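(* Let $-\infty\le a<b_0\le\infty$, $a<b_1\le\infty$, and for $j=0,1$ let $q_j\in L^1_{\mathrm{loc}}(a,b_j)$ be real-valued, let $H_j$ be a self-adjoint operator on $L^2(a,b_j)$ associated with $-\frac{d^2}{dx^2}+q_j$ with separated boundary conditions, let $\theta_j(z,x),\phi_j(z,x)$ be a real entire fundamental system of solutions of $-u''+q_ju=zu$ with $W(\theta_j,\phi_j)=1$ such that $\phi_j(z,x)$ lies in the domain of $H_j$ near $a$, and let $M_j(z)$ be the associated singular Weyl function. Suppose $\theta_0(z,x)$, $\theta_1(z,x)$, $\phi_0(z,x)$, $\phi_1(z,x)$ are of growth order at most $s$ for some $s>0$, and that $\phi_1(z,x)\sim\phi_0(z,x)$ for one $x\in(a,b_0)\cap(a,b_1)$ as $|z|\to\infty$ along some nonreal rays dissecting the complex plane into sectors of opening angles less than $\pi/s$. Then for each $c\in(a,b_0)\cap(a,b_1)$ the following properties are equivalent: (i) $q_0(x)=q_1(x)$ for almost all $x\in(a,c)$ and $W(\phi_0,\phi_1)(a)=0$. (ii) For each $\delta>0$ there is an entire function $f(z)$ of growth order at most $s$ such that $$M_1(z)-M_0(z)=f(z)+\mathcal{O}\left(\frac{1}{\sqrt{-z}\,\phi_0(z,c)^2}\right)$$ as $|z|\to\infty$ in the sector $|\mathrm{Im}(z)|\ge\delta\,|\mathrm{Re}(z)|$. (iii) For each $d\in(a,c)$ there is an entire function $f(z)$ of growth order at most $s$ such that $$M_1(z)-M_0(z)=f(z)+\mathcal{O}\left(\frac{1}{\phi_0(z,d)^2}\right)$$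 as $|z|\to\infty$ along the given nonreal rays.
   Context: A solution $u(z,x)$ of $-u''+q_ju=zu$ is called real entire if $u(\cdot,x)$ and $u'(\cdot,x)$ (prime denotes $d/dx$) are entire functions, real on the real axis, for every $x$. It is of growth order at most $s$ if, for all $x$ in the interval, both entire functions $u(\cdot,x)$ and $u'(\cdot,x)$ are of growth order at most $s$. It lies in the domain of $H_j$ near $a$ if it is square integrable near $a$ and satisfies the boundary condition of $H_j$ at $a$ (if any). $W(u,v)=u v'-u'v$ is the Wronskian, and $W(\phi_0,\phi_1)(a)$ denotes the limit of $W(\phi_0(z),\phi_1(z))(x)$ as $x\downarrow a$ (for $z\in\mathbb{C}$). The singular Weyl function is $$M_j(z)=-\frac{W(\theta_j(z),u_{j,+}(z))}{W(\phi_j(z),u_{j,+}(z))},\qquad z\in\mathbb{C}\setminus\mathbb{R},$$ where $u_{j,+}(z,x)$ is a nontrivial solution of $-u''+q_ju=zu$ that is square integrable near $b_j$ and satisfies the boundary condition of $H_j$ at $b_j$ (if any). The notation $\phi_1(z,x)\sim\phi_0(z,x)$ means $\phi_1(z,x)=\phi_0(z,x)(1+o(1))$ in the specified limit. Nonreal rays are rays from the origin not contained in the real axis. $\sqrt{\cdot}$ is the principal square root with branch cut along the negative real axis. *)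

theory Defs
  imports "HOL-Complex_Analysis.Complex_Analysis" "HOL-Library.Landau_Symbols"
begin

section \<open>The differential expression\<close>

definition loc_integrable :: "real set \<Rightarrow> (real \<Rightarrow> 'a::euclidean_space) \<Rightarrow> bool" where
  "loc_integrable S g \<longleftrightarrow> (\<forall>K. compact K \<and> K \<subseteq> S \<longrightarrow> g absolutely_integrable_on K)"

text \<open>Local absolute continuity on an interval \<open>S\<close>, defined as being a primitive of a locally
  Lebesgue integrable function.\<close>

definition AC_loc :: "real set \<Rightarrow> (real \<Rightarrow> complex) \<Rightarrow> bool" where
  "AC_loc S f \<longleftrightarrow>
     (\<exists>g. loc_integrable S g \<and> (\<forall>x\<in>S. \<forall>y\<in>S. x \<le> y \<longrightarrow> (g has_integral (f y - f x)) {x..y}))"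

abbreviation dx :: "(real \<Rightarrow> complex) \<Rightarrow> real \<Rightarrow> complex" where
  "dx f \<equiv> (\<lambda>x. vector_derivative f (at x))"

definition wronskian :: "(real \<Rightarrow> complex) \<Rightarrow> (real \<Rightarrow> complex) \<Rightarrow> real \<Rightarrow> complex" where
  "wronskian u v x = u x * dx v x - dx u x * v x"

text \<open>The functions to which the differential expression \<open>- d\<^sup>2/dx\<^sup>2 + q\<close> can be applied:
  \<open>f\<close> and \<open>f'\<close> are locally absolutely continuous. For these, \<open>dx (dx f)\<close> is the second derivative
  almost everywhere; its arbitrary values on the exceptional null set never matter, since
  \<open>sl_expr q f\<close> is only used up to almost everywhere equality.\<close>

definition sl_regular :: "real set \<Rightarrow> (real \<Rightarrow> complex) \<Rightarrow> bool" where
  "sl_regular S f \<longleftrightarrow> (\<forall>x\<in>S. f differentiable (at x)) \<and> AC_loc S f \<and> AC_loc S (dx f)"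

definition sl_expr :: "(real \<Rightarrow> real) \<Rightarrow> (real \<Rightarrow> complex) \<Rightarrow> real \<Rightarrow> complex" where
  "sl_expr q f x = - dx (dx f) x + of_real (q x) * f x"

definition sl_solution ::
  "real set \<Rightarrow> (real \<Rightarrow> real) \<Rightarrow> complex \<Rightarrow> (real \<Rightarrow> complex) \<Rightarrow> bool" where
  "sl_solution S q z u \<longleftrightarrow>
     sl_regular S u \<and> (AE x in lebesgue_on S. sl_expr q u x = z * u x)"


section \<open>Square integrability and self-adjointness\<close>

definition L2 :: "real set \<Rightarrow> (real \<Rightarrow> complex) \<Rightarrow> bool" where
  "L2 S f \<longleftrightarrow> f \<in> borel_measurable (lebesgue_on S) \<and>
     integrable (lebesgue_on S) (\<lambda>x. (cmod (f x))\<^sup>2)"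

definition L2_inner :: "real set \<Rightarrow> (real \<Rightarrow> complex) \<Rightarrow> (real \<Rightarrow> complex) \<Rightarrow> complex" where
  "L2_inner S f g = (\<integral>x. cnj (f x) * g x \<partial>lebesgue_on S)"

text \<open>Operators in \<open>L\<^sup>2(S)\<close> are given by their graphs. A graph is a set of pairs of
  representatives, and the graphs below contain with a pair of functions all pairs that agree
  with it almost everywhere on \<open>S\<close>.\<close>

type_synonym L2_graph = "((real \<Rightarrow> complex) \<times> (real \<Rightarrow> complex)) set"

definition adjoint_graph :: "real set \<Rightarrow> L2_graph \<Rightarrow> L2_graph" where
  "adjoint_graph S G =
     {(g, k). L2 S g \<and> L2 S k \<and> (\<forall>(f, h)\<in>G. L2_inner S g h = L2_inner S k f)}"

definition densely_defined :: "real set \<Rightarrow> L2_graph \<Rightarrow> bool" where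
  "densely_defined S G \<longleftrightarrow>
     (\<forall>g. L2 S g \<longrightarrow> (\<forall>\<epsilon>>0. \<exists>(f, h)\<in>G. (\<integral>x. (cmod (g x - f x))\<^sup>2 \<partial>lebesgue_on S) < \<epsilon>))"

definition self_adjoint :: "real set \<Rightarrow> L2_graph \<Rightarrow> bool" where
  "self_adjoint S G \<longleftrightarrow> densely_defined S G \<and> adjoint_graph S G = G"


section \<open>Endpoints and separated boundary conditions\<close>

text \<open>Endpoints are extended reals; limits at them are limits of functions on the reals along
  the following filters (compare the fundamental theorem of calculus for interval integrals).\<close>

definition to_left_end :: "ereal \<Rightarrow> real filter" where
  "to_left_end a = filtermap real_of_ereal (at_right a)"

definition to_right_end :: "ereal \<Rightarrow> real filter" where
  "to_right_end b = filtermap real_of_ereal (at_left b)"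

definition L2_near_left :: "ereal \<Rightarrow> ereal \<Rightarrow> (real \<Rightarrow> complex) \<Rightarrow> bool" where
  "L2_near_left a b f \<longleftrightarrow> (\<exists>c\<in>einterval a b. L2 (einterval a (ereal c)) f)"

definition L2_near_right :: "ereal \<Rightarrow> ereal \<Rightarrow> (real \<Rightarrow> complex) \<Rightarrow> bool" where
  "L2_near_right a b f \<longleftrightarrow> (\<exists>c\<in>einterval a b. L2 (einterval (ereal c) b) f)"

definition limit_circle_left :: "ereal \<Rightarrow> ereal \<Rightarrow> (real \<Rightarrow> real) \<Rightarrow> bool" where
  "limit_circle_left a b q \<longleftrightarrow>
     (\<forall>z u. sl_solution (einterval a b) q z u \<longrightarrow> L2_near_left a b u)"

definition limit_circle_right :: "ereal \<Rightarrow> ereal \<Rightarrow> (real \<Rightarrow> real) \<Rightarrow> bool" where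
  "limit_circle_right a b q \<longleftrightarrow>
     (\<forall>z u. sl_solution (einterval a b) q z u \<longrightarrow> L2_near_right a b u)"

definition sl_max_domain :: "ereal \<Rightarrow> ereal \<Rightarrow> (real \<Rightarrow> real) \<Rightarrow> (real \<Rightarrow> complex) set" where
  "sl_max_domain a b q =
     {f. sl_regular (einterval a b) f \<and> L2 (einterval a b) f \<and> L2 (einterval a b) (sl_expr q f)}"

text \<open>A boundary condition at an endpoint is either absent (\<open>None\<close>) or of the form \<open>W(v, f) = 0\<close>
  at that endpoint (\<open>Some v\<close>). The endpoint is represented by its filter \<open>F\<close>.\<close>

type_synonym boundary_condition = "(real \<Rightarrow> complex) option"

definition satisfies_bc :: "real filter \<Rightarrow> boundary_condition \<Rightarrow> (real \<Rightarrow> complex) \<Rightarrow> bool" where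
  "satisfies_bc F \<beta> f \<longleftrightarrow>
     (case \<beta> of None \<Rightarrow> True | Some v \<Rightarrow> (wronskian v f \<longlongrightarrow> 0) F)"

text \<open>There is a boundary condition exactly at limit circle endpoints. There \<open>v\<close> lies in the
  maximal domain \<open>D\<close>, satisfies \<open>W(v, v\<^sup>*) = 0\<close> at the endpoint, and \<open>W(v, g)\<close> does not vanish
  there for some \<open>g\<close> in \<open>D\<close>.\<close>

definition admissible_bc ::
  "real filter \<Rightarrow> bool \<Rightarrow> (real \<Rightarrow> complex) set \<Rightarrow> boundary_condition \<Rightarrow> bool" where
  "admissible_bc F limit_circle D \<beta> \<longleftrightarrow>
     (case \<beta> of
        None \<Rightarrow> \<not> limit_circle
      | Some v \<Rightarrow> limit_circle \<and> v \<in> D \<and> (wronskian v (\<lambda>x. cnj (v x)) \<longlongrightarrow> 0) F \<and>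
          (\<exists>g\<in>D. \<not> (wronskian v g \<longlongrightarrow> 0) F))"

definition sl_domain :: "ereal \<Rightarrow> ereal \<Rightarrow> (real \<Rightarrow> real) \<Rightarrow>
    boundary_condition \<Rightarrow> boundary_condition \<Rightarrow> (real \<Rightarrow> complex) set" where
  "sl_domain a b q \<alpha> \<beta> =
     {f \<in> sl_max_domain a b q.
        satisfies_bc (to_left_end a) \<alpha> f \<and> satisfies_bc (to_right_end b) \<beta> f}"

definition sl_operator :: "ereal \<Rightarrow> ereal \<Rightarrow> (real \<Rightarrow> real) \<Rightarrow>
    boundary_condition \<Rightarrow> boundary_condition \<Rightarrow> L2_graph" where
  "sl_operator a b q \<alpha> \<beta> =
     {(f, h). L2 (einterval a b) f \<and> L2 (einterval a b) h \<and>
        (\<exists>f0\<in>sl_domain a b q \<alpha> \<beta>.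
           (AE x in lebesgue_on (einterval a b). f x = f0 x) \<and>
           (AE x in lebesgue_on (einterval a b). h x = sl_expr q f0 x))}"

text \<open>The operator \<open>H = sl_operator a b q \<alpha> \<beta>\<close> is a self-adjoint realization of
  \<open>- d\<^sup>2/dx\<^sup>2 + q\<close> in \<open>L\<^sup>2(a, b)\<close> with separated boundary conditions \<open>\<alpha>\<close> (at \<open>a\<close>) and \<open>\<beta>\<close> (at \<open>b\<close>).\<close>

definition separated_self_adjoint :: "ereal \<Rightarrow> ereal \<Rightarrow> (real \<Rightarrow> real) \<Rightarrow>
    boundary_condition \<Rightarrow> boundary_condition \<Rightarrow> bool" where
  "separated_self_adjoint a b q \<alpha> \<beta> \<longleftrightarrow>
     admissible_bc (to_left_end a) (limit_circle_left a b q) (sl_max_domain a b q) \<alpha> \<and>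
     admissible_bc (to_right_end b) (limit_circle_right a b q) (sl_max_domain a b q) \<beta> \<and>
     self_adjoint (einterval a b) (sl_operator a b q \<alpha> \<beta>)"

definition in_domain_near_left ::
  "ereal \<Rightarrow> ereal \<Rightarrow> boundary_condition \<Rightarrow> (real \<Rightarrow> complex) \<Rightarrow> bool" where
  "in_domain_near_left a b \<alpha> u \<longleftrightarrow> L2_near_left a b u \<and> satisfies_bc (to_left_end a) \<alpha> u"

definition in_domain_near_right ::
  "ereal \<Rightarrow> ereal \<Rightarrow> boundary_condition \<Rightarrow> (real \<Rightarrow> complex) \<Rightarrow> bool" where
  "in_domain_near_right a b \<beta> u \<longleftrightarrow> L2_near_right a b u \<and> satisfies_bc (to_right_end b) \<beta> u"


section \<open>Real entire solutions, growth order, singular Weyl function\<close>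

text \<open>The growth order of an entire function is the infimum of all \<open>\<rho> \<ge> 0\<close> with
  \<open>\<bar>f(z)\<bar> = O(exp(\<bar>z\<bar>\<^sup>\<rho>))\<close>; it is infinite if there is no such \<open>\<rho>\<close>.\<close>

definition growth_order :: "(complex \<Rightarrow> complex) \<Rightarrow> ereal" where
  "growth_order f =
     Inf {ereal \<rho> |\<rho>. 0 \<le> \<rho> \<and>
            (\<lambda>z. cmod (f z)) \<in> O[at_infinity](\<lambda>z. exp (cmod z powr \<rho>))}"

definition real_entire_solution ::
  "real set \<Rightarrow> (real \<Rightarrow> real) \<Rightarrow> (complex \<Rightarrow> real \<Rightarrow> complex) \<Rightarrow> bool" where
  "real_entire_solution S q u \<longleftrightarrow>
     (\<forall>z. sl_solution S q z (u z)) \<and>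
     (\<forall>x\<in>S. (\<lambda>z. u z x) holomorphic_on UNIV \<and> (\<lambda>z. dx (u z) x) holomorphic_on UNIV \<and>
        (\<forall>z\<in>\<real>. u z x \<in> \<real> \<and> dx (u z) x \<in> \<real>))"

definition real_entire_system :: "real set \<Rightarrow> (real \<Rightarrow> real) \<Rightarrow>
    (complex \<Rightarrow> real \<Rightarrow> complex) \<Rightarrow> (complex \<Rightarrow> real \<Rightarrow> complex) \<Rightarrow> bool" where
  "real_entire_system S q \<theta> \<phi> \<longleftrightarrow>
     real_entire_solution S q \<theta> \<and> real_entire_solution S q \<phi> \<and>
     (\<forall>z. \<forall>x\<in>S. wronskian (\<theta> z) (\<phi> z) x = 1)"

definition solution_order_le ::
  "real set \<Rightarrow> (complex \<Rightarrow> real \<Rightarrow> complex) \<Rightarrow> real \<Rightarrow> bool" where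
  "solution_order_le S u s \<longleftrightarrow>
     (\<forall>x\<in>S. growth_order (\<lambda>z. u z x) \<le> ereal s \<and> growth_order (\<lambda>z. dx (u z) x) \<le> ereal s)"

definition weyl_solution_right :: "ereal \<Rightarrow> ereal \<Rightarrow> (real \<Rightarrow> real) \<Rightarrow> boundary_condition \<Rightarrow>
    complex \<Rightarrow> (real \<Rightarrow> complex) \<Rightarrow> bool" where
  "weyl_solution_right a b q \<beta> z u \<longleftrightarrow>
     sl_solution (einterval a b) q z u \<and> (\<exists>x\<in>einterval a b. u x \<noteq> 0) \<and>
     in_domain_near_right a b \<beta> u"

text \<open>The Wronskians are constant in \<open>x\<close>, and the Weyl solution at \<open>b\<close> is unique up to a
  constant factor, so this determines \<open>M\<close> on the nonreal numbers.\<close>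

definition singular_weyl_function :: "ereal \<Rightarrow> ereal \<Rightarrow> (real \<Rightarrow> real) \<Rightarrow> boundary_condition \<Rightarrow>
    (complex \<Rightarrow> real \<Rightarrow> complex) \<Rightarrow> (complex \<Rightarrow> real \<Rightarrow> complex) \<Rightarrow> (complex \<Rightarrow> complex) \<Rightarrow> bool" where
  "singular_weyl_function a b q \<beta> \<theta> \<phi> M \<longleftrightarrow>
     (\<forall>z. z \<notin> \<real> \<longrightarrow>
        (\<exists>u. weyl_solution_right a b q \<beta> z u \<and>
           (\<forall>x\<in>einterval a b. M z = - wronskian (\<theta> z) u x / wronskian (\<phi> z) u x)))"


section \<open>Asymptotics along rays and in sectors\<close>

definition ray :: "real \<Rightarrow> complex set" where
  "ray t = {of_real r * cis t |r. 0 < r}"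

text \<open>\<open>R\<close> is the union of finitely many (at least one) nonreal rays, at successive angles
  \<open>t 0 < t 1 < \<dots> < t n = t 0 + 2 \<pi>\<close>, which cut the plane into sectors of opening angle less
  than \<open>\<omega>\<close>.\<close>

definition dissecting_rays :: "real \<Rightarrow> complex set \<Rightarrow> bool" where
  "dissecting_rays \<omega> R \<longleftrightarrow>
     (\<exists>(n::nat) (t::nat \<Rightarrow> real). t n = t 0 + 2 * pi \<and>
        (\<forall>k<n. t k < t (Suc k) \<and> t (Suc k) - t k < \<omega> \<and> \<not> ray (t k) \<subseteq> \<real>) \<and>
        R = (\<Union>k<n. ray (t k)))"

definition at_infinity_along :: "complex set \<Rightarrow> complex filter" where
  "at_infinity_along A = inf at_infinity (principal A)"

end

theory Submission
  imports Defs "HOL-Real_Asymp.Real_Asymp"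
begin

text \<open>Write \<open>k = \<surd>(-z)\<close>. Self-adjointness of \<open>H\<^sub>j\<close> applied to cut-off solutions shows that \<open>\<phi>\<^sub>j'/\<phi>\<^sub>j\<close> and
  \<open>u\<^sub>+'/u\<^sub>+\<close> lie in opposite half-planes for nonreal \<open>z\<close>. Feeding this into the Volterra equation gives
  \<open>\<phi>\<^sub>j'/\<phi>\<^sub>j \<sim> k\<close> and \<open>\<phi>\<^sub>j(z,y)/\<phi>\<^sub>j(z,x) \<sim> exp(k(y - x))\<close> in sectors, and hence
  \<open>\<phi>\<^sub>j (\<theta>\<^sub>j + M\<^sub>j \<phi>\<^sub>j) = O(1/k)\<close> for the diagonal of the Green function.

  If (i) holds, \<open>W(\<phi>\<^sub>0,\<phi>\<^sub>1) = 0\<close> on \<open>(a,c]\<close>, so \<open>\<phi>\<^sub>1/\<phi>\<^sub>0 = W(\<theta>\<^sub>0,\<phi>\<^sub>1)\<close> is entire of order at most \<open>s\<close> and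
  tends to 1 along the rays; it is 1 by Phragmen-Lindelof, and (ii) holds with \<open>f = - W(\<theta>\<^sub>0,\<theta>\<^sub>1)\<close>.
  That (ii) implies (iii) follows from the exponential growth of \<open>\<phi>\<^sub>0\<close> in \<open>x\<close>. If (iii) holds, the entire
  function \<open>\<phi>\<^sub>1 \<theta>\<^sub>0 - \<phi>\<^sub>0 \<theta>\<^sub>1 - f \<phi>\<^sub>0 \<phi>\<^sub>1\<close>, taken at a point left of the one to which \<open>f\<close> belongs,
  tends to 0 along the rays and therefore vanishes; differentiating the resulting identity in \<open>x\<close> gives
  \<open>\<phi>\<^sub>0\<^sup>2 = \<phi>\<^sub>1\<^sup>2\<close> and with it (i).\<close>

section \<open>Locally absolutely continuous functions\<close>

text \<open>The endpoint \<open>a\<close> may be singular or infinite and \<open>\<phi>\<close> has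
  no normalisation there, so the Volterra equation is started at an interior point
  \<open>x0\<close>. The only information used at \<open>x0\<close> is the sign of
  \<open>Im (\<phi>'/\<phi>)\<close>. It agrees with the sign of \<open>Im k\<close>, which keeps
  \<open>\<phi>'/\<phi>\<close> away from \<open>- k\<close> and bounds the decaying amplitude by
  the growing one; the unknown growing amplitude cancels in all quotients. For the Weyl solution the
  sign alone is enough: it makes the imaginary parts in \<open>\<phi>'/\<phi> - u'/u\<close> add up.
  The signs come from the reality of \<open><f, H f>\<close>. A solution is known to lie in the
  domain near one end only, hence the cutoff. Where the cutoff is constant one has
  \<open>H f = z f\<close>, so there remain only a norm near that end and a boundary term at an
  interior point; no limit at an endpoint has to be computed. The step from (iii) to (i) rests on
  \<open>(\<theta>/\<phi>)' = - 1/\<phi>^2\<close>: for nonreal \<open>z\<close> the identity says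
  that \<open>\<theta>0/\<phi>0 - \<theta>1/\<phi>1\<close> equals \<open>f\<close>, which does not
  depend on \<open>x\<close>.\<close>

lemma AE_lebesgue_on_negligible_iff:
  assumes "S \<in> sets lebesgue"
  shows "(AE x in lebesgue_on S. P x) \<longleftrightarrow> (\<exists>N. negligible N \<and> (\<forall>x\<in>S - N. P x))"
proof -
  have "(AE x in lebesgue_on S. P x) \<longleftrightarrow> (AE x in lebesgue. x \<in> S \<longrightarrow> P x)"
    using assms by (intro AE_restrict_space_iff) auto
  also have "\<dots> \<longleftrightarrow> (\<exists>N\<in>null_sets lebesgue. {x. \<not> (x \<in> S \<longrightarrow> P x)} \<subseteq> N)"
    by (simp add: eventually_ae_filter)
  also have "\<dots> \<longleftrightarrow> (\<exists>N. negligible N \<and> (\<forall>x\<in>S - N. P x))"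
    unfolding Bex_def negligible_iff_null_sets[symmetric] by (intro ex_cong1) blast
  finally show ?thesis .
qed

lemma einterval_lebesgue [simp]: "einterval a b \<in> sets lebesgue"
  using borel_einterval by (metis sets_completionI_sets sets_lborel)

lemma Icc_subset_einterval:
  assumes "x \<in> einterval a b" "y \<in> einterval a b"
  shows "{x..y} \<subseteq> einterval a b"
proof
  fix t assume "t \<in> {x..y}"
  then have "ereal x \<le> ereal t" "ereal t \<le> ereal y" by auto
  moreover have "a < ereal x" "ereal y < b" using assms by (auto simp: einterval_def)
  ultimately show "t \<in> einterval a b" unfolding einterval_def mem_Collect_eq by (meson less_le_trans le_less_trans)
qed

text \<open>Lebesgue differentiation for gauge integrals, over intervals with \<open>x\<close> as
  left endpoint. The bound is multiplied out by \<open>h\<close> because the two-sided version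
  verifies the derivative in exactly this form.\<close>

lemma indefinite_integral_ae_right_derivative:
  fixes g :: "real \<Rightarrow> 'b::euclidean_space"
  assumes "\<And>x y. g integrable_on {x..y}"
  obtains N where "negligible N"
    "\<And>x e. x \<notin> N \<Longrightarrow> 0 < e \<Longrightarrow> \<exists>d>0. \<forall>h. 0 < h \<and> h < d \<longrightarrow>
        norm (integral {x..x+h} g - h *\<^sub>R g x) \<le> e * h"
proof -
  have "\<And>x y. g integrable_on cbox x y" using assms by simp
  then obtain N where N: "negligible N"
    "\<And>x e. x \<notin> N \<Longrightarrow> 0 < e \<Longrightarrow> \<exists>d>0. \<forall>h. 0 < h \<and> h < d \<longrightarrow>
        norm (integral (cbox x (x + h *\<^sub>R One)) g /\<^sub>R h ^ DIM(real) - g x) < e"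
    by (rule integrable_ccontinuous_explicit) blast
  show thesis
  proof (rule that[OF N(1)])
    fix x e :: real assume xe: "x \<notin> N" "0 < e"
    obtain d where d: "d > 0" "\<And>h. 0 < h \<and> h < d \<Longrightarrow> norm (integral {x..x+h} g /\<^sub>R h - g x) < e"
      using N(2)[OF xe] by auto
    have "norm (integral {x..x+h} g - h *\<^sub>R g x) \<le> e * h" if h: "0 < h" "h < d" for h
    proof -
      have "integral {x..x+h} g - h *\<^sub>R g x = h *\<^sub>R (integral {x..x+h} g /\<^sub>R h - g x)"
        using h by (simp add: scaleR_diff_right)
      then have "norm (integral {x..x+h} g - h *\<^sub>R g x) = h * norm (integral {x..x+h} g /\<^sub>R h - g x)"
        using h by simp
      also have "\<dots> \<le> h * e" using d(2)[of h] h by (intro mult_left_mono) auto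
      finally show ?thesis by (simp add: mult.commute)
    qed
    then show "\<exists>d>0. \<forall>h. 0 < h \<and> h < d \<longrightarrow> norm (integral {x..x+h} g - h *\<^sub>R g x) \<le> e * h"
      using d(1) by blast
  qed
qed

text \<open>The one-sided statement is applied to \<open>g\<close> and to its reflection
  \<open>t \<mapsto> g (- t)\<close>; the second application yields the derivative from the left
  outside a reflected null set.\<close>

lemma indefinite_integral_ae_derivative_Icc:
  fixes g :: "real \<Rightarrow> 'b::euclidean_space"
  assumes "g integrable_on {l..u}"
    and F: "\<And>x y. l \<le> x \<Longrightarrow> x \<le> y \<Longrightarrow> y \<le> u \<Longrightarrow> (g has_integral (F y - F x)) {x..y}"
  shows "\<exists>N. negligible N \<and> (\<forall>x\<in>{l<..<u} - N. (F has_vector_derivative g x) (at x))"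
proof -
  \<comment> \<open>Extension by zero, because the one-sided lemma asks for integrability over every
    interval.\<close>
  define g0 where "g0 = (\<lambda>x. if x \<in> {l..u} then g x else 0)"
  have int: "g0 integrable_on {x..y}" for x y
  proof -
    have "g integrable_on ({l..u} \<inter> {x..y})"
      unfolding Int_atLeastAtMost by (rule integrable_on_subinterval[OF assms(1)]) auto
    then show ?thesis
      unfolding g0_def integrable_restrict_Int .
  qed
  have int': "(\<lambda>t. g0 (- t)) integrable_on {x..y}" for x y
    using int[of "- y" "- x"] Henstock_Kurzweil_Integration.integrable_reflect_real[of g0 "- x" "- y"] by simp
  obtain N1 where N1: "negligible N1"
    "\<And>x e. x \<notin> N1 \<Longrightarrow> 0 < e \<Longrightarrow> \<exists>d>0. \<forall>h. 0 < h \<and> h < d \<longrightarrow>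
        norm (integral {x..x+h} g0 - h *\<^sub>R g0 x) \<le> e * h"
    using indefinite_integral_ae_right_derivative[OF int] by blast
  obtain N2 where N2: "negligible N2"
    "\<And>x e. x \<notin> N2 \<Longrightarrow> 0 < e \<Longrightarrow> \<exists>d>0. \<forall>h. 0 < h \<and> h < d \<longrightarrow>
        norm (integral {x..x+h} (\<lambda>t. g0 (- t)) - h *\<^sub>R g0 (- x)) \<le> e * h"
    using indefinite_integral_ae_right_derivative[OF int'] by blast
  have neg: "negligible (N1 \<union> uminus ` N2)"
    using N1(1) N2(1) by (intro negligible_Un negligible_differentiable_image_negligible) (auto intro!: derivative_intros)
  have der: "(F has_vector_derivative g x) (at x)" if x: "x \<in> {l<..<u} - (N1 \<union> uminus ` N2)" for x
  proof -
    have gx: "g0 x = g x" using x by (simp add: g0_def)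
    have x2: "- x \<notin> N2" using x by force
    have Fint: "integral {v..w} g0 = F w - F v" if "l \<le> v" "v \<le> w" "w \<le> u" for v w
    proof -
      have "(g0 has_integral (F w - F v)) {v..w}"
        using F[OF that] that by (rule_tac has_integral_eq[rotated]) (auto simp: g0_def)
      then show ?thesis by (rule integral_unique)
    qed
    have Fint': "integral {-x..-x+h} (\<lambda>t. g0 (- t)) = F x - F (x - h)" if "0 < h" "h < x - l" for h
    proof -
      have "(g0 has_integral (F x - F (x - h))) {x-h..x}"
        using F[of "x - h" x] that x by (rule_tac has_integral_eq[rotated]) (auto simp: g0_def)
      then have "((\<lambda>t. g0 (- t)) has_integral (F x - F (x - h))) {-x..-(x-h)}"
        using has_integral_reflect_real[of g0 "F x - F (x - h)" x "x - h"] by auto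
      then show ?thesis by (simp add: integral_unique)
    qed
    show ?thesis
      unfolding has_vector_derivative_def has_derivative_at_alt
    proof (intro conjI allI impI)
      fix e :: real assume e: "0 < e"
      obtain d1 where d1: "d1 > 0" "\<And>h. 0 < h \<and> h < d1 \<Longrightarrow> norm (integral {x..x+h} g0 - h *\<^sub>R g0 x) \<le> e * h"
        using N1(2)[of x e] x e by blast
      obtain d2 where d2: "d2 > 0" "\<And>h. 0 < h \<and> h < d2 \<Longrightarrow>
          norm (integral {-x..-x+h} (\<lambda>t. g0 (- t)) - h *\<^sub>R g0 (-(-x))) \<le> e * h"
        using N2(2)[OF x2 e] by blast
      define d where "d = min (min d1 d2) (min (x - l) (u - x))"
      have "d > 0" using d1 d2 x by (simp add: d_def)
      moreover have "norm (F y - F x - (y - x) *\<^sub>R g x) \<le> e * norm (y - x)" if y: "norm (y - x) < d" for y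
      proof (cases y x rule: linorder_cases)
        case equal
        then show ?thesis by simp
      next
        case greater
        then show ?thesis
          using d1(2)[of "y - x"] y Fint[of x y] x gx by (simp add: d_def)
      next
        case less
        have "norm (F x - F y - (x - y) *\<^sub>R g x) \<le> e * (x - y)"
          using d2(2)[of "x - y"] y Fint'[of "x - y"] x gx less by (simp add: d_def)
        moreover have "norm (F y - F x - (y - x) *\<^sub>R g x) = norm (F x - F y - (x - y) *\<^sub>R g x)"
          by (subst norm_minus_cancel[symmetric]) (simp add: algebra_simps)
        ultimately show ?thesis using less by simp
      qed
      ultimately show "\<exists>d>0. \<forall>y. norm (y - x) < d \<longrightarrow> norm (F y - F x - (y - x) *\<^sub>R g x) \<le> e * norm (y - x)"
        by blast
    qed (rule bounded_linear_scaleR_left)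
  qed
  show ?thesis using neg der by blast
qed

text \<open>Local integrability gives one null set for each compact interval. Intervals with
  rational endpoints suffice to cover \<open>S\<close>, and being countable they keep the union of
  the null sets null.\<close>

lemma primitive_ae_derivative:
  fixes g :: "real \<Rightarrow> 'b::euclidean_space"
  assumes S: "open S" and g: "loc_integrable S g"
    and F: "\<And>x y. {x..y} \<subseteq> S \<Longrightarrow> x \<le> y \<Longrightarrow> (g has_integral (F y - F x)) {x..y}"
  shows "\<exists>N. negligible N \<and> (\<forall>x\<in>S - N. (F has_vector_derivative g x) (at x))"
proof -
  define I where "I = {(p, q). p \<in> \<rat> \<and> q \<in> \<rat> \<and> {p..q} \<subseteq> S}"
  have "countable I"
    by (rule countable_subset[of _ "\<rat> \<times> \<rat>"]) (auto simp: I_def countable_rat)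
  have "\<forall>i\<in>I. \<exists>N. negligible N \<and> (\<forall>x\<in>{fst i<..<snd i} - N. (F has_vector_derivative g x) (at x))"
  proof
    fix i assume i: "i \<in> I"
    have sub: "{fst i..snd i} \<subseteq> S" using i by (auto simp: I_def)
    then have "g absolutely_integrable_on {fst i..snd i}" using g by (simp add: loc_integrable_def)
    then have "g integrable_on {fst i..snd i}" by (rule set_lebesgue_integral_eq_integral(1))
    then show "\<exists>N. negligible N \<and> (\<forall>x\<in>{fst i<..<snd i} - N. (F has_vector_derivative g x) (at x))"
      using sub by (intro indefinite_integral_ae_derivative_Icc F) auto
  qed
  then obtain N where N: "\<And>i. i \<in> I \<Longrightarrow> negligible (N i)"
    "\<And>i x. i \<in> I \<Longrightarrow> x \<in> {fst i<..<snd i} - N i \<Longrightarrow> (F has_vector_derivative g x) (at x)"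
    by metis
  have "negligible (\<Union>i\<in>I. N i)"
    using \<open>countable I\<close> N(1) by (intro negligible_countable_Union) auto
  moreover have "(F has_vector_derivative g x) (at x)" if x: "x \<in> S - (\<Union>i\<in>I. N i)" for x
  proof -
    obtain e where e: "0 < e" "ball x e \<subseteq> S" using S x by (auto simp: open_contains_ball)
    obtain p where p: "p \<in> \<rat>" "x - e < p" "p < x" using Rats_dense_in_real[of "x - e" x] e by auto
    obtain q where q: "q \<in> \<rat>" "x < q" "q < x + e" using Rats_dense_in_real[of x "x + e"] e by auto
    have "{p..q} \<subseteq> ball x e" using p q by (auto simp: dist_real_def)
    then have "(p, q) \<in> I" using e p q by (auto simp: I_def)
    then show ?thesis using N(2)[of "(p, q)" x] x p q by auto
  qed
  ultimately show ?thesis by blast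
qed

section \<open>Integration by parts\<close>

lemma has_integral_mult_primitive_C1:
  fixes g h k k' :: "real \<Rightarrow> complex"
  assumes xy: "x \<le> y" and g: "g absolutely_integrable_on {x..y}"
    and h: "\<And>s t. x \<le> s \<Longrightarrow> s \<le> t \<Longrightarrow> t \<le> y \<Longrightarrow> (g has_integral (h t - h s)) {s..t}"
    and k: "\<And>t. t \<in> {x..y} \<Longrightarrow> (k has_vector_derivative k' t) (at t within {x..y})"
    and k': "continuous_on {x..y} k'"
  shows "((\<lambda>t. g t * k t + h t * k' t) has_integral (h y * k y - h x * k x)) {x..y}"
proof -
  define w where "w = (\<lambda>t. g t * k t + h t * k' t)"
  have contk: "continuous_on {x..y} k"
    unfolding continuous_on_eq_continuous_within using has_vector_derivative_continuous[OF k] by blast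
  have conth: "continuous_on {x..y} h"
  proof -
    have "continuous_on {x..y} (\<lambda>t. h x + integral {x..t} g)"
      using g by (intro continuous_intros indefinite_integral_continuous_1 set_lebesgue_integral_eq_integral(1))
    moreover have "h x + integral {x..t} g = h t" if "t \<in> {x..y}" for t
      using h[of x t] that by (simp add: integral_unique)
    ultimately show ?thesis by (rule continuous_on_eq) simp
  qed
  have gk: "(\<lambda>t. k t * g t) absolutely_integrable_on {x..y}"
    by (rule absolutely_integrable_bounded_measurable_product[OF _ _ _ _ g])
      (auto simp: bilinear_conv_bounded_bilinear intro!: bounded_bilinear_mult continuous_imp_measurable_on_sets_lebesgue contk compact_imp_bounded compact_continuous_image)
  have w: "w integrable_on {x..y}"
    unfolding w_def
  proof (rule integrable_add)
    show "(\<lambda>t. g t * k t) integrable_on {x..y}"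
      using set_lebesgue_integral_eq_integral(1)[OF gk] by (simp add: mult.commute)
    show "(\<lambda>t. h t * k' t) integrable_on {x..y}"
      by (intro integrable_continuous_real continuous_intros conth k')
  qed
  have wsub: "w integrable_on {s..t}" if "x \<le> s" "t \<le> y" for s t
    by (rule integrable_on_subinterval[OF w]) (use that in auto)
  have ng: "(\<lambda>t. norm (g t)) integrable_on {x..y}"
    using g unfolding absolutely_integrable_on_def by blast
  obtain K where "\<forall>t\<in>{x..y}. norm (k' t) \<le> K"
    using compact_imp_bounded[OF compact_continuous_image[OF k' compact_Icc]] by (auto simp: bounded_iff)
  then have K: "\<And>t. t \<in> {x..y} \<Longrightarrow> norm (k' t) \<le> K" by blast
  define m where "m = (\<lambda>t. norm (g t) + K)"
  have m: "m integrable_on {x..y}" unfolding m_def by (intro integrable_add ng integrable_const_ivl)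
  have msub: "m integrable_on {s..t}" if "x \<le> s" "t \<le> y" for s t
    by (rule integrable_on_subinterval[OF m]) (use that in auto)
  have small: "norm (h y * k y - h x * k x - integral {x..y} w) \<le> e * integral {x..y} m" if e: "0 < e" for e
  proof -
    obtain d1 where d1: "d1 > 0" "\<And>s t. s \<in> {x..y} \<Longrightarrow> t \<in> {x..y} \<Longrightarrow> dist s t < d1 \<Longrightarrow> dist (h s) (h t) < e"
      using compact_uniformly_continuous[OF conth compact_Icc] e unfolding uniformly_continuous_on_def by metis
    obtain d2 where d2: "d2 > 0" "\<And>s t. s \<in> {x..y} \<Longrightarrow> t \<in> {x..y} \<Longrightarrow> dist s t < d2 \<Longrightarrow> dist (k s) (k t) < e"
      using compact_uniformly_continuous[OF contk compact_Icc] e unfolding uniformly_continuous_on_def by metis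
    obtain n :: nat where n: "(y - x) / min d1 d2 < n" using reals_Archimedean2 by blast
    have n0: "n > 0"
    proof (rule ccontr)
      assume "\<not> n > 0"
      then have "(y - x) / min d1 d2 < 0" using n by simp
      moreover have "0 \<le> (y - x) / min d1 d2" using xy d1 d2 by (intro divide_nonneg_pos) auto
      ultimately show False by linarith
    qed
    \<comment> \<open>Equal cells, shorter than both moduli of uniform continuity \<open>d1\<close>
      and \<open>d2\<close>.\<close>
    define \<eta> where "\<eta> = (y - x) / n"
    have step: "\<eta> < d1" "\<eta> < d2"
    proof -
      have "y - x < n * min d1 d2" using n d1(1) d2(1) by (simp add: pos_divide_less_eq)
      then have "\<eta> < min d1 d2" using n0 unfolding \<eta>_def
        by (metis mult.commute of_nat_0_less_iff pos_divide_less_eq)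
      then show "\<eta> < d1" "\<eta> < d2" by auto
    qed
    have \<eta>0: "0 \<le> \<eta>" using xy by (simp add: \<eta>_def)
    define t where "t = (\<lambda>i::nat. x + i * \<eta>)"
    have tSuc: "t (Suc i) = t i + \<eta>" for i by (simp add: t_def algebra_simps)
    have t0: "t 0 = x" and tn: "t n = y" using n0 by (simp_all add: t_def \<eta>_def)
    have trange: "t i \<in> {x..y}" if "i \<le> n" for i
    proof -
      have "real i * \<eta> \<le> real n * \<eta>" using that \<eta>0 by (intro mult_right_mono) auto
      then show ?thesis using \<eta>0 tn by (simp add: t_def)
    qed
    have "norm (h (t i) * k (t i) - h x * k x - integral {x..t i} w) \<le> e * integral {x..t i} m" if "i \<le> n" for i
      using that
    proof (induction i)
      case 0
      then show ?case by (simp add: t0)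
    next
      case (Suc i)
      let ?s = "t i" and ?t = "t (Suc i)"
      have r: "x \<le> ?s" "?s \<le> ?t" "?t \<le> y" using trange[of i] trange[of "Suc i"] tSuc[of i] \<eta>0 Suc.prems by auto
      have st: "?t - ?s < d1" "?t - ?s < d2" using step by (auto simp: tSuc)
      have Iw: "integral {x..?t} w = integral {x..?s} w + integral {?s..?t} w"
        using r wsub by (intro Henstock_Kurzweil_Integration.integral_combine[symmetric]) auto
      have Im: "integral {x..?t} m = integral {x..?s} m + integral {?s..?t} m"
        using r msub by (intro Henstock_Kurzweil_Integration.integral_combine[symmetric]) auto
      have i1: "((\<lambda>\<sigma>. g \<sigma> * k ?t) has_integral ((h ?t - h ?s) * k ?t)) {?s..?t}"
        using h[OF r] by (rule has_integral_mult_left)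
      have "(k' has_integral (k ?t - k ?s)) {?s..?t}"
        using r by (intro fundamental_theorem_of_calculus has_vector_derivative_within_subset[OF k]) auto
      then have i2: "((\<lambda>\<sigma>. h ?s * k' \<sigma>) has_integral (h ?s * (k ?t - k ?s))) {?s..?t}"
        by (rule has_integral_mult_right)
      have "(w has_integral (integral {?s..?t} w)) {?s..?t}" using r wsub by blast
      from has_integral_diff[OF has_integral_add[OF i1 i2] this]
      have "((\<lambda>\<sigma>. g \<sigma> * (k ?t - k \<sigma>) + (h ?s - h \<sigma>) * k' \<sigma>) has_integral
          (h ?t * k ?t - h ?s * k ?s - integral {?s..?t} w)) {?s..?t}"
        by (simp add: w_def algebra_simps)
      moreover have "((\<lambda>\<sigma>. e * m \<sigma>) has_integral (e * integral {?s..?t} m)) {?s..?t}"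
        using r msub by (intro has_integral_mult_right) blast
      moreover have "norm (g \<sigma> * (k ?t - k \<sigma>) + (h ?s - h \<sigma>) * k' \<sigma>) \<le> e * m \<sigma>" if "\<sigma> \<in> {?s..?t}" for \<sigma>
      proof -
        have "norm (k ?t - k \<sigma>) \<le> e" "norm (h ?s - h \<sigma>) \<le> e"
          using d1(2)[of ?s \<sigma>] d2(2)[of ?t \<sigma>] st that r by (auto simp: dist_norm less_imp_le)
        then have "norm (g \<sigma>) * norm (k ?t - k \<sigma>) + norm (h ?s - h \<sigma>) * norm (k' \<sigma>) \<le> norm (g \<sigma>) * e + e * K"
          using K[of \<sigma>] that r e by (intro add_mono mult_mono) auto
        then show ?thesis
          using norm_triangle_ineq[of "g \<sigma> * (k ?t - k \<sigma>)" "(h ?s - h \<sigma>) * k' \<sigma>"]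
          unfolding norm_mult m_def distrib_left mult.commute[of e "norm (g \<sigma>)"] by linarith
      qed
      ultimately have "norm (h ?t * k ?t - h ?s * k ?s - integral {?s..?t} w) \<le> (e * integral {?s..?t} m) \<bullet> 1"
        by - (erule (1) has_integral_norm_bound_integral_component, simp)
      then show ?case
        using Suc norm_triangle_ineq[of "h ?s * k ?s - h x * k x - integral {x..?s} w" "h ?t * k ?t - h ?s * k ?s - integral {?s..?t} w"]
        unfolding Iw Im by (simp add: algebra_simps)
    qed
    from this[of n] show ?thesis by (simp add: tn)
  qed
  have "norm (h y * k y - h x * k x - integral {x..y} w) \<le> 0"
  proof (rule tendsto_lowerbound[of _ _ "at_right (0::real)"])
    show "((\<lambda>e. e * integral {x..y} m) \<longlongrightarrow> 0) (at_right 0)"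
      by (rule tendsto_mult_left_zero) simp
    show "eventually (\<lambda>e. norm (h y * k y - h x * k x - integral {x..y} w) \<le> e * integral {x..y} m) (at_right 0)"
      using small by (auto simp: eventually_at_right_field intro!: exI[of _ 1])
  qed simp
  then have "integral {x..y} w = h y * k y - h x * k x" by simp
  then show ?thesis using w unfolding w_def[symmetric] by (metis integrable_integral)
qed

text \<open>\<open>AC_loc\<close> only asserts that some density \<open>g\<close> exists. It agrees
  with \<open>dx f\<close> almost everywhere, so \<open>dx f\<close> itself may serve as the density
  and later integrals can be written with derivatives.\<close>

lemma AC_loc_ae_derivative:
  assumes "AC_loc (einterval a b) f"
  shows "AE x in lebesgue_on (einterval a b). (f has_vector_derivative dx f x) (at x)"
    and "loc_integrable (einterval a b) (dx f)"
    and "x \<in> einterval a b \<Longrightarrow> y \<in> einterval a b \<Longrightarrow> x \<le> y \<Longrightarrow> (dx f has_integral (f y - f x)) {x..y}"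
    and "continuous_on (einterval a b) f"
proof -
  let ?S = "einterval a b"
  obtain g where g: "loc_integrable ?S g"
    "\<And>x y. x \<in> ?S \<Longrightarrow> y \<in> ?S \<Longrightarrow> x \<le> y \<Longrightarrow> (g has_integral (f y - f x)) {x..y}"
    using assms unfolding AC_loc_def by blast
  have "\<exists>N. negligible N \<and> (\<forall>x\<in>?S - N. (f has_vector_derivative g x) (at x))"
    by (rule primitive_ae_derivative[OF open_einterval g(1) g(2)]) auto
  then obtain N where N: "negligible N" "\<And>x. x \<in> ?S - N \<Longrightarrow> (f has_vector_derivative g x) (at x)"
    by blast
  have N': "dx f x = g x" if "x \<in> ?S - N" for x
    using N(2)[OF that] by (rule vector_derivative_at)
  show "AE x in lebesgue_on ?S. (f has_vector_derivative dx f x) (at x)"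
    using N N' by (subst AE_lebesgue_on_negligible_iff) auto
  show "loc_integrable ?S (dx f)"
    unfolding loc_integrable_def
  proof safe
    fix K :: "real set" assume K: "compact K" "K \<subseteq> ?S"
    then have "g absolutely_integrable_on K" using g(1) by (auto simp: loc_integrable_def)
    then show "dx f absolutely_integrable_on K"
      by (rule absolutely_integrable_spike[OF _ N(1)]) (use K N' in auto)
  qed
  show "(dx f has_integral (f y - f x)) {x..y}" if "x \<in> ?S" "y \<in> ?S" "x \<le> y"
    by (rule has_integral_spike[OF N(1) _ g(2)[OF that]])
      (use Icc_subset_einterval[OF that(1,2)] N' in auto)
  show "continuous_on ?S f"
    unfolding continuous_on_eq_continuous_at[OF open_einterval]
  proof
    fix x assume x: "x \<in> ?S"
    then obtain e where e: "0 < e" "cball x e \<subseteq> ?S"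
      using open_einterval[of a b] by (auto simp: open_contains_cball)
    then have S: "x - e \<in> ?S" "x + e \<in> ?S" by (auto simp: dist_real_def)
    have sub: "{x - e..x + e} \<subseteq> ?S" by (rule Icc_subset_einterval[OF S])
    have "g integrable_on {x - e..x + e}"
      using g(1) sub by (intro set_lebesgue_integral_eq_integral(1)) (auto simp: loc_integrable_def)
    then have "continuous_on {x - e..x + e} (\<lambda>t. f (x - e) + integral {x - e..t} g)"
      by (intro continuous_intros indefinite_integral_continuous_1)
    then have "continuous_on {x - e..x + e} f"
    proof (rule continuous_on_eq)
      fix t assume "t \<in> {x - e..x + e}"
      then show "f (x - e) + integral {x - e..t} g = f t"
        using integral_unique[OF g(2)[of "x - e" t]] S sub \<open>t \<in> {x - e..x + e}\<close> by fastforce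
    qed
    then have "continuous_on {x - e<..<x + e} f" by (rule continuous_on_subset) auto
    then show "isCont f x" using e by (subst (asm) continuous_on_eq_continuous_at) auto
  qed
qed

section \<open>Integral identities for solutions, and Wronskians\<close>

lemma sl_regularD:
  assumes "sl_regular (einterval a b) f"
  shows "x \<in> einterval a b \<Longrightarrow> (f has_vector_derivative dx f x) (at x)"
    and "continuous_on (einterval a b) f" and "continuous_on (einterval a b) (dx f)"
proof -
  show der: "(f has_vector_derivative dx f x) (at x)" if "x \<in> einterval a b" for x
    using assms that by (auto simp: sl_regular_def vector_derivative_works)
  then show "continuous_on (einterval a b) f"
    using has_vector_derivative_continuous by (fastforce simp: continuous_on_eq_continuous_at)
  show "continuous_on (einterval a b) (dx f)"
    using assms AC_loc_ae_derivative(4) by (auto simp: sl_regular_def)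
qed

lemma sl_regular_mult_C1_integral:
  assumes f: "sl_regular (einterval a b) f" and xy: "x \<in> einterval a b" "y \<in> einterval a b" "x \<le> y"
    and p: "\<And>t. t \<in> {x..y} \<Longrightarrow> (p has_vector_derivative p' t) (at t)"
    and p': "continuous_on {x..y} p'"
  shows "((\<lambda>t. dx (dx f) t * p t + dx f t * p' t) has_integral (dx f y * p y - dx f x * p x)) {x..y}"
proof (rule has_integral_mult_primitive_C1)
  have sub: "{x..y} \<subseteq> einterval a b" by (rule Icc_subset_einterval[OF xy(1,2)])
  have AC: "AC_loc (einterval a b) (dx f)" using f by (simp add: sl_regular_def)
  show "dx (dx f) absolutely_integrable_on {x..y}"
    using AC_loc_ae_derivative(2)[OF AC] sub by (auto simp: loc_integrable_def)
  show "(dx (dx f) has_integral (dx f t - dx f s)) {s..t}" if "x \<le> s" "s \<le> t" "t \<le> y" for s t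
    using that sub by (intro AC_loc_ae_derivative(3)[OF AC]) auto
qed (use assms in \<open>auto intro: has_vector_derivative_at_within\<close>)

lemma sl_solutionD:
  assumes "sl_solution S q z u"
  shows "sl_regular S u" and "AE x in lebesgue_on S. dx (dx u) x = (of_real (q x) - z) * u x"
proof -
  show "sl_regular S u" using assms by (simp add: sl_solution_def)
  have "AE x in lebesgue_on S. sl_expr q u x = z * u x" using assms by (simp add: sl_solution_def)
  then show "AE x in lebesgue_on S. dx (dx u) x = (of_real (q x) - z) * u x"
    by (rule eventually_mono) (simp add: sl_expr_def algebra_simps)
qed

lemma has_integral_AE_eq:
  assumes "(f has_integral I) {x..y}" and "AE t in lebesgue_on S. f t = g t"
    and "S \<in> sets lebesgue" "{x..y} \<subseteq> S"
  shows "(g has_integral I) {x..y}"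
proof -
  obtain N where N: "negligible N" "\<forall>t\<in>S - N. f t = g t"
    using assms by (auto simp: AE_lebesgue_on_negligible_iff)
  show ?thesis
    by (rule has_integral_spike[OF N(1) _ assms(1)]) (use N assms in auto)
qed

text \<open>Source of the integral identities for solutions: \<open>p\<close> is a second solution
  for the Wronskian and an exponential for the Volterra equation.\<close>

lemma sl_solution_mult_C1_integral:
  assumes u: "sl_solution (einterval a b) q z u"
    and xy: "x \<in> einterval a b" "y \<in> einterval a b" "x \<le> y"
    and p: "\<And>t. t \<in> {x..y} \<Longrightarrow> (p has_vector_derivative p' t) (at t)"
    and p': "continuous_on {x..y} p'"
  shows "((\<lambda>t. (of_real (q t) - z) * u t * p t + dx u t * p' t)
      has_integral (dx u y * p y - dx u x * p x)) {x..y}"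
  by (rule has_integral_AE_eq[OF sl_regular_mult_C1_integral[OF sl_solutionD(1)[OF u] xy p p']
        eventually_mono[OF sl_solutionD(2)[OF u]] einterval_lebesgue Icc_subset_einterval[OF xy(1,2)]]) auto

lemma wronskian_eq:
  assumes u: "sl_solution (einterval a b0) q0 z u" and v: "sl_solution (einterval a b1) q1 z v"
    and xy: "x \<in> einterval a b0 \<inter> einterval a b1" "y \<in> einterval a b0 \<inter> einterval a b1" "x \<le> y"
    and q: "AE t in lebesgue_on S. q0 t = q1 t" "S \<in> sets lebesgue" "{x<..<y} \<subseteq> S"
  shows "wronskian u v x = wronskian u v y"
proof -
  have sub: "{x..y} \<subseteq> einterval a b0" "{x..y} \<subseteq> einterval a b1"
    using xy by (auto intro: Icc_subset_einterval[THEN subsetD])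
  note ru = sl_regularD[OF sl_solutionD(1)[OF u]] and rv = sl_regularD[OF sl_solutionD(1)[OF v]]
  have 1: "((\<lambda>t. (of_real (q0 t) - z) * u t * v t + dx u t * dx v t)
      has_integral (dx u y * v y - dx u x * v x)) {x..y}"
    using xy sub rv(1) by (intro sl_solution_mult_C1_integral[OF u] continuous_on_subset[OF rv(3)]) auto
  have 2: "((\<lambda>t. (of_real (q1 t) - z) * v t * u t + dx v t * dx u t)
      has_integral (dx v y * u y - dx v x * u x)) {x..y}"
    using xy sub ru(1) by (intro sl_solution_mult_C1_integral[OF v] continuous_on_subset[OF ru(3)]) auto
  obtain N where N: "negligible N" "\<forall>t\<in>S - N. q0 t = q1 t"
    using q by (auto simp: AE_lebesgue_on_negligible_iff)
  have "((\<lambda>t. (of_real (q1 t) - z) * v t * u t + dx v t * dx u t)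
      has_integral (dx u y * v y - dx u x * v x)) {x..y}"
    by (rule has_integral_spike[of "N \<union> {x, y}", OF _ _ 1]) (use N q(3) in \<open>auto simp: mult_ac subset_eq\<close>)
  from has_integral_unique[OF this 2] show ?thesis by (simp add: wronskian_def algebra_simps)
qed

lemma wronskian_const:
  assumes u: "sl_solution (einterval a b) q z u" and v: "sl_solution (einterval a b) q z v"
    and xy: "x \<in> einterval a b" "y \<in> einterval a b"
  shows "wronskian u v x = wronskian u v y"
proof -
  have "wronskian u v x = wronskian u v y" if "x \<le> y" "x \<in> einterval a b" "y \<in> einterval a b" for x y
    by (rule wronskian_eq[OF u v _ _ that(1), of UNIV]) (use that in auto)
  then show ?thesis using xy by (metis linear)
qed

section \<open>A twice continuously differentiable cutoff\<close>

text \<open>The exponent is written as a double successor: from 2 on, the kink of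
  \<open>max 0 t\<close> at 0 is flattened.\<close>

lemma max_power_derivative:
  "((\<lambda>t::real. max 0 t ^ Suc (Suc n)) has_real_derivative real (Suc (Suc n)) * max 0 t ^ Suc n) (at t)"
proof (cases t "0 :: real" rule: linorder_cases)
  case less
  have "((\<lambda>t. max 0 t ^ Suc (Suc n)) has_real_derivative 0) (at t)"
    by (rule has_field_derivative_transform_within_open[of "\<lambda>_. 0" _ _ "{..<0}"]) (use less in auto)
  then show ?thesis using less by simp
next
  case greater
  have "((\<lambda>t. max 0 t ^ Suc (Suc n)) has_real_derivative real (Suc (Suc n)) * t ^ Suc n) (at t)"
    by (rule has_field_derivative_transform_within_open[of "\<lambda>t. t ^ Suc (Suc n)" _ _ "{0<..}"])
      (use greater DERIV_pow[of "Suc (Suc n)" t UNIV] in auto)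
  then show ?thesis using greater by simp
next
  case equal
  have "((\<lambda>h::real. max 0 h ^ Suc n) \<longlongrightarrow> max 0 0 ^ Suc n) (at 0)"
    by (intro tendsto_intros)
  then have "((\<lambda>h::real. (max 0 (0 + h) ^ Suc (Suc n) - max 0 0 ^ Suc (Suc n)) / h) \<longlongrightarrow> 0) (at 0)"
    by (rule_tac Lim_null_comparison[rotated]) 
      (auto simp: eventually_at max_def intro!: exI[of _ 1])
  then show ?thesis using equal by (simp add: DERIV_def)
qed

text \<open>The cutoff is \<open>f / (f + k)\<close>, where \<open>f\<close> and \<open>k\<close>
  are the cubes of the positive parts of \<open>r - x\<close> and \<open>x - p\<close>. Cubes make
  it twice continuously differentiable, and since \<open>p < r\<close> they never vanish
  together.\<close>

lemma smooth_cutoff: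
  assumes "p < r"
  obtains \<kappa> \<kappa>1 \<kappa>2 :: "real \<Rightarrow> real"
  where "\<And>x. (\<kappa> has_real_derivative \<kappa>1 x) (at x)" "\<And>x. (\<kappa>1 has_real_derivative \<kappa>2 x) (at x)"
    "continuous_on UNIV \<kappa>2" "\<And>x. x \<le> p \<Longrightarrow> \<kappa> x = 1" "\<And>x. r \<le> x \<Longrightarrow> \<kappa> x = 0"
    "\<And>x. x \<le> p \<or> r \<le> x \<Longrightarrow> \<kappa>1 x = 0" "\<And>x. x \<le> p \<or> r \<le> x \<Longrightarrow> \<kappa>2 x = 0"
proof -
  define f where "f = (\<lambda>t::real. max 0 (r - t) ^ 3)"
  define f1 where "f1 = (\<lambda>t::real. - 3 * max 0 (r - t) ^ 2)"
  define f2 where "f2 = (\<lambda>t::real. 6 * max 0 (r - t))"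
  define k where "k = (\<lambda>t::real. max 0 (t - p) ^ 3)"
  define k1 where "k1 = (\<lambda>t::real. 3 * max 0 (t - p) ^ 2)"
  define k2 where "k2 = (\<lambda>t::real. 6 * max 0 (t - p))"
  define g where "g = (\<lambda>t. f t + k t)"
  have d3: "((\<lambda>t::real. max 0 t ^ 3) has_real_derivative 3 * max 0 t ^ 2) (at t)" for t
    using max_power_derivative[of 1 t] by (simp add: numeral_eq_Suc)
  have d2: "((\<lambda>t::real. max 0 t ^ 2) has_real_derivative 2 * max 0 t) (at t)" for t
    using max_power_derivative[of 0 t] by (simp add: numeral_eq_Suc)
  have dr: "((\<lambda>t. r - t) has_real_derivative - 1) (at x)" and dp: "((\<lambda>t. t - p) has_real_derivative 1) (at x)" for x
    by (auto intro!: derivative_eq_intros)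
  have f: "(f has_real_derivative f1 x) (at x)" "(f1 has_real_derivative f2 x) (at x)" for x
    unfolding f_def f1_def f2_def
    using DERIV_chain2[OF d3 dr, of x] DERIV_cmult[OF DERIV_chain2[OF d2 dr], where c = "- 3"] by simp_all
  have k: "(k has_real_derivative k1 x) (at x)" "(k1 has_real_derivative k2 x) (at x)" for x
    unfolding k_def k1_def k2_def
    using DERIV_chain2[OF d3 dp, of x] DERIV_cmult[OF DERIV_chain2[OF d2 dp], where c = 3] by simp_all
  have g0: "g x > 0" for x
  proof (cases "x < r")
    case True
    then have "f x > 0" "k x \<ge> 0" by (auto simp: f_def k_def)
    then show ?thesis by (simp add: g_def)
  next
    case False
    then have "f x \<ge> 0" "k x > 0" using assms by (auto simp: f_def k_def)
    then show ?thesis by (simp add: g_def)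
  qed
  \<comment> \<open>Numerator of the quotient rule for \<open>f / (f + k)\<close> after cancelling
    \<open>f * f1\<close>; in its derivative \<open>m2\<close> the terms \<open>f1 * k1\<close>
    cancel.\<close>
  define m1 where "m1 = (\<lambda>x. f1 x * k x - f x * k1 x)"
  define m2 where "m2 = (\<lambda>x. f2 x * k x - f x * k2 x)"
  have m: "(m1 has_real_derivative m2 x) (at x)" for x
    unfolding m1_def m2_def by (auto intro!: derivative_eq_intros f k)
  have g: "(g has_real_derivative f1 x + k1 x) (at x)" for x
    unfolding g_def by (auto intro!: derivative_eq_intros f k)
  show thesis
  proof (rule that)
    show "((\<lambda>x. f x / g x) has_real_derivative m1 x / (g x * g x)) (at x)" for x
      using g0[of x] by (auto intro!: derivative_eq_intros f g k simp: m1_def g_def algebra_simps)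
    show "((\<lambda>x. m1 x / (g x * g x)) has_real_derivative
        (m2 x * (g x * g x) - m1 x * ((f1 x + k1 x) * g x + (f1 x + k1 x) * g x)) / (g x * g x * (g x * g x))) (at x)" for x
      using g0[of x] by (auto intro!: derivative_eq_intros m g simp: algebra_simps)
    have "continuous_on UNIV f2" "continuous_on UNIV k2"
      by (auto simp: f2_def k2_def intro!: continuous_intros)
    moreover have "continuous_on UNIV f" "continuous_on UNIV k" "continuous_on UNIV f1" "continuous_on UNIV k1"
      by (auto intro!: DERIV_continuous_on[OF f(1)] DERIV_continuous_on[OF f(2)] DERIV_continuous_on[OF k(1)] DERIV_continuous_on[OF k(2)])
    ultimately show "continuous_on UNIV (\<lambda>x. (m2 x * (g x * g x) - m1 x * ((f1 x + k1 x) * g x + (f1 x + k1 x) * g x)) / (g x * g x * (g x * g x)))"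
      unfolding m1_def m2_def using g0 by (intro continuous_intros) (auto simp: g_def intro!: continuous_intros less_imp_neq[symmetric])
    show "f x / g x = 1" if "x \<le> p" for x
      using that g0[of x] by (simp add: g_def k_def)
    show "f x / g x = 0" if "r \<le> x" for x
      using that by (simp add: f_def)
    have m0: "m1 x = 0" "m2 x = 0" if "x \<le> p \<or> r \<le> x" for x
      using that by (auto simp: m1_def m2_def f_def f1_def f2_def k_def k1_def k2_def)
    show "m1 x / (g x * g x) = 0" if "x \<le> p \<or> r \<le> x" for x
      by (simp add: m0[OF that])
    show "(m2 x * (g x * g x) - m1 x * ((f1 x + k1 x) * g x + (f1 x + k1 x) * g x)) / (g x * g x * (g x * g x)) = 0"
      if "x \<le> p \<or> r \<le> x" for x
      by (simp add: m0[OF that])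
  qed
qed

section \<open>Boundary terms of a self-adjoint realization\<close>

lemma eventually_to_left_end:
  assumes "a < ereal c"
  shows "eventually (\<lambda>x. x \<in> einterval a (ereal c)) (to_left_end a)"
  unfolding to_left_end_def eventually_filtermap eventually_at_right[OF assms]
proof (intro exI[of _ "ereal c"] conjI allI impI assms)
  fix y assume "a < y" "y < ereal c"
  then show "real_of_ereal y \<in> einterval a (ereal c)"
    by (cases y) (auto simp: einterval_def)
qed

lemma eventually_to_right_end:
  assumes "ereal c < b"
  shows "eventually (\<lambda>x. x \<in> einterval (ereal c) b) (to_right_end b)"
  unfolding to_right_end_def eventually_filtermap eventually_at_left[OF assms]
proof (intro exI[of _ "ereal c"] conjI allI impI assms)
  fix y assume "y < b" "ereal c < y"
  then show "real_of_ereal y \<in> einterval (ereal c) b"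
    by (cases y) (auto simp: einterval_def)
qed

lemma to_left_end_nontrivial:
  assumes "a < ereal c"
  shows "to_left_end a \<noteq> bot"
proof
  assume "to_left_end a = bot"
  then have "eventually (\<lambda>_. False) (at_right a)"
    by (simp add: to_left_end_def trivial_limit_def eventually_filtermap)
  then obtain y where "a < y" "\<And>x. a < x \<Longrightarrow> \<not> x < y"
    unfolding eventually_at_right[OF assms] by blast
  then show False using dense by blast
qed

section \<open>Square integrability on subintervals\<close>

lemma L2_cong_AE:
  assumes S: "S \<in> sets lebesgue" and f: "L2 S f" and AE: "AE x in lebesgue_on S. f x = g x"
  shows "L2 S g"
proof -
  have "g \<in> borel_measurable (lebesgue_on S)"
  proof -
    obtain N where N: "negligible N" "\<forall>x\<in>S - N. f x = g x"
      using AE S by (auto simp: AE_lebesgue_on_negligible_iff)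
    have "(\<lambda>x. if x \<in> S then f x else 0) \<in> borel_measurable lebesgue"
      using f S by (simp add: L2_def borel_measurable_if)
    moreover have "AE x in lebesgue. (if x \<in> S then f x else 0) = (if x \<in> S then g x else 0)"
      using N by (intro AE_I'[of N]) (auto simp: negligible_iff_null_sets)
    ultimately have "(\<lambda>x. if x \<in> S then g x else 0) \<in> borel_measurable lebesgue"
      by (rule borel_measurable_AE)
    then show ?thesis using S by (simp add: borel_measurable_if)
  qed
  moreover from this have "(\<lambda>x. (cmod (g x))\<^sup>2) \<in> borel_measurable (lebesgue_on S)"
    by simp
  then have "integrable (lebesgue_on S) (\<lambda>x. (cmod (g x))\<^sup>2)"
  proof (rule integrable_cong_AE_imp[rotated])
    show "integrable (lebesgue_on S) (\<lambda>x. (cmod (f x))\<^sup>2)" using f by (simp add: L2_def)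
    show "AE x in lebesgue_on S. (cmod (f x))\<^sup>2 = (cmod (g x))\<^sup>2"
      by (rule eventually_mono[OF AE]) simp
  qed
  ultimately show ?thesis by (simp add: L2_def)
qed

lemma L2_cong: "L2 S f \<Longrightarrow> (\<And>x. x \<in> S \<Longrightarrow> f x = g x) \<Longrightarrow> S \<in> sets lebesgue \<Longrightarrow> L2 S g"
  by (rule L2_cong_AE) (auto intro!: AE_I2)

lemma L2_cmult: "L2 S f \<Longrightarrow> L2 S (\<lambda>x. c * f x)"
  unfolding L2_def by (auto simp: norm_mult power_mult_distrib intro!: borel_measurable_times)

lemma L2_zero: "L2 S (\<lambda>x. 0)"
  by (simp add: L2_def)

lemma L2_iff:
  "S \<in> sets lebesgue \<Longrightarrow> L2 S f \<longleftrightarrow>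
    f \<in> borel_measurable (lebesgue_on S) \<and> (\<lambda>x. (cmod (f x))\<^sup>2) absolutely_integrable_on S"
  by (simp add: L2_def integrable_restrict_space set_integrable_def)

lemma L2_absolutely_integrable:
  "L2 S f \<Longrightarrow> S \<in> sets lebesgue \<Longrightarrow> (\<lambda>x. (cmod (f x))\<^sup>2) absolutely_integrable_on S"
  by (simp add: L2_iff)

lemma continuous_imp_absolutely_integrable_compact:
  fixes g :: "real \<Rightarrow> complex"
  assumes "compact K" "continuous_on K g"
  shows "g absolutely_integrable_on K"
proof -
  have "integrable lborel (\<lambda>x. indicator K x *\<^sub>R g x)"
    by (rule borel_integrable_compact[OF assms])
  then show ?thesis unfolding set_integrable_def
    using integrable_completion[OF borel_measurable_integrable] by blast
qed

lemma einterval_split: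
  assumes "p \<in> einterval a b" "r \<in> einterval a b" "p < r"
  shows "einterval a b = einterval a (ereal p) \<union> {p..r} \<union> einterval (ereal r) b"
proof (intro set_eqI iffI)
  have ends: "a < ereal p" "ereal p < b" "a < ereal r" "ereal r < b"
    using assms by (auto simp: einterval_def)
  fix x
  show "x \<in> einterval a (ereal p) \<union> {p..r} \<union> einterval (ereal r) b" if "x \<in> einterval a b"
    using that by (cases "x < p"; cases "r < x") (auto simp: einterval_def)
  show "x \<in> einterval a b" if x: "x \<in> einterval a (ereal p) \<union> {p..r} \<union> einterval (ereal r) b"
  proof -
    from x consider "x \<in> einterval a (ereal p)" | "x \<in> {p..r}" | "x \<in> einterval (ereal r) b" by blast
    then show ?thesis
    proof cases
      case 1
      then show ?thesis using ends less_trans[of "ereal x" "ereal p" b] by (simp add: einterval_def)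
    next
      case 2
      then show ?thesis using Icc_subset_einterval[OF assms(1,2)] by blast
    next
      case 3
      then show ?thesis using ends less_trans[of a "ereal r" "ereal x"] by (simp add: einterval_def)
    qed
  qed
qed

lemma L2_join:
  assumes pr: "p \<in> einterval a b" "r \<in> einterval a b" "p < r" and cont: "continuous_on (einterval a b) f"
    and "L2 (einterval a (ereal p)) f" "L2 (einterval (ereal r) b) f"
  shows "L2 (einterval a b) f"
proof -
  have "{p..r} \<subseteq> einterval a b" using pr by (intro Icc_subset_einterval)
  then have "(\<lambda>x. (cmod (f x))\<^sup>2) absolutely_integrable_on {p..r}"
    by (intro absolutely_integrable_continuous_real continuous_intros continuous_on_subset[OF cont])
  then have "(\<lambda>x. (cmod (f x))\<^sup>2) absolutely_integrable_on (einterval a (ereal p) \<union> {p..r} \<union> einterval (ereal r) b)"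
    using L2_absolutely_integrable[OF assms(5)] L2_absolutely_integrable[OF assms(6)]
    by (intro absolutely_integrable_Un) auto
  then show ?thesis
    unfolding einterval_split[OF pr, symmetric]
    using cont by (auto simp: L2_iff intro!: continuous_imp_measurable_on_sets_lebesgue)
qed

lemma L2_subset:
  assumes "L2 T f" "S \<subseteq> T" "S \<in> sets lebesgue" "T \<in> sets lebesgue"
  shows "L2 S f"
proof -
  have "f \<in> borel_measurable (lebesgue_on S)"
    using assms(1,2) unfolding L2_def by (auto intro: measurable_restrict_mono)
  moreover have "(\<lambda>x. (cmod (f x))\<^sup>2) absolutely_integrable_on S"
    using set_integrable_subset[OF L2_absolutely_integrable[OF assms(1,4)] assms(3,2)] .
  ultimately show ?thesis using assms(3) by (simp add: L2_iff)
qed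

lemma einterval_mono: "a \<le> a' \<Longrightarrow> b' \<le> b \<Longrightarrow> einterval a' b' \<subseteq> einterval a b"
  by (auto simp: einterval_def)

lemma einterval_subset:
  assumes "p \<in> einterval a b"
  shows "einterval a (ereal p) \<subseteq> einterval a b" "einterval (ereal p) b \<subseteq> einterval a b"
proof -
  have p: "a \<le> ereal p" "ereal p \<le> b" using assms by (auto simp: einterval_def)
  show "einterval a (ereal p) \<subseteq> einterval a b" by (rule einterval_mono[OF order_refl p(2)])
  show "einterval (ereal p) b \<subseteq> einterval a b" by (rule einterval_mono[OF p(1) order_refl])
qed

text \<open>Continuity handles the compact gap between the point provided by
  \<open>L2_near_left\<close> and \<open>p\<close>, so the choice of that point is
  immaterial.\<close>

lemma L2_near_left_all:
  assumes cont: "continuous_on (einterval a b) f" and "L2_near_left a b f" and p: "p \<in> einterval a b"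
  shows "L2 (einterval a (ereal p)) f"
proof -
  obtain c where c: "c \<in> einterval a b" "L2 (einterval a (ereal c)) f"
    using assms by (auto simp: L2_near_left_def)
  show ?thesis
  proof (cases "p \<le> c")
    case True
    then show ?thesis by (intro L2_subset[OF c(2)] einterval_mono) auto
  next
    case False
    have sub: "{c..p} \<subseteq> einterval a b" using c p by (intro Icc_subset_einterval)
    then have "(\<lambda>x. (cmod (f x))\<^sup>2) absolutely_integrable_on {c..p}"
      by (intro absolutely_integrable_continuous_real continuous_intros continuous_on_subset[OF cont])
    then have "(\<lambda>x. (cmod (f x))\<^sup>2) absolutely_integrable_on (einterval a (ereal c) \<union> {c..p})"
      using L2_absolutely_integrable[OF c(2)] by (intro absolutely_integrable_Un) auto
    then have "(\<lambda>x. (cmod (f x))\<^sup>2) absolutely_integrable_on (einterval a (ereal p))"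
      by (rule set_integrable_subset) (use False c in \<open>auto simp: einterval_def\<close>)
    moreover have "continuous_on (einterval a (ereal p)) f"
      by (rule continuous_on_subset[OF cont einterval_subset(1)[OF p]])
    ultimately show ?thesis
      by (auto simp: L2_iff intro!: continuous_imp_measurable_on_sets_lebesgue)
  qed
qed

lemma L2_near_right_all:
  assumes cont: "continuous_on (einterval a b) f" and "L2_near_right a b f" and p: "p \<in> einterval a b"
  shows "L2 (einterval (ereal p) b) f"
proof -
  obtain c where c: "c \<in> einterval a b" "L2 (einterval (ereal c) b) f"
    using assms by (auto simp: L2_near_right_def)
  show ?thesis
  proof (cases "c \<le> p")
    case True
    then show ?thesis by (intro L2_subset[OF c(2)] einterval_mono) auto
  next
    case False
    have sub: "{p..c} \<subseteq> einterval a b" using c p by (intro Icc_subset_einterval)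
    then have "(\<lambda>x. (cmod (f x))\<^sup>2) absolutely_integrable_on {p..c}"
      by (intro absolutely_integrable_continuous_real continuous_intros continuous_on_subset[OF cont])
    then have "(\<lambda>x. (cmod (f x))\<^sup>2) absolutely_integrable_on ({p..c} \<union> einterval (ereal c) b)"
      using L2_absolutely_integrable[OF c(2)] by (intro absolutely_integrable_Un) auto
    then have "(\<lambda>x. (cmod (f x))\<^sup>2) absolutely_integrable_on (einterval (ereal p) b)"
      by (rule set_integrable_subset) (use False c in \<open>auto simp: einterval_def\<close>)
    moreover have "continuous_on (einterval (ereal p) b) f"
      by (rule continuous_on_subset[OF cont einterval_subset(2)[OF p]])
    ultimately show ?thesis
      by (auto simp: L2_iff intro!: continuous_imp_measurable_on_sets_lebesgue)
  qed
qed

text \<open>\<open>q\<close> is real, so the potential contributes a real multiple of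
  \<open>|f|^2\<close>.\<close>

lemma Im_cnj_mult_sl_expr: "Im (cnj (f x) * sl_expr q f x) = - Im (dx (dx f) x * cnj (f x))"
proof -
  have "cnj (f x) * sl_expr q f x = - (dx (dx f) x * cnj (f x)) + of_real (q x) * (f x * cnj (f x))"
    by (simp add: sl_expr_def algebra_simps)
  also have "of_real (q x) * (f x * cnj (f x)) = complex_of_real (q x * (cmod (f x))\<^sup>2)"
    unfolding of_real_mult complex_norm_square ..
  finally show ?thesis by simp
qed

section \<open>Imaginary part of the quadratic form\<close>

text \<open>Self-adjointness makes \<open><f, H f>\<close> real. Near both ends
  \<open>H f = z f\<close>, which contributes \<open>Im z\<close> times squared norms; between
  \<open>p\<close> and \<open>r\<close>, integration by parts turns the imaginary part into boundary
  terms. \<open>h\<close> is a continuous representative of \<open>H f\<close>, so that its square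
  integrability can be checked piecewise.\<close>

lemma self_adjoint_boundary_identity:
  assumes sa: "self_adjoint (einterval a b) (sl_operator a b q \<alpha> \<beta>)"
    and f: "sl_regular (einterval a b) f"
    and h: "AE x in lebesgue_on (einterval a b). h x = sl_expr q f x" "continuous_on (einterval a b) h"
    and pr: "p \<in> einterval a b" "r \<in> einterval a b" "p < r"
    and hl: "\<And>x. x \<in> einterval a (ereal p) \<Longrightarrow> h x = z * f x"
    and hr: "\<And>x. x \<in> einterval (ereal r) b \<Longrightarrow> h x = z * f x"
    and L2l: "L2 (einterval a (ereal p)) f" and L2r: "L2 (einterval (ereal r) b) f"
    and bc: "satisfies_bc (to_left_end a) \<alpha> f" "satisfies_bc (to_right_end b) \<beta> f"
  shows "Im z * (integral (einterval a (ereal p)) (\<lambda>x. (cmod (f x))\<^sup>2) + integral (einterval (ereal r) b) (\<lambda>x. (cmod (f x))\<^sup>2))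
      = Im (cnj (f r) * dx f r) - Im (cnj (f p) * dx f p)"
proof -
  let ?S = "einterval a b" and ?L = "einterval a (ereal p)" and ?R = "einterval (ereal r) b"
  have sub: "{p..r} \<subseteq> ?S" using pr by (intro Icc_subset_einterval)
  note reg = sl_regularD[OF f]
  have L2f: "L2 ?S f" by (rule L2_join[OF pr reg(2) L2l L2r])
  have "L2 ?L h" "L2 ?R h"
    using hl hr by (auto intro!: L2_cong[OF L2_cmult[OF L2l, of z]] L2_cong[OF L2_cmult[OF L2r, of z]])
  then have L2h: "L2 ?S h" by (rule L2_join[OF pr h(2)])
  have "f \<in> sl_domain a b q \<alpha> \<beta>"
    using f L2f L2_cong_AE[OF einterval_lebesgue L2h h(1)] bc by (simp add: sl_domain_def sl_max_domain_def)
  then have G: "(f, h) \<in> sl_operator a b q \<alpha> \<beta>"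
    using L2f L2h h(1) by (auto simp: sl_operator_def)
  \<comment> \<open>The pair lies in the graph and in the graph of the adjoint; pairing it with
    itself gives the symmetry.\<close>
  then have "(f, h) \<in> adjoint_graph ?S (sl_operator a b q \<alpha> \<beta>)"
    using sa by (simp add: self_adjoint_def)
  then have "L2_inner ?S f h = L2_inner ?S h f"
    using G unfolding adjoint_graph_def by blast
  define \<psi> where "\<psi> = (\<lambda>x. cnj (f x) * h x)"
  have "L2_inner ?S h f = (\<integral>x. cnj (cnj (f x) * h x) \<partial>lebesgue_on ?S)"
    by (simp only: L2_inner_def complex_cnj_mult complex_cnj_cnj mult.commute)
  also have "\<dots> = cnj (L2_inner ?S f h)"
    unfolding L2_inner_def by (rule Bochner_Integration.integral_cnj)
  finally have "L2_inner ?S h f = cnj (L2_inner ?S f h)" .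
  then have im0: "Im (L2_inner ?S f h) = 0"
    using \<open>L2_inner ?S f h = L2_inner ?S h f\<close> by (simp add: complex_eq_iff)
  have \<psi>z: "\<psi> x = z * of_real ((cmod (f x))\<^sup>2)" if "x \<in> ?L \<or> x \<in> ?R" for x
  proof -
    have "h x = z * f x" using that hl hr by blast
    then show ?thesis unfolding \<psi>_def complex_norm_square by (simp only: mult_ac)
  qed
  have abs: "\<psi> absolutely_integrable_on A" if A: "A = ?L \<or> A = ?R" for A
  proof -
    have "(\<lambda>x. (cmod (f x))\<^sup>2) absolutely_integrable_on A"
      using A L2l L2r by (auto intro: L2_absolutely_integrable)
    then have "(\<lambda>x. z * of_real ((cmod (f x))\<^sup>2)) absolutely_integrable_on A"
      using absolutely_integrable_linear[OF _ bounded_linear_compose[OF bounded_linear_mult_right bounded_linear_of_real]]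
      by (fastforce simp: o_def)
    then show ?thesis
      by (rule absolutely_integrable_spike[of _ _ "{}"]) (use A \<psi>z in auto)
  qed
  have int: "integral A \<psi> = z * of_real (integral A (\<lambda>x. (cmod (f x))\<^sup>2))" if A: "A = ?L \<or> A = ?R" for A
  proof -
    have "(\<lambda>x. (cmod (f x))\<^sup>2) absolutely_integrable_on A"
      using A L2l L2r by (auto intro: L2_absolutely_integrable)
    then have "((\<lambda>x. (cmod (f x))\<^sup>2) has_integral integral A (\<lambda>x. (cmod (f x))\<^sup>2)) A"
      using set_lebesgue_integral_eq_integral(1) by blast
    then have "((\<lambda>x. z * of_real ((cmod (f x))\<^sup>2)) has_integral z * of_real (integral A (\<lambda>x. (cmod (f x))\<^sup>2))) A"
      by (intro has_integral_mult_right has_integral_of_real)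
    then have "(\<psi> has_integral z * of_real (integral A (\<lambda>x. (cmod (f x))\<^sup>2))) A"
      by (rule has_integral_eq[rotated]) (use A \<psi>z in auto)
    then show ?thesis by (rule integral_unique)
  qed
  have cont\<psi>: "continuous_on {p..r} \<psi>"
    unfolding \<psi>_def by (intro continuous_intros continuous_on_subset[OF reg(2)] continuous_on_subset[OF h(2)] sub)
  have absS: "\<psi> absolutely_integrable_on ?S"
    unfolding einterval_split[OF pr]
    by (intro absolutely_integrable_Un abs absolutely_integrable_continuous_real cont\<psi>) auto
  have "(\<psi> has_integral (integral ?L \<psi> + integral {p..r} \<psi> + integral ?R \<psi>)) ?S"
    unfolding einterval_split[OF pr]
  proof (intro has_integral_Un)
    show "(\<psi> has_integral integral ?L \<psi>) ?L" "(\<psi> has_integral integral ?R \<psi>) ?R"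
      using set_lebesgue_integral_eq_integral(1)[OF abs] by blast+
    show "(\<psi> has_integral integral {p..r} \<psi>) {p..r}"
      using integrable_continuous_real[OF cont\<psi>] by blast
    have "?L \<inter> {p..r} = {}" "(?L \<union> {p..r}) \<inter> ?R = {}"
      using pr(3) by (auto simp: einterval_def)
    then show "negligible (?L \<inter> {p..r})" "negligible ((?L \<union> {p..r}) \<inter> ?R)" by simp_all
  qed
  then have "integral ?S \<psi> = integral ?L \<psi> + integral {p..r} \<psi> + integral ?R \<psi>"
    by (rule integral_unique)
  moreover have "L2_inner ?S f h = integral ?S \<psi>"
    unfolding L2_inner_def \<psi>_def[symmetric]
    using absS by (intro lebesgue_integral_eq_integral) (auto simp: integrable_restrict_space set_integrable_def)
  ultimately have "Im (integral ?L \<psi>) + Im (integral {p..r} \<psi>) + Im (integral ?R \<psi>) = 0"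
    using im0 by simp
  moreover have "Im (integral {p..r} \<psi>) = Im (cnj (f p) * dx f p) - Im (cnj (f r) * dx f r)"
  proof -
    have "((\<lambda>t. dx (dx f) t * cnj (f t) + dx f t * cnj (dx f t)) has_integral
        (dx f r * cnj (f r) - dx f p * cnj (f p))) {p..r}"
    proof (rule sl_regular_mult_C1_integral[OF f pr(1,2) less_imp_le[OF pr(3)]])
      show "((\<lambda>t. cnj (f t)) has_vector_derivative cnj (dx f t)) (at t)" if "t \<in> {p..r}" for t
        using reg(1) sub that by (intro has_vector_derivative_cnj) auto
      show "continuous_on {p..r} (\<lambda>t. cnj (dx f t))"
        by (intro continuous_on_cnj continuous_on_subset[OF reg(3) sub])
    qed
    \<comment> \<open>The summand \<open>dx f t * cnj (dx f t)\<close> is real and drops out of the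
      imaginary part.\<close>
    from has_integral_linear[OF this bounded_linear_Im]
    have 1: "((\<lambda>t. Im (dx (dx f) t * cnj (f t))) has_integral (Im (dx f r * cnj (f r)) - Im (dx f p * cnj (f p)))) {p..r}"
      by (simp add: o_def algebra_simps)
    have "(\<psi> has_integral integral {p..r} \<psi>) {p..r}"
      using integrable_continuous_real[OF cont\<psi>] by blast
    from has_integral_linear[OF this bounded_linear_Im]
    have "((\<lambda>t. Im (\<psi> t)) has_integral Im (integral {p..r} \<psi>)) {p..r}" by (simp add: o_def)
    then have "((\<lambda>t. - Im (dx (dx f) t * cnj (f t))) has_integral Im (integral {p..r} \<psi>)) {p..r}"
      by (rule has_integral_AE_eq[OF _ _ einterval_lebesgue sub])
        (rule eventually_mono[OF h(1)], simp only: \<psi>_def Im_cnj_mult_sl_expr minus_minus)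
    from has_integral_unique[OF this has_integral_neg[OF 1]] show ?thesis by (simp add: algebra_simps)
  qed
  ultimately show ?thesis
    using int[of ?L] int[of ?R] by (simp add: algebra_simps)
qed

text \<open>Leibniz rule: by the equation for \<open>u\<close> the terms with the undifferentiated
  cutoff combine to \<open>z \<kappa> u\<close>. What results is a continuous function, whereas
  \<open>sl_expr q f\<close> is meaningful only almost everywhere.\<close>

lemma sl_regular_cutoff:
  fixes \<kappa> \<kappa>1 \<kappa>2 :: "real \<Rightarrow> real"
  assumes u: "sl_solution (einterval a b) q z u"
    and \<kappa>: "\<And>x. (\<kappa> has_real_derivative \<kappa>1 x) (at x)" "\<And>x. (\<kappa>1 has_real_derivative \<kappa>2 x) (at x)"
      "continuous_on UNIV \<kappa>2"
  defines "f \<equiv> (\<lambda>x. of_real (\<kappa> x) * u x)"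
  shows "sl_regular (einterval a b) f"
    and "x \<in> einterval a b \<Longrightarrow> dx f x = of_real (\<kappa>1 x) * u x + of_real (\<kappa> x) * dx u x"
    and "AE x in lebesgue_on (einterval a b).
      z * (of_real (\<kappa> x) * u x) - 2 * of_real (\<kappa>1 x) * dx u x - of_real (\<kappa>2 x) * u x = sl_expr q f x"
proof -
  let ?S = "einterval a b"
  let ?f1 = "\<lambda>x. of_real (\<kappa>1 x) * u x + of_real (\<kappa> x) * dx u x"
  note reg = sl_regularD[OF sl_solutionD(1)[OF u]]
  have "sl_regular ?S u" by (rule sl_solutionD(1)[OF u])
  then have AC: "AC_loc ?S (dx u)" by (simp add: sl_regular_def)
  have \<kappa>v: "((\<lambda>x. of_real (\<kappa> x) :: complex) has_vector_derivative of_real (\<kappa>1 x)) (at x)"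
    "((\<lambda>x. of_real (\<kappa>1 x) :: complex) has_vector_derivative of_real (\<kappa>2 x)) (at x)" for x
    using \<kappa>(1,2)[of x] by (auto intro: has_vector_derivative_of_real simp: has_real_derivative_iff_has_vector_derivative)
  have \<kappa>c: "continuous_on A (\<lambda>x. of_real (\<kappa> x) :: complex)" "continuous_on A (\<lambda>x. of_real (\<kappa>1 x) :: complex)"
    "continuous_on A (\<lambda>x. of_real (\<kappa>2 x) :: complex)" for A
    by (rule continuous_on_of_real, rule DERIV_continuous_on[OF has_field_derivative_at_within[OF \<kappa>(1)]]
          DERIV_continuous_on[OF has_field_derivative_at_within[OF \<kappa>(2)]] continuous_on_subset[OF \<kappa>(3) subset_UNIV])+
  have fd: "(f has_vector_derivative ?f1 x) (at x)" if "x \<in> ?S" for x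
    unfolding f_def using has_vector_derivative_mult[OF \<kappa>v(1) reg(1)[OF that]] by (simp add: add.commute)
  then show dxf: "dx f x = ?f1 x" if "x \<in> ?S" for x
    using that by (intro vector_derivative_at)
  have f1c: "continuous_on ?S ?f1" by (intro continuous_intros \<kappa>c reg)
  \<comment> \<open>Density of \<open>dx f\<close>: the first two summands differentiate
    \<open>\<kappa>1 * u\<close>, the bracket differentiates \<open>dx u * \<kappa>\<close>.\<close>
  have f2: "(\<lambda>x. of_real (\<kappa>2 x) * u x + of_real (\<kappa>1 x) * dx u x + (dx (dx u) x * of_real (\<kappa> x) + dx u x * of_real (\<kappa>1 x)))
      absolutely_integrable_on K" if "compact K" "K \<subseteq> ?S" for K
  proof (rule set_integral_add(1)[OF set_integral_add(1) set_integral_add(1)])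
    have K: "K \<in> sets lebesgue" using that by (simp add: lmeasurable_compact fmeasurableD)
    have cont: "g absolutely_integrable_on K" if "continuous_on ?S g" for g :: "real \<Rightarrow> complex"
      using \<open>compact K\<close> continuous_on_subset[OF that \<open>K \<subseteq> ?S\<close>]
      by (rule continuous_imp_absolutely_integrable_compact)
    show "(\<lambda>x. of_real (\<kappa>2 x) * u x) absolutely_integrable_on K" "(\<lambda>x. of_real (\<kappa>1 x) * dx u x) absolutely_integrable_on K"
      "(\<lambda>x. dx u x * of_real (\<kappa>1 x)) absolutely_integrable_on K"
      by (intro cont continuous_intros \<kappa>c reg)+
    have "dx (dx u) absolutely_integrable_on K"
      using AC_loc_ae_derivative(2)[OF AC] that by (simp add: loc_integrable_def)
    then have "(\<lambda>x. of_real (\<kappa> x) * dx (dx u) x) absolutely_integrable_on K"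
      using that K
      by (rule_tac absolutely_integrable_bounded_measurable_product[of times])
        (auto simp: bilinear_conv_bounded_bilinear intro!: bounded_bilinear_mult continuous_imp_measurable_on_sets_lebesgue
          \<kappa>c compact_imp_bounded compact_continuous_image)
    then show "(\<lambda>x. dx (dx u) x * of_real (\<kappa> x)) absolutely_integrable_on K" by (simp add: mult.commute)
  qed
  show "sl_regular ?S f"
    unfolding sl_regular_def
  proof (intro conjI ballI)
    show "f differentiable (at x)" if "x \<in> ?S" for x
      using fd[OF that] by (rule differentiableI_vector)
    show "AC_loc ?S f"
      unfolding AC_loc_def
    proof (rule exI[of _ ?f1], intro conjI ballI impI)
      show "loc_integrable ?S ?f1"
        unfolding loc_integrable_def
        by (auto intro!: continuous_imp_absolutely_integrable_compact continuous_on_subset[OF f1c])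
      show "(?f1 has_integral (f y - f x)) {x..y}" if "x \<in> ?S" "y \<in> ?S" "x \<le> y" for x y
        using that Icc_subset_einterval[OF that(1,2)]
        by (intro fundamental_theorem_of_calculus has_vector_derivative_at_within[OF fd]) auto
    qed
    show "AC_loc ?S (dx f)"
      unfolding AC_loc_def
    proof (intro exI conjI ballI impI)
      show "loc_integrable ?S (\<lambda>x. of_real (\<kappa>2 x) * u x + of_real (\<kappa>1 x) * dx u x + (dx (dx u) x * of_real (\<kappa> x) + dx u x * of_real (\<kappa>1 x)))"
        using f2 by (auto simp: loc_integrable_def)
      fix x y assume xy: "x \<in> ?S" "y \<in> ?S" "x \<le> y"
      have 1: "((\<lambda>x. of_real (\<kappa>2 x) * u x + of_real (\<kappa>1 x) * dx u x) has_integral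
          (of_real (\<kappa>1 y) * u y - of_real (\<kappa>1 x) * u x)) {x..y}"
      proof (rule fundamental_theorem_of_calculus[OF xy(3)])
        fix t assume "t \<in> {x..y}"
        then have "t \<in> ?S" using Icc_subset_einterval[OF xy(1,2)] by blast
        from has_vector_derivative_mult[OF \<kappa>v(2)[of t] reg(1)[OF this]]
        show "((\<lambda>x. of_real (\<kappa>1 x) * u x) has_vector_derivative of_real (\<kappa>2 t) * u t + of_real (\<kappa>1 t) * dx u t) (at t within {x..y})"
          by (rule_tac has_vector_derivative_at_within) (simp add: add.commute)
      qed
      have 2: "((\<lambda>t. dx (dx u) t * of_real (\<kappa> t) + dx u t * of_real (\<kappa>1 t)) has_integral
          (dx u y * of_real (\<kappa> y) - dx u x * of_real (\<kappa> x))) {x..y}"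
        by (intro sl_regular_mult_C1_integral[OF sl_solutionD(1)[OF u] xy] \<kappa>v \<kappa>c)
      show "((\<lambda>x. of_real (\<kappa>2 x) * u x + of_real (\<kappa>1 x) * dx u x + (dx (dx u) x * of_real (\<kappa> x) + dx u x * of_real (\<kappa>1 x)))
          has_integral (dx f y - dx f x)) {x..y}"
        using has_integral_add[OF 1 2] by (simp add: dxf xy algebra_simps)
    qed
  qed
  have "AE x in lebesgue_on ?S. x \<in> ?S" by (rule AE_I2) simp
  then show "AE x in lebesgue_on ?S.
      z * (of_real (\<kappa> x) * u x) - 2 * of_real (\<kappa>1 x) * dx u x - of_real (\<kappa>2 x) * u x = sl_expr q f x"
    using AC_loc_ae_derivative(1)[OF AC] sl_solutionD(2)[OF u]
  proof eventually_elim
    case (elim x)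
    have "(?f1 has_vector_derivative (of_real (\<kappa>2 x) * u x + of_real (\<kappa>1 x) * dx u x
        + (of_real (\<kappa>1 x) * dx u x + of_real (\<kappa> x) * dx (dx u) x))) (at x)"
      using has_vector_derivative_add[OF has_vector_derivative_mult[OF \<kappa>v(2)[of x] reg(1)[OF elim(1)]]
          has_vector_derivative_mult[OF \<kappa>v(1)[of x] elim(2)]]
      by (simp add: algebra_simps)
    then have "(dx f has_vector_derivative (of_real (\<kappa>2 x) * u x + of_real (\<kappa>1 x) * dx u x
        + (of_real (\<kappa>1 x) * dx u x + of_real (\<kappa> x) * dx (dx u) x))) (at x)"
      by (rule has_vector_derivative_transform_within_open[OF _ open_einterval elim(1)]) (simp add: dxf)
    then have "dx (dx f) x = of_real (\<kappa>2 x) * u x + of_real (\<kappa>1 x) * dx u x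
        + (of_real (\<kappa>1 x) * dx u x + of_real (\<kappa> x) * dx (dx u) x)"
      by (rule vector_derivative_at)
    then show ?case unfolding sl_expr_def elim(3) by (simp add: f_def algebra_simps)
  qed
qed

lemma satisfies_bc_cong:
  assumes "satisfies_bc F \<alpha> u" "eventually (\<lambda>x. f x = u x \<and> dx f x = dx u x) F"
  shows "satisfies_bc F \<alpha> f"
proof (cases \<alpha>)
  case (Some v)
  have "(wronskian v u \<longlongrightarrow> 0) F" using assms(1) Some by (simp add: satisfies_bc_def)
  then have "(wronskian v f \<longlongrightarrow> 0) F"
    by (rule Lim_transform_eventually) (auto intro: eventually_mono[OF assms(2)] simp: wronskian_def)
  then show ?thesis using Some by (simp add: satisfies_bc_def)
qed (simp add: satisfies_bc_def)

lemma dx_cong_open: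
  assumes "open S" "x \<in> S" "\<And>y. y \<in> S \<Longrightarrow> f y = g y"
  shows "dx f x = dx g x"
proof -
  have "eventually (\<lambda>y. f y = g y) (nhds x)"
    using assms by (auto simp: eventually_nhds)
  then show ?thesis by (intro vector_derivative_cong_eq) (auto elim: eventually_mono simp: eventually_at_filter)
qed

lemma satisfies_bc_zero: "satisfies_bc F \<alpha> (\<lambda>x. 0)"
proof (cases \<alpha>)
  case (Some v)
  have "wronskian v (\<lambda>x. 0) = (\<lambda>x. 0)" by (simp add: fun_eq_iff wronskian_def)
  then show ?thesis by (simp add: Some satisfies_bc_def)
qed (simp add: satisfies_bc_def)

text \<open>\<open>cl\<close> and \<open>cr\<close> are the values of the cutoff near the two ends.
  Each is 0 or 1, so one lemma serves both ends: where the value is 0, integrability and boundary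
  condition are trivial, and where it is 1 they are those of \<open>u\<close>.\<close>

lemma cutoff_boundary_identity:
  fixes \<kappa> \<kappa>1 \<kappa>2 :: "real \<Rightarrow> real" and cl cr :: real
  assumes sa: "self_adjoint (einterval a b) (sl_operator a b q \<alpha> \<beta>)"
    and u: "sl_solution (einterval a b) q z u"
    and \<kappa>: "\<And>x. (\<kappa> has_real_derivative \<kappa>1 x) (at x)" "\<And>x. (\<kappa>1 has_real_derivative \<kappa>2 x) (at x)"
      "continuous_on UNIV \<kappa>2"
    and \<kappa>l: "\<And>x. x \<le> p \<Longrightarrow> \<kappa> x = cl" and \<kappa>r: "\<And>x. r \<le> x \<Longrightarrow> \<kappa> x = cr"
    and \<kappa>0: "\<And>x. x \<le> p \<or> r \<le> x \<Longrightarrow> \<kappa>1 x = 0" "\<And>x. x \<le> p \<or> r \<le> x \<Longrightarrow> \<kappa>2 x = 0"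
    and cl: "cl = 0 \<or> cl = 1 \<and> in_domain_near_left a b \<alpha> u"
    and cr: "cr = 0 \<or> cr = 1 \<and> in_domain_near_right a b \<beta> u"
    and pr: "p \<in> einterval a b" "r \<in> einterval a b" "p < r"
  shows "Im z * (cl * integral (einterval a (ereal p)) (\<lambda>x. (cmod (u x))\<^sup>2)
        + cr * integral (einterval (ereal r) b) (\<lambda>x. (cmod (u x))\<^sup>2))
      = cr * Im (cnj (u r) * dx u r) - cl * Im (cnj (u p) * dx u p)"
proof -
  let ?S = "einterval a b" and ?L = "einterval a (ereal p)" and ?R = "einterval (ereal r) b"
  have ends: "a < ereal p" "ereal r < b" "ereal p < b" "a < ereal r" using pr by (auto simp: einterval_def)
  have sub: "?L \<subseteq> ?S" "?R \<subseteq> ?S" by (rule einterval_subset[OF pr(1)], rule einterval_subset[OF pr(2)])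
  have L: "x \<in> ?S" "x \<le> p" if "x \<in> ?L" for x
    using that sub(1) by (auto simp: einterval_def)
  have R: "x \<in> ?S" "r \<le> x" if "x \<in> ?R" for x
    using that sub(2) by (auto simp: einterval_def)
  note reg = sl_regularD[OF sl_solutionD(1)[OF u]]
  define f where "f = (\<lambda>x. of_real (\<kappa> x) * u x)"
  define h where "h = (\<lambda>x. z * (of_real (\<kappa> x) * u x) - 2 * of_real (\<kappa>1 x) * dx u x - of_real (\<kappa>2 x) * u x)"
  note cut = sl_regular_cutoff[OF u \<kappa>, folded f_def]
  have fl: "f x = of_real cl * u x" "h x = z * f x" if "x \<le> p" for x
    using that by (simp_all add: f_def h_def \<kappa>l \<kappa>0)
  have fr: "f x = of_real cr * u x" "h x = z * f x" if "r \<le> x" for x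
    using that by (simp_all add: f_def h_def \<kappa>r \<kappa>0)
  have fl': "dx f x = of_real cl * dx u x" if "x \<in> ?S" "x \<le> p" for x
    using that by (simp add: cut(2) \<kappa>l \<kappa>0)
  have fr': "dx f x = of_real cr * dx u x" if "x \<in> ?S" "r \<le> x" for x
    using that by (simp add: cut(2) \<kappa>r \<kappa>0)
  have el: "eventually (\<lambda>x. x \<in> ?L) (to_left_end a)" by (rule eventually_to_left_end[OF ends(1)])
  have er: "eventually (\<lambda>x. x \<in> ?R) (to_right_end b)" by (rule eventually_to_right_end[OF ends(2)])
  have "eventually (\<lambda>x. f x = of_real cl * u x \<and> dx f x = of_real cl * dx u x) (to_left_end a)"
    using el
  proof (rule eventually_mono)
    show "f x = of_real cl * u x \<and> dx f x = of_real cl * dx u x" if "x \<in> ?L" for x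
      using fl(1)[OF L(2)[OF that]] fl'[OF L[OF that]] by blast
  qed
  then have bcl: "satisfies_bc (to_left_end a) \<alpha> f"
    using cl satisfies_bc_cong[OF satisfies_bc_zero, of f _ \<alpha>] satisfies_bc_cong[of _ \<alpha> u f]
    by (auto simp: in_domain_near_left_def)
  have "eventually (\<lambda>x. f x = of_real cr * u x \<and> dx f x = of_real cr * dx u x) (to_right_end b)"
    using er
  proof (rule eventually_mono)
    show "f x = of_real cr * u x \<and> dx f x = of_real cr * dx u x" if "x \<in> ?R" for x
      using fr(1)[OF R(2)[OF that]] fr'[OF R[OF that]] by blast
  qed
  then have bcr: "satisfies_bc (to_right_end b) \<beta> f"
    using cr satisfies_bc_cong[OF satisfies_bc_zero, of f _ \<beta>] satisfies_bc_cong[of _ \<beta> u f]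
    by (auto simp: in_domain_near_right_def)
  have "L2 ?L (\<lambda>x. of_real cl * u x)"
    using cl L2_near_left_all[OF reg(2) _ pr(1)] by (auto simp: L2_zero in_domain_near_left_def)
  then have L2l: "L2 ?L f" by (rule L2_cong) (simp_all add: fl(1) L(2))
  have "L2 ?R (\<lambda>x. of_real cr * u x)"
    using cr L2_near_right_all[OF reg(2) _ pr(2)] by (auto simp: L2_zero in_domain_near_right_def)
  then have L2r: "L2 ?R f" by (rule L2_cong) (simp_all add: fr(1) R(2))
  have \<kappa>c: "continuous_on A (\<lambda>x. of_real (\<kappa> x) :: complex)" "continuous_on A (\<lambda>x. of_real (\<kappa>1 x) :: complex)"
    "continuous_on A (\<lambda>x. of_real (\<kappa>2 x) :: complex)" for A
    by (rule continuous_on_of_real, rule DERIV_continuous_on[OF has_field_derivative_at_within[OF \<kappa>(1)]]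
          DERIV_continuous_on[OF has_field_derivative_at_within[OF \<kappa>(2)]] continuous_on_subset[OF \<kappa>(3) subset_UNIV])+
  have hc: "continuous_on ?S h"
    unfolding h_def by (intro continuous_intros \<kappa>c reg)
  have hAE: "AE x in lebesgue_on ?S. h x = sl_expr q f x"
    using cut(3) by (simp add: h_def)
  have "Im z * (integral ?L (\<lambda>x. (cmod (f x))\<^sup>2) + integral ?R (\<lambda>x. (cmod (f x))\<^sup>2))
      = Im (cnj (f r) * dx f r) - Im (cnj (f p) * dx f p)"
    by (rule self_adjoint_boundary_identity[OF sa cut(1) _ hc pr _ _ L2l L2r bcl bcr])
      (simp_all add: hAE fl(2) fr(2) L(2) R(2))
  \<comment> \<open>Here and in the three equations that follow, \<open>cl\<close> and
    \<open>cr\<close> equal their own squares, being 0 or 1.\<close>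
  moreover have "integral ?L (\<lambda>x. (cmod (f x))\<^sup>2) = integral ?L (\<lambda>x. cl * (cmod (u x))\<^sup>2)"
    by (rule integral_cong, use cl in \<open>auto simp: fl(1) L(2)\<close>)
  moreover have "integral ?R (\<lambda>x. (cmod (f x))\<^sup>2) = integral ?R (\<lambda>x. cr * (cmod (u x))\<^sup>2)"
    by (rule integral_cong, use cr in \<open>auto simp: fr(1) R(2)\<close>)
  moreover have "Im (cnj (f p) * dx f p) = cl * Im (cnj (u p) * dx u p)"
    using fl(1)[of p] fl'[of p] pr cl by auto
  moreover have "Im (cnj (f r) * dx f r) = cr * Im (cnj (u r) * dx u r)"
    using fr(1)[of r] fr'[of r] pr cr by auto
  ultimately show ?thesis by simp
qed

lemma weyl_left_identity:
  assumes sa: "self_adjoint (einterval a b) (sl_operator a b q \<alpha> \<beta>)"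
    and u: "sl_solution (einterval a b) q z u" and dom: "in_domain_near_left a b \<alpha> u"
    and p: "p \<in> einterval a b"
  shows "Im z * integral (einterval a (ereal p)) (\<lambda>x. (cmod (u x))\<^sup>2) = - Im (cnj (u p) * dx u p)"
proof -
  have ends: "a < ereal p" "ereal p < b" using p by (auto simp: einterval_def)
  \<comment> \<open>Any point between \<open>p\<close> and \<open>b\<close> will do: the cutoff is 1
    up to \<open>p\<close> and 0 from \<open>r\<close> on, so only the boundary term at
    \<open>p\<close> survives.\<close>
  obtain r where "r \<in> einterval (ereal p) b" using einterval_nonempty[OF ends(2)] by blast
  then have pr: "p < r" "r \<in> einterval a b"
    using ends less_trans[OF ends(1), of "ereal r"] by (auto simp: einterval_def)
  obtain \<kappa> \<kappa>1 \<kappa>2 :: "real \<Rightarrow> real" where \<kappa>: "\<And>x. (\<kappa> has_real_derivative \<kappa>1 x) (at x)"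
      "\<And>x. (\<kappa>1 has_real_derivative \<kappa>2 x) (at x)" "continuous_on UNIV \<kappa>2"
      "\<And>x. x \<le> p \<Longrightarrow> \<kappa> x = 1" "\<And>x. r \<le> x \<Longrightarrow> \<kappa> x = 0"
      "\<And>x. x \<le> p \<or> r \<le> x \<Longrightarrow> \<kappa>1 x = 0" "\<And>x. x \<le> p \<or> r \<le> x \<Longrightarrow> \<kappa>2 x = 0"
    using smooth_cutoff[OF pr(1)] by blast
  show ?thesis
    using cutoff_boundary_identity[OF sa u \<kappa> _ _ p pr(2,1)] dom by simp
qed

lemma weyl_right_identity:
  assumes sa: "self_adjoint (einterval a b) (sl_operator a b q \<alpha> \<beta>)"
    and u: "sl_solution (einterval a b) q z u" and dom: "in_domain_near_right a b \<beta> u"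
    and r: "r \<in> einterval a b"
  shows "Im z * integral (einterval (ereal r) b) (\<lambda>x. (cmod (u x))\<^sup>2) = Im (cnj (u r) * dx u r)"
proof -
  have ends: "a < ereal r" "ereal r < b" using r by (auto simp: einterval_def)
  obtain p where "p \<in> einterval a (ereal r)" using einterval_nonempty[OF ends(1)] by blast
  then have pr: "p < r" "p \<in> einterval a b"
    using ends less_trans[of "ereal p" "ereal r" b] by (auto simp: einterval_def)
  obtain \<kappa> \<kappa>1 \<kappa>2 :: "real \<Rightarrow> real" where \<kappa>: "\<And>x. (\<kappa> has_real_derivative \<kappa>1 x) (at x)"
      "\<And>x. (\<kappa>1 has_real_derivative \<kappa>2 x) (at x)" "continuous_on UNIV \<kappa>2"
      "\<And>x. x \<le> p \<Longrightarrow> \<kappa> x = 1" "\<And>x. r \<le> x \<Longrightarrow> \<kappa> x = 0"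
      "\<And>x. x \<le> p \<or> r \<le> x \<Longrightarrow> \<kappa>1 x = 0" "\<And>x. x \<le> p \<or> r \<le> x \<Longrightarrow> \<kappa>2 x = 0"
    using smooth_cutoff[OF pr(1)] by blast
  \<comment> \<open>The complementary cutoff keeps the right end.\<close>
  have d1: "((\<lambda>x. 1 - \<kappa> x) has_real_derivative - \<kappa>1 x) (at x)" for x
    using DERIV_diff[OF DERIV_const \<kappa>(1)] by simp
  have d2: "((\<lambda>x. - \<kappa>1 x) has_real_derivative - \<kappa>2 x) (at x)" for x
    by (rule DERIV_minus[OF \<kappa>(2)])
  have d3: "continuous_on UNIV (\<lambda>x. - \<kappa>2 x)"
    by (intro continuous_on_minus \<kappa>(3))
  show ?thesis
    using cutoff_boundary_identity[OF sa u d1 d2 d3, of p 0 r 1] \<kappa>(4-7) dom pr r by simp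
qed

lemma integral_norm_square_pos:
  assumes cont: "continuous_on (einterval a b) f" and L2: "L2 (einterval a b) f"
    and x: "x \<in> einterval a b" "f x \<noteq> 0"
  shows "integral (einterval a b) (\<lambda>x. (cmod (f x))\<^sup>2) > 0"
proof -
  have "isCont f x" using cont x by (simp add: continuous_on_eq_continuous_at)
  then have "isCont (\<lambda>x. (cmod (f x))\<^sup>2) x" by (intro continuous_intros)
  moreover have "(cmod (f x))\<^sup>2 / 2 < (cmod (f x))\<^sup>2" using x by simp
  ultimately have "eventually (\<lambda>t. (cmod (f x))\<^sup>2 / 2 < (cmod (f t))\<^sup>2) (at x)"
    unfolding isCont_def by (rule order_tendstoD(1))
  moreover have "eventually (\<lambda>t. t \<in> einterval a b) (at x)"
    using x by (intro eventually_at_in_open') auto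
  ultimately have "eventually (\<lambda>t. t \<in> einterval a b \<and> (cmod (f x))\<^sup>2 / 2 \<le> (cmod (f t))\<^sup>2) (at x)"
    by eventually_elim auto
  then obtain d where d: "d > 0" "\<And>t. t \<noteq> x \<Longrightarrow> dist t x < d \<Longrightarrow>
      t \<in> einterval a b \<and> (cmod (f x))\<^sup>2 / 2 \<le> (cmod (f t))\<^sup>2"
    unfolding eventually_at by auto
  have d': "t \<in> einterval a b \<and> (cmod (f x))\<^sup>2 / 2 \<le> (cmod (f t))\<^sup>2" if "t \<in> {x..x + d/2}" for t
    using d(2)[of t] that x d(1) by (cases "t = x") (auto simp: dist_real_def)
  have int: "(\<lambda>x. (cmod (f x))\<^sup>2) integrable_on einterval a b"
    using L2_absolutely_integrable[OF L2] by (intro set_lebesgue_integral_eq_integral(1)) auto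
  have sub: "{x..x + d/2} \<subseteq> einterval a b" using d' by blast
  have int': "(\<lambda>x. (cmod (f x))\<^sup>2) integrable_on {x..x + d/2}"
    by (intro integrable_continuous_real continuous_intros continuous_on_subset[OF cont sub])
  have "0 < (d/2) * ((cmod (f x))\<^sup>2 / 2)" using d x by simp
  also have "\<dots> = integral {x..x + d/2} (\<lambda>t. (cmod (f x))\<^sup>2 / 2)" using d by simp
  also have "\<dots> \<le> integral {x..x + d/2} (\<lambda>x. (cmod (f x))\<^sup>2)"
    using d' by (intro integral_le int') auto
  also have "\<dots> \<le> integral (einterval a b) (\<lambda>x. (cmod (f x))\<^sup>2)"
    by (rule integral_subset_le[OF sub int' int]) simp
  finally show ?thesis .
qed

section \<open>Half-plane conditions for logarithmic derivatives\<close>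

text \<open>The boundary identity is divided by \<open>|u p|^2\<close>. The norm left of
  \<open>p\<close> is positive, since otherwise \<open>u\<close> and with it \<open>dx u\<close>
  would vanish on an interval; for nonreal \<open>z\<close> this also excludes
  \<open>u p = 0\<close>.\<close>

lemma weyl_left_sign:
  assumes sa: "self_adjoint (einterval a b) (sl_operator a b q \<alpha> \<beta>)"
    and u: "sl_solution (einterval a b) q z u" and dom: "in_domain_near_left a b \<alpha> u"
    and nd: "\<And>x. x \<in> einterval a b \<Longrightarrow> u x \<noteq> 0 \<or> dx u x \<noteq> 0"
    and p: "p \<in> einterval a b" and z: "Im z \<noteq> 0"
  shows "u p \<noteq> 0" and "Im z * Im (dx u p / u p) < 0"
proof -
  let ?I = "integral (einterval a (ereal p)) (\<lambda>x. (cmod (u x))\<^sup>2)"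
  note reg = sl_regularD[OF sl_solutionD(1)[OF u]]
  have ends: "a < ereal p" "ereal p < b" using p by (auto simp: einterval_def)
  have sub: "einterval a (ereal p) \<subseteq> einterval a b" by (rule einterval_subset[OF p])
  have "\<exists>x\<in>einterval a (ereal p). u x \<noteq> 0"
  proof (rule ccontr)
    assume "\<not> ?thesis"
    then have 0: "u x = 0" if "x \<in> einterval a (ereal p)" for x using that by blast
    obtain x where x: "x \<in> einterval a (ereal p)" using einterval_nonempty[OF ends(1)] by blast
    have "dx u x = dx (\<lambda>x. 0) x" by (rule dx_cong_open[OF open_einterval x]) (rule 0)
    then show False using nd[of x] 0[OF x] x sub by auto
  qed
  then obtain x where x: "x \<in> einterval a (ereal p)" "u x \<noteq> 0" by blast
  have "?I > 0"
    using dom by (intro integral_norm_square_pos[where f = u and x = x, OF _ _ x] continuous_on_subset[OF reg(2) sub]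
        L2_near_left_all[OF reg(2) _ p]) (simp add: in_domain_near_left_def)
  moreover have eq: "Im z * ?I = - Im (cnj (u p) * dx u p)"
    by (rule weyl_left_identity[OF sa u dom p])
  ultimately have "Im (cnj (u p) * dx u p) \<noteq> 0" using z by auto
  then show up: "u p \<noteq> 0" by auto
  have "Im (dx u p / u p) = Im (cnj (u p) * dx u p) / (cmod (u p))\<^sup>2"
    by (simp add: Im_divide cmod_power2 algebra_simps)
  also have "Im (cnj (u p) * dx u p) = - (Im z * ?I)" using eq by simp
  finally have "Im z * Im (dx u p / u p) = - (Im z)\<^sup>2 * ?I / (cmod (u p))\<^sup>2"
    by (simp add: power2_eq_square[of "Im z"])
  also have "\<dots> < 0" using z up \<open>?I > 0\<close> by (simp add: divide_neg_pos)
  finally show "Im z * Im (dx u p / u p) < 0" .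
qed

text \<open>Mirror image: the boundary term now sits at the left end of the interval of integration
  and changes sign, which moves \<open>u'/u\<close> to the other half-plane.\<close>

lemma weyl_right_sign:
  assumes sa: "self_adjoint (einterval a b) (sl_operator a b q \<alpha> \<beta>)"
    and u: "sl_solution (einterval a b) q z u" and dom: "in_domain_near_right a b \<beta> u"
    and nd: "\<And>x. x \<in> einterval a b \<Longrightarrow> u x \<noteq> 0 \<or> dx u x \<noteq> 0"
    and p: "p \<in> einterval a b" and z: "Im z \<noteq> 0"
  shows "u p \<noteq> 0" and "Im z * Im (dx u p / u p) > 0"
proof -
  let ?I = "integral (einterval (ereal p) b) (\<lambda>x. (cmod (u x))\<^sup>2)"
  note reg = sl_regularD[OF sl_solutionD(1)[OF u]]
  have ends: "a < ereal p" "ereal p < b" using p by (auto simp: einterval_def)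
  have sub: "einterval (ereal p) b \<subseteq> einterval a b" by (rule einterval_subset[OF p])
  have "\<exists>x\<in>einterval (ereal p) b. u x \<noteq> 0"
  proof (rule ccontr)
    assume "\<not> ?thesis"
    then have 0: "u x = 0" if "x \<in> einterval (ereal p) b" for x using that by blast
    obtain x where x: "x \<in> einterval (ereal p) b" using einterval_nonempty[OF ends(2)] by blast
    have "dx u x = dx (\<lambda>x. 0) x" by (rule dx_cong_open[OF open_einterval x]) (rule 0)
    then show False using nd[of x] 0[OF x] x sub by auto
  qed
  then obtain x where x: "x \<in> einterval (ereal p) b" "u x \<noteq> 0" by blast
  have "?I > 0"
    using dom by (intro integral_norm_square_pos[where f = u and x = x, OF _ _ x] continuous_on_subset[OF reg(2) sub]
        L2_near_right_all[OF reg(2) _ p]) (simp add: in_domain_near_right_def)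
  moreover have eq: "Im z * ?I = Im (cnj (u p) * dx u p)"
    by (rule weyl_right_identity[OF sa u dom p])
  ultimately have "Im (cnj (u p) * dx u p) \<noteq> 0" using z by auto
  then show up: "u p \<noteq> 0" by auto
  have "Im (dx u p / u p) = Im (cnj (u p) * dx u p) / (cmod (u p))\<^sup>2"
    by (simp add: Im_divide cmod_power2 algebra_simps)
  then have "Im z * Im (dx u p / u p) = (Im z)\<^sup>2 * ?I / (cmod (u p))\<^sup>2"
    unfolding eq[symmetric] by (simp add: power2_eq_square)
  also have "\<dots> > 0" using z up \<open>?I > 0\<close> by simp
  finally show "Im z * Im (dx u p / u p) > 0" .
qed

section \<open>Solutions for large spectral parameter\<close>

text \<open>Since \<open>u'' = (q + k^2) u\<close>, the derivative of
  \<open>(k u + u') exp (- k t)\<close> is \<open>q u exp (- k t)\<close>: the Volterra equation in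
  first-order form. Only \<open>k^2 = - z\<close> is assumed about \<open>k\<close>, so
  \<open>- k\<close> may be inserted as well, which governs \<open>k u - u'\<close>.\<close>

lemma sl_solution_mult_exp_integral:
  assumes u: "sl_solution (einterval a b) q z u" and k: "k\<^sup>2 = - z"
    and xy: "x \<in> einterval a b" "y \<in> einterval a b" "x \<le> y"
  shows "((\<lambda>t. of_real (q t) * (u t * exp (- (k * of_real (t - c)))))
      has_integral ((k * u y + dx u y) * exp (- (k * of_real (y - c))) - (k * u x + dx u x) * exp (- (k * of_real (x - c))))) {x..y}"
proof -
  let ?p = "\<lambda>t::real. exp (- (k * of_real (t - c)))"
  have sub: "{x..y} \<subseteq> einterval a b" by (rule Icc_subset_einterval[OF xy(1,2)])
  have p: "(?p has_vector_derivative - k * ?p t) (at t)" for t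
  proof -
    have "((\<lambda>w. exp (- (k * (w - of_real c)))) has_field_derivative - k * exp (- (k * (of_real t - of_real c)))) (at (of_real t))"
      by (auto intro!: derivative_eq_intros)
    from has_vector_derivative_real_field[OF this] show ?thesis by simp
  qed
  have 1: "((\<lambda>t. (of_real (q t) - z) * u t * ?p t + dx u t * (- k * ?p t)) has_integral (dx u y * ?p y - dx u x * ?p x)) {x..y}"
    by (rule sl_solution_mult_C1_integral[OF u xy p]) (intro continuous_intros)
  have 2: "((\<lambda>t. u t * (- k * ?p t) + dx u t * ?p t) has_integral (u y * ?p y - u x * ?p x)) {x..y}"
    using sub
    by (intro fundamental_theorem_of_calculus[OF xy(3)] has_vector_derivative_at_within[OF has_vector_derivative_mult]
        p sl_regularD(1)[OF sl_solutionD(1)[OF u]]) auto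
  have z: "z = - (k * k)" using k by (simp add: power2_eq_square eq_neg_iff_add_eq_0 add.commute)
  from has_integral_add[OF 1 has_integral_mult_right[OF 2, of k]] show ?thesis
    by (simp add: z algebra_simps)
qed

text \<open>\<open>A\<close> is the amplitude of the growing exponential in the free solution. The bound on the decaying
  part in terms of \<open>A\<close> will come from the half-plane condition on \<open>u'/u\<close>.\<close>

lemma volterra_estimate:
  fixes q :: "real \<Rightarrow> real"
  assumes u: "sl_solution (einterval a b) q z u" and k: "k\<^sup>2 = - z" "0 \<le> Re k" "k \<noteq> 0"
    and x: "x0 \<in> einterval a b" "x1 \<in> einterval a b" "x0 \<le> x1"
    and q: "q absolutely_integrable_on {x0..x1}" and Q: "integral {x0..x1} (\<lambda>x. \<bar>q x\<bar>) \<le> Q" "2 * Q \<le> cmod k"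
    and A: "A = k * u x0 + dx u x0" and B: "cmod (k * u x0 - dx u x0) \<le> C * cmod A"
  shows "cmod ((k * u x1 + dx u x1) * exp (- (k * of_real (x1 - x0))) - A) \<le> (1 + C) * Q * cmod A / cmod k"
    and "cmod ((k * u x1 - dx u x1) * exp (- (k * of_real (x1 - x0))))
      \<le> C * cmod A * exp (- 2 * Re k * (x1 - x0)) + (1 + C) * Q * cmod A / cmod k"
proof -
  \<comment> \<open>\<open>u\<close> with the expected growth \<open>exp (k (t - x0))\<close>
    divided out. The maximum \<open>N\<close> of its modulus is the quantity to be bounded.\<close>
  define y where "y = (\<lambda>t. u t * exp (- (k * of_real (t - x0))))"
  have sub: "{x0..x1} \<subseteq> einterval a b" by (rule Icc_subset_einterval[OF x(1,2)])
  note reg = sl_regularD[OF sl_solutionD(1)[OF u]]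
  have "continuous_on {x0..x1} (\<lambda>t. cmod (y t))"
    unfolding y_def by (intro continuous_intros continuous_on_subset[OF reg(2) sub])
  then obtain t0 where t0: "t0 \<in> {x0..x1}" "\<And>t. t \<in> {x0..x1} \<Longrightarrow> cmod (y t) \<le> cmod (y t0)"
    using continuous_attains_sup[of "{x0..x1}" "\<lambda>t. cmod (y t)"] x(3) by auto
  define N where "N = cmod (y t0)"
  have N: "cmod (y t) \<le> N" if "t \<in> {x0..x1}" for t using t0(2)[OF that] by (simp add: N_def)
  have N0: "0 \<le> N" by (simp add: N_def)
  have qi: "(\<lambda>x. \<bar>q x\<bar>) integrable_on {x0..x1}"
    using q unfolding absolutely_integrable_on_def by simp
  have qi': "(\<lambda>x. \<bar>q x\<bar>) integrable_on {x0..t}" if "t \<in> {x0..x1}" for t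
    by (rule integrable_on_subinterval[OF qi]) (use that in auto)
  have Qt: "integral {x0..t} (\<lambda>x. \<bar>q x\<bar>) \<le> Q" if "t \<in> {x0..x1}" for t
  proof -
    have "integral {x0..t} (\<lambda>x. \<bar>q x\<bar>) \<le> integral {x0..x1} (\<lambda>x. \<bar>q x\<bar>)"
      using that by (intro integral_subset_le qi qi') auto
    then show ?thesis using Q(1) by linarith
  qed
  have bound: "cmod I \<le> N * M * Q"
    if I: "(f has_integral I) {x0..t}" and t: "t \<in> {x0..x1}" and M: "0 \<le> M"
      and f: "\<And>s. s \<in> {x0..t} \<Longrightarrow> cmod (f s) \<le> \<bar>q s\<bar> * (N * M)" for f I t M
  proof -
    have "((\<lambda>s. \<bar>q s\<bar> * (N * M)) has_integral (integral {x0..t} (\<lambda>x. \<bar>q x\<bar>) * (N * M))) {x0..t}"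
      using qi'[OF t] by (intro has_integral_mult_left) blast
    from has_integral_norm_bound_integral_component[OF I this, of 1] f
    have "cmod I \<le> integral {x0..t} (\<lambda>x. \<bar>q x\<bar>) * (N * M)" by simp
    also have "\<dots> \<le> Q * (N * M)"
      using Qt[OF t] N0 M by (intro mult_right_mono) auto
    finally show ?thesis by (simp add: mult_ac)
  qed
  define \<alpha> where "\<alpha> = (\<lambda>t. (k * u t + dx u t) * exp (- (k * of_real (t - x0))))"
  define \<gamma> where "\<gamma> = (\<lambda>t. (k * u t - dx u t) * exp (- (k * of_real (t - x0))))"
  define B0 where "B0 = k * u x0 - dx u x0"
  have \<alpha>: "cmod (\<alpha> t - A) \<le> N * Q" if t: "t \<in> {x0..x1}" for t
  proof -
    have "((\<lambda>s. of_real (q s) * y s) has_integral (\<alpha> t - A)) {x0..t}"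
      using sl_solution_mult_exp_integral[OF u k(1) x(1), of t x0] t sub by (auto simp: y_def \<alpha>_def A)
    then have "cmod (\<alpha> t - A) \<le> N * 1 * Q"
    proof (rule bound[OF _ t])
      show "cmod (of_real (q s) * y s) \<le> \<bar>q s\<bar> * (N * 1)" if "s \<in> {x0..t}" for s
        using N[of s] that t by (simp add: norm_mult mult_left_mono)
    qed simp
    then show ?thesis by simp
  qed
  have \<gamma>: "cmod (\<gamma> t - B0 * exp (- (2 * k * of_real (t - x0)))) \<le> N * Q" if t: "t \<in> {x0..x1}" for t
  proof -
    let ?e = "\<lambda>s::real. exp (k * of_real (s - x0))"
    \<comment> \<open>The other amplitude obeys the equation with \<open>- k\<close>. Its integrand
      may grow like \<open>exp (2 k (s - x0))\<close>; this factor is taken out again after the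
      estimate.\<close>
    have k': "(-k)\<^sup>2 = - z" using k by simp
    have "((\<lambda>s. of_real (q s) * (u s * ?e s)) has_integral ((- k * u t + dx u t) * ?e t + B0)) {x0..t}"
    proof -
      have "t \<in> einterval a b" "x0 \<le> t" using t sub by auto
      then show ?thesis
        using sl_solution_mult_exp_integral[OF u k' x(1), of t x0] by (simp add: B0_def diff_diff_eq2 add_diff_eq)
    qed
    then have "cmod ((- k * u t + dx u t) * ?e t + B0) \<le> N * exp (2 * Re k * (t - x0)) * Q"
    proof (rule bound[OF _ t])
      fix s assume s: "s \<in> {x0..t}"
      have "u s * ?e s = y s * exp (2 * k * of_real (s - x0))"
        by (simp add: y_def mult.assoc exp_add[symmetric])
      then have "cmod (u s * ?e s) = cmod (y s) * exp (2 * Re k * (s - x0))"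
        by (simp add: norm_mult)
      also have "\<dots> \<le> N * exp (2 * Re k * (t - x0))"
        using s t k(2) N0 by (intro mult_mono N) (auto intro!: mult_left_mono)
      finally show "cmod (of_real (q s) * (u s * ?e s)) \<le> \<bar>q s\<bar> * (N * exp (2 * Re k * (t - x0)))"
        by (simp only: norm_mult norm_of_real mult_left_mono abs_ge_zero)
    qed simp
    moreover have "\<gamma> t - B0 * exp (- (2 * k * of_real (t - x0)))
        = - ((- k * u t + dx u t) * ?e t + B0) * exp (- (2 * k * of_real (t - x0)))"
    proof -
      have "exp (- (k * of_real (t - x0))) = ?e t * exp (- (2 * k * of_real (t - x0)))"
        by (simp add: exp_add[symmetric])
      then show ?thesis unfolding \<gamma>_def by (simp only:) (simp add: algebra_simps)
    qed
    ultimately have "cmod (\<gamma> t - B0 * exp (- (2 * k * of_real (t - x0))))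
        \<le> N * exp (2 * Re k * (t - x0)) * Q * exp (- (2 * Re k * (t - x0)))"
    proof -
      assume eq: "\<gamma> t - B0 * exp (- (2 * k * of_real (t - x0)))
        = - ((- k * u t + dx u t) * ?e t + B0) * exp (- (2 * k * of_real (t - x0)))"
      have "cmod (exp (- (2 * k * of_real (t - x0)))) = exp (- (2 * Re k * (t - x0)))" by simp
      moreover assume "cmod ((- k * u t + dx u t) * ?e t + B0) \<le> N * exp (2 * Re k * (t - x0)) * Q"
      ultimately show ?thesis
        unfolding eq norm_mult norm_minus_cancel by (simp only: mult_right_mono exp_ge_zero)
    qed
    also have "\<dots> = N * Q" by (simp add: exp_minus)
    finally show ?thesis .
  qed
  have k0: "cmod k > 0" using k by simp
  have C0: "cmod B0 \<le> C * cmod A" using B by (simp add: B0_def)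
  \<comment> \<open>At the maximum point \<open>2 k y = \<alpha> + \<gamma>\<close>. The two errors
    \<open>N Q\<close> add up to at most \<open>N |k|\<close> because \<open>2 Q \<le> |k|\<close>,
    and are absorbed by the left side \<open>2 |k| N\<close>.\<close>
  have NA: "cmod k * N \<le> (1 + C) * cmod A"
  proof -
    have "2 * k * y t0 = (\<alpha> t0 - A) + (\<gamma> t0 - B0 * exp (- (2 * k * of_real (t0 - x0)))) + A + B0 * exp (- (2 * k * of_real (t0 - x0)))"
      by (simp add: y_def \<alpha>_def \<gamma>_def algebra_simps)
    then have "cmod (2 * k * y t0) \<le> N * Q + N * Q + cmod A + cmod (B0 * exp (- (2 * k * of_real (t0 - x0))))"
      using \<alpha>[OF t0(1)] \<gamma>[OF t0(1)] by (smt (verit) norm_triangle_ineq)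
    also have "cmod (B0 * exp (- (2 * k * of_real (t0 - x0)))) \<le> C * cmod A * 1"
      unfolding norm_mult using t0(1) k(2) C0 by (intro mult_mono) (auto intro: order_trans[OF norm_ge_zero])
    also have "N * Q + N * Q = N * (2 * Q)" by simp
    also have "\<dots> \<le> N * cmod k" by (intro mult_left_mono Q N0)
    finally show ?thesis by (simp add: N_def norm_mult algebra_simps)
  qed
  have "0 \<le> integral {x0..x1} (\<lambda>x. \<bar>q x\<bar>)" by (rule integral_nonneg[OF qi]) simp
  then have Q0: "0 \<le> Q" using Q(1) by linarith
  have "cmod k * N * Q \<le> (1 + C) * cmod A * Q" by (rule mult_right_mono[OF NA Q0])
  then have NQ: "N * Q \<le> (1 + C) * Q * cmod A / cmod k"
    using k0 by (simp add: field_simps)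
  have x1: "x1 \<in> {x0..x1}" using x by simp
  show "cmod ((k * u x1 + dx u x1) * exp (- (k * of_real (x1 - x0))) - A) \<le> (1 + C) * Q * cmod A / cmod k"
    using \<alpha>[OF x1] NQ unfolding \<alpha>_def by linarith
  have "cmod (B0 * exp (- (2 * k * of_real (x1 - x0)))) \<le> C * cmod A * exp (- 2 * Re k * (x1 - x0))"
    using C0 by (simp add: norm_mult mult_right_mono)
  moreover have "cmod (\<gamma> x1) \<le> cmod (\<gamma> x1 - B0 * exp (- (2 * k * of_real (x1 - x0)))) + cmod (B0 * exp (- (2 * k * of_real (x1 - x0))))"
    by (metis diff_add_cancel norm_triangle_ineq)
  ultimately show "cmod ((k * u x1 - dx u x1) * exp (- (k * of_real (x1 - x0))))
      \<le> C * cmod A * exp (- 2 * Re k * (x1 - x0)) + (1 + C) * Q * cmod A / cmod k"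
    using \<gamma>[OF x1] NQ unfolding \<gamma>_def by linarith
qed

section \<open>The square root of \<open>- z\<close> in sectors\<close>

definition sector :: "real \<Rightarrow> complex set" where
  "sector \<delta> = {z. \<bar>Im z\<bar> \<ge> \<delta> * \<bar>Re z\<bar>}"

definition freq :: "complex \<Rightarrow> complex" where
  "freq z = csqrt (- z)"

lemma freq_square: "(freq z)\<^sup>2 = - z"
  by (simp add: freq_def)

text \<open>Real and imaginary part of the root are tied by \<open>2 Re k Im k = - Im z\<close>.
  Thus \<open>Im k\<close> has the sign opposite to \<open>Im z\<close>, which is also the sign of
  \<open>Im (\<phi>'/\<phi>)\<close>.\<close>

lemma freq_nonreal:
  assumes "Im z \<noteq> 0"
  shows "Re (freq z) > 0" "Im z * Im (freq z) < 0" "freq z \<noteq> 0"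
proof -
  let ?k = "freq z"
  have "Im (?k\<^sup>2) = - Im z" by (simp add: freq_square)
  then have im: "2 * Re ?k * Im ?k = - Im z" by (simp add: power2_eq_square mult_ac)
  then have "Re ?k \<noteq> 0" using assms by auto
  moreover have "Re ?k \<ge> 0" using csqrt_principal[of "- z"] by (auto simp: freq_def)
  ultimately show re: "Re ?k > 0" by simp
  have "Im z * Im ?k = - (2 * Re ?k * (Im ?k)\<^sup>2)" using im by (simp add: power2_eq_square algebra_simps)
  moreover have "Im ?k \<noteq> 0" using im assms by auto
  ultimately show "Im z * Im ?k < 0" using re by simp
  show "?k \<noteq> 0" using re by auto
qed

text \<open>In the sector \<open>|Im z| \<ge> \<eta> |z|\<close> with
  \<open>\<eta> = \<delta> / (1 + \<delta>)\<close>, while \<open>2 |Re k| |Im k| = |Im z|\<close>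
  and \<open>|z| = |k|^2\<close>. Bounding one factor by \<open>|k|\<close> leaves
  \<open>\<eta> / 2 * |k|\<close> as a lower bound for the other.\<close>

lemma freq_sector:
  assumes "0 < \<delta>"
  obtains \<epsilon> where "0 < \<epsilon>" "\<epsilon> < 1"
    "\<And>z. z \<in> sector \<delta> \<Longrightarrow> \<epsilon> * cmod (freq z) \<le> \<bar>Re (freq z)\<bar> \<and> \<epsilon> * cmod (freq z) \<le> \<bar>Im (freq z)\<bar>"
proof -
  define \<eta> where "\<eta> = \<delta> / (1 + \<delta>)"
  have \<eta>: "0 < \<eta>" "\<eta> < 1" using assms by (auto simp: \<eta>_def)
  show thesis
  proof (rule that[of "\<eta> / 2"])
    fix z assume z: "z \<in> sector \<delta>"
    let ?k = "freq z"
    have "cmod z \<le> \<bar>Re z\<bar> + \<bar>Im z\<bar>" by (rule cmod_le)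
    then have "\<delta> * cmod z \<le> \<delta> * \<bar>Re z\<bar> + \<delta> * \<bar>Im z\<bar>"
      using assms by (simp add: distrib_left[symmetric])
    also have "\<dots> \<le> (1 + \<delta>) * \<bar>Im z\<bar>" using z by (simp add: sector_def algebra_simps)
    finally have zi: "\<eta> * cmod z \<le> \<bar>Im z\<bar>" using assms by (simp add: \<eta>_def field_simps)
    have "Im (?k\<^sup>2) = - Im z" by (simp add: freq_square)
    then have "2 * Re ?k * Im ?k = - Im z" by (simp add: power2_eq_square mult_ac)
    then have im: "2 * \<bar>Re ?k\<bar> * \<bar>Im ?k\<bar> = \<bar>Im z\<bar>"
      by (metis abs_minus_cancel abs_mult abs_numeral)
    have "cmod z = cmod (?k\<^sup>2)" by (simp add: freq_square)
    then have kk: "cmod z = cmod ?k * cmod ?k" by (simp add: power2_eq_square norm_mult)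
    show "\<eta> / 2 * cmod ?k \<le> \<bar>Re ?k\<bar> \<and> \<eta> / 2 * cmod ?k \<le> \<bar>Im ?k\<bar>"
    proof (cases "cmod ?k = 0")
      case True
      then show ?thesis by simp
    next
      case False
      have "\<eta> * (cmod ?k * cmod ?k) \<le> 2 * \<bar>Re ?k\<bar> * cmod ?k" "\<eta> * (cmod ?k * cmod ?k) \<le> 2 * cmod ?k * \<bar>Im ?k\<bar>"
        using zi im unfolding kk
        by (smt (verit, best) abs_Im_le_cmod abs_Re_le_cmod mult_left_mono mult_right_mono abs_ge_zero)+
      then show ?thesis using False by (simp add: field_simps)
    qed
  qed (use \<eta> in auto)
qed

lemma eventually_sector:
  assumes "0 < \<delta>"
  shows "eventually (\<lambda>z. z \<in> sector \<delta> \<and> Im z \<noteq> 0) (at_infinity_along (sector \<delta>))"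
proof -
  have "eventually (\<lambda>z::complex. z \<noteq> 0) at_infinity"
    by (auto simp: eventually_at_infinity intro!: exI[of _ 1])
  then show ?thesis
    unfolding at_infinity_along_def eventually_inf_principal
  proof eventually_elim
    case (elim z)
    have "Im z \<noteq> 0" if "z \<in> sector \<delta>"
    proof
      assume "Im z = 0"
      then have "\<delta> * \<bar>Re z\<bar> \<le> 0" using that by (simp add: sector_def)
      then have "Re z = 0" using assms by (simp add: mult_le_0_iff)
      then show False using elim \<open>Im z = 0\<close> by (simp add: complex_eq_iff)
    qed
    then show ?case by blast
  qed
qed

lemma cmod_freq_at_top: "filterlim (\<lambda>z. cmod (freq z)) at_top (at_infinity_along A)"
proof -
  have "filterlim (\<lambda>z::complex. sqrt (cmod z)) at_top at_infinity"
    by (rule filterlim_compose[OF sqrt_at_top filterlim_norm_at_top])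
  moreover have "cmod (freq z) = sqrt (cmod z)" for z
    by (metis freq_square norm_minus_cancel norm_power real_sqrt_unique norm_ge_zero)
  ultimately have "filterlim (\<lambda>z. cmod (freq z)) at_top at_infinity" by simp
  then show ?thesis
    by (rule filterlim_mono) (auto simp: at_infinity_along_def)
qed

section \<open>One operator with its fundamental system\<close>

locale weyl_system =
  fixes a b :: ereal and q :: "real \<Rightarrow> real" and \<alpha> \<beta> :: boundary_condition
    and \<theta> \<phi> :: "complex \<Rightarrow> real \<Rightarrow> complex" and M :: "complex \<Rightarrow> complex"
  assumes q: "loc_integrable (einterval a b) q"
    and separated: "separated_self_adjoint a b q \<alpha> \<beta>"
    and system: "real_entire_system (einterval a b) q \<theta> \<phi>"
    and left: "\<And>z. in_domain_near_left a b \<alpha> (\<phi> z)"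
    and weyl: "singular_weyl_function a b q \<beta> \<theta> \<phi> M"
begin

abbreviation "S \<equiv> einterval a b"

lemma sa: "self_adjoint S (sl_operator a b q \<alpha> \<beta>)"
  using separated by (simp add: separated_self_adjoint_def)

lemma sol: "sl_solution S q z (\<theta> z)" "sl_solution S q z (\<phi> z)"
  using system by (auto simp: real_entire_system_def real_entire_solution_def)

lemma wronskian_1: "x \<in> S \<Longrightarrow> \<theta> z x * dx (\<phi> z) x - dx (\<theta> z) x * \<phi> z x = 1"
  using system by (simp add: real_entire_system_def wronskian_def)

lemma holo:
  assumes "x \<in> S"
  shows "(\<lambda>z. \<theta> z x) holomorphic_on UNIV" "(\<lambda>z. dx (\<theta> z) x) holomorphic_on UNIV"
    "(\<lambda>z. \<phi> z x) holomorphic_on UNIV" "(\<lambda>z. dx (\<phi> z) x) holomorphic_on UNIV"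
  using system assms by (auto simp: real_entire_system_def real_entire_solution_def)

lemma reg:
  shows "x \<in> S \<Longrightarrow> (\<theta> z has_vector_derivative dx (\<theta> z) x) (at x)"
    "x \<in> S \<Longrightarrow> (\<phi> z has_vector_derivative dx (\<phi> z) x) (at x)"
  using sl_regularD(1)[OF sl_solutionD(1)[OF sol(1)]] sl_regularD(1)[OF sl_solutionD(1)[OF sol(2)]] by auto

lemma phi_nondegenerate: "x \<in> S \<Longrightarrow> \<phi> z x \<noteq> 0 \<or> dx (\<phi> z) x \<noteq> 0"
  using wronskian_1[of x z] by auto

lemma phi_sign:
  assumes "x \<in> S" "Im z \<noteq> 0"
  shows "\<phi> z x \<noteq> 0" "Im z * Im (dx (\<phi> z) x / \<phi> z x) < 0"
  using weyl_left_sign[OF sa sol(2) left phi_nondegenerate assms] by auto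

text \<open>Vanishing Cauchy data at one point would make the Wronskians with
  \<open>\<theta>\<close> and \<open>\<phi>\<close> zero everywhere, and \<open>u\<close> is
  recovered from these two. So a nontrivial Weyl solution is nondegenerate at every point, as the
  sign lemma demands.\<close>

lemma weyl_solution_right_sign:
  assumes u: "weyl_solution_right a b q \<beta> z u" and x: "x \<in> S" and z: "Im z \<noteq> 0"
  shows "u x \<noteq> 0" "Im z * Im (dx u x / u x) > 0"
proof -
  have usol: "sl_solution S q z u" and dom: "in_domain_near_right a b \<beta> u"
    and "\<exists>x\<in>S. u x \<noteq> 0" using u by (auto simp: weyl_solution_right_def)
  then obtain y where y: "y \<in> S" "u y \<noteq> 0" by blast
  have nd: "u t \<noteq> 0 \<or> dx u t \<noteq> 0" if t: "t \<in> S" for t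
  proof (rule ccontr)
    assume "\<not> ?thesis"
    then have "wronskian (\<theta> z) u t = 0" "wronskian (\<phi> z) u t = 0" by (auto simp: wronskian_def)
    then have "wronskian (\<theta> z) u y = 0" "wronskian (\<phi> z) u y = 0"
      using wronskian_const[OF sol(1) usol t y(1)] wronskian_const[OF sol(2) usol t y(1)] by auto
    moreover have "\<phi> z y * wronskian (\<theta> z) u y - \<theta> z y * wronskian (\<phi> z) u y
        = u y * (\<theta> z y * dx (\<phi> z) y - dx (\<theta> z) y * \<phi> z y)"
      by (simp add: wronskian_def algebra_simps)
    ultimately show False using wronskian_1[OF y(1)] y(2) by simp
  qed
  show "u x \<noteq> 0" "Im z * Im (dx u x / u x) > 0"
    using weyl_right_sign[OF sa usol dom nd x z] by auto
qed

text \<open>\<open>\<phi> (\<theta> + M \<phi>)\<close> is the diagonal of the Green function, \<open>m\<close> the logarithmic derivative of the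
  Weyl solution at \<open>b\<close>.\<close>

lemma green_diagonal:
  assumes z: "Im z \<noteq> 0"
  obtains m where "\<And>x. x \<in> S \<Longrightarrow> Im z * Im (m x) > 0"
    "\<And>x. x \<in> S \<Longrightarrow> \<phi> z x * (\<theta> z x + M z * \<phi> z x) = 1 / (dx (\<phi> z) x / \<phi> z x - m x)"
proof -
  have "z \<notin> \<real>" using z by (auto simp: complex_is_Real_iff)
  then obtain u where u: "weyl_solution_right a b q \<beta> z u"
      and M: "\<And>x. x \<in> S \<Longrightarrow> M z = - wronskian (\<theta> z) u x / wronskian (\<phi> z) u x"
    using weyl unfolding singular_weyl_function_def by blast
  show thesis
  proof (rule that[of "\<lambda>x. dx u x / u x"])
    fix x assume x: "x \<in> S"
    show pos: "Im z * Im (dx u x / u x) > 0" by (rule weyl_solution_right_sign[OF u x z])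
    have u0: "u x \<noteq> 0" by (rule weyl_solution_right_sign[OF u x z])
    note p = phi_sign[OF x z]
    have ne: "dx (\<phi> z) x / \<phi> z x - dx u x / u x \<noteq> 0" using pos p(2) by auto
    \<comment> \<open>Difference of the logarithmic derivatives of \<open>\<phi>\<close> and of the
      Weyl solution, nonzero because they lie in opposite half-planes.\<close>
    define D where "D = dx (\<phi> z) x / \<phi> z x - dx u x / u x"
    have D0: "D \<noteq> 0" using ne by (simp add: D_def)
    have W: "wronskian (\<phi> z) u x = - (\<phi> z x * u x * D)"
      using u0 p(1) by (simp add: wronskian_def D_def field_simps)
    then have W0: "wronskian (\<phi> z) u x \<noteq> 0" using u0 p(1) D0 by simp
    have MW: "M z * wronskian (\<phi> z) u x = - wronskian (\<theta> z) u x"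
      using M[OF x] W0 by simp
    have "(\<theta> z x + M z * \<phi> z x) * (\<phi> z x * D) * u x
        = - (\<theta> z x * wronskian (\<phi> z) u x + M z * wronskian (\<phi> z) u x * \<phi> z x)"
      unfolding W by (simp add: algebra_simps)
    also have "\<dots> = u x * (\<theta> z x * dx (\<phi> z) x - dx (\<theta> z) x * \<phi> z x)"
      unfolding MW by (simp add: wronskian_def algebra_simps)
    also have "\<dots> = 1 * u x" using wronskian_1[OF x] by simp
    finally have "(\<theta> z x + M z * \<phi> z x) * (\<phi> z x * D) = 1"
      unfolding mult_right_cancel[OF u0] .
    then show "\<phi> z x * (\<theta> z x + M z * \<phi> z x) = 1 / (dx (\<phi> z) x / \<phi> z x - dx u x / u x)"
      using D0 unfolding D_def[symmetric] by (simp add: eq_divide_eq mult_ac)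
  qed
qed

section \<open>Asymptotics in a fixed sector\<close>

context
  fixes \<delta> :: real
  assumes \<delta>: "0 < \<delta>"
begin

abbreviation "F \<equiv> at_infinity_along (sector \<delta>)"

text \<open>\<open>A\<close> is the unknown growing amplitude at \<open>x0\<close>. With
  \<open>m = \<phi>'/\<phi>\<close> at \<open>x0\<close>, the equal signs of \<open>Im m\<close> and
  \<open>Im k\<close> give \<open>|k + m| \<ge> |Im k| \<ge> \<epsilon> |k|\<close>; this yields
  both \<open>A \<noteq> 0\<close> and the bound on \<open>k \<phi> - \<phi>'\<close> that the
  Volterra estimate requires. Sum and difference of the two amplitudes at \<open>x\<close> then
  isolate \<open>\<phi>\<close> and its derivative.\<close>

lemma asymptotics_aux:
  assumes x: "x0 \<in> S" "x \<in> S" "x0 < x"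
  defines "A \<equiv> \<lambda>z. freq z * \<phi> z x0 + dx (\<phi> z) x0"
    and "e \<equiv> \<lambda>z. exp (- (freq z * of_real (x - x0)))"
  shows "eventually (\<lambda>z. A z \<noteq> 0) F"
    and "((\<lambda>z. 2 * freq z * \<phi> z x * e z / A z) \<longlongrightarrow> 1) F"
    and "((\<lambda>z. 2 * dx (\<phi> z) x * e z / A z) \<longlongrightarrow> 1) F"
proof -
  obtain \<epsilon> where \<epsilon>: "0 < \<epsilon>" "\<epsilon> < 1"
    "\<And>z. z \<in> sector \<delta> \<Longrightarrow> \<epsilon> * cmod (freq z) \<le> \<bar>Re (freq z)\<bar> \<and> \<epsilon> * cmod (freq z) \<le> \<bar>Im (freq z)\<bar>"
    using freq_sector[OF \<delta>] by blast
  \<comment> \<open>From \<open>|k - m| \<le> 2 |k| + |k + m|\<close> and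
    \<open>|k| \<le> |k + m| / \<epsilon>\<close>.\<close>
  define C where "C = 1 + 2 / \<epsilon>"
  have "{x0..x} \<subseteq> S" using x by (intro Icc_subset_einterval)
  then have qi: "q absolutely_integrable_on {x0..x}" using q by (auto simp: loc_integrable_def)
  define Q where "Q = integral {x0..x} (\<lambda>x. \<bar>q x\<bar>)"
  have AB: "A z \<noteq> 0 \<and> cmod (freq z * \<phi> z x0 - dx (\<phi> z) x0) \<le> C * cmod (A z)"
    if z: "z \<in> sector \<delta>" "Im z \<noteq> 0" for z
  proof -
    let ?k = "freq z"
    define m where "m = dx (\<phi> z) x0 / \<phi> z x0"
    note p = phi_sign[OF x(1) z(2), folded m_def]
    note k = freq_nonreal[OF z(2)]
    have Am: "A z = \<phi> z x0 * (?k + m)" "?k * \<phi> z x0 - dx (\<phi> z) x0 = \<phi> z x0 * (?k - m)"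
      using p(1) by (simp_all add: A_def m_def field_simps)
    have "\<bar>Im ?k\<bar> \<le> \<bar>Im (?k + m)\<bar>"
      using k(2) p(2) by (auto simp: mult_less_0_iff)
    then have "\<epsilon> * cmod ?k \<le> cmod (?k + m)"
      using \<epsilon>(3)[OF z(1)] abs_Im_le_cmod[of "?k + m"] by linarith
    then have km: "cmod ?k \<le> cmod (?k + m) / \<epsilon>" using \<epsilon> by (simp add: field_simps)
    have "0 < cmod (?k + m)"
      using \<open>\<epsilon> * cmod ?k \<le> cmod (?k + m)\<close> \<epsilon>(1) k(3) by (smt (verit) mult_pos_pos zero_less_norm_iff)
    then have "A z \<noteq> 0" using p(1) Am by auto
    have "cmod (?k - m) = cmod (2 * ?k - (?k + m))" by (simp add: algebra_simps)
    also have "\<dots> \<le> 2 * cmod ?k + cmod (?k + m)"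
      by (rule order_trans[OF norm_triangle_ineq4]) (simp add: norm_mult)
    also have "\<dots> \<le> C * cmod (?k + m)" using km by (simp add: C_def algebra_simps)
    finally have "cmod (\<phi> z x0 * (?k - m)) \<le> C * cmod (A z)"
      unfolding Am norm_mult using mult_left_mono[of "cmod (?k - m)" "C * cmod (?k + m)" "cmod (\<phi> z x0)"]
      by (simp add: mult_ac)
    then show ?thesis using \<open>A z \<noteq> 0\<close> Am by simp
  qed
  show A0: "eventually (\<lambda>z. A z \<noteq> 0) F"
    using eventually_sector[OF \<delta>] by eventually_elim (use AB in blast)
  \<comment> \<open>Common majorant of both relative errors as a function of \<open>r = |k|\<close>
    alone; \<open>Re k \<ge> \<epsilon> |k|\<close> controls the exponential.\<close>
  define bd where "bd = (\<lambda>r. C * exp (- (2 * \<epsilon> * (x - x0)) * r) + (1 + C) * Q * inverse r)"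
  have "(bd \<longlongrightarrow> C * 0 + (1 + C) * Q * 0) at_top"
  proof -
    have "filterlim (\<lambda>r. (2 * \<epsilon> * (x - x0)) * r) at_top at_top"
      using \<epsilon> x(3) by (intro filterlim_tendsto_pos_mult_at_top[OF tendsto_const]) (auto intro: filterlim_ident)
    then have "filterlim (\<lambda>r. - (2 * \<epsilon> * (x - x0)) * r) at_bot at_top"
      by (simp add: filterlim_uminus_at_bot)
    then have "((\<lambda>r. exp (- (2 * \<epsilon> * (x - x0)) * r)) \<longlongrightarrow> 0) at_top"
      by (rule filterlim_compose[OF exp_at_bot])
    then show ?thesis
      unfolding bd_def by (intro tendsto_intros tendsto_inverse_0_at_top filterlim_ident)
  qed
  then have "(bd \<longlongrightarrow> 0) at_top" by simp
  then have bd0: "((\<lambda>z. bd (cmod (freq z))) \<longlongrightarrow> 0) F"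
    by (rule filterlim_compose[OF _ cmod_freq_at_top])
  have "eventually (\<lambda>z. 2 * Q \<le> cmod (freq z)) F"
    using cmod_freq_at_top by (auto simp: filterlim_at_top)
  with eventually_sector[OF \<delta>]
  have ev: "eventually (\<lambda>z. cmod ((freq z * \<phi> z x + dx (\<phi> z) x) * e z / A z - 1) \<le> bd (cmod (freq z)) \<and>
      cmod ((freq z * \<phi> z x - dx (\<phi> z) x) * e z / A z) \<le> bd (cmod (freq z))) F"
  proof eventually_elim
    case (elim z)
    let ?k = "freq z"
    note k = freq_nonreal[of z]
    have z: "z \<in> sector \<delta>" "Im z \<noteq> 0" using elim by auto
    note AB = AB[OF z]
    have A: "cmod (A z) > 0" using AB by simp
    have k0: "0 \<le> Re ?k" "?k \<noteq> 0" "?k\<^sup>2 = - z" using k z by (auto simp: freq_square)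
    have A1: "A z = ?k * \<phi> z x0 + dx (\<phi> z) x0" by (simp add: A_def)
    note V = volterra_estimate[OF sol(2) k0(3,1,2) x(1,2) less_imp_le[OF x(3)] qi
        eq_refl[OF Q_def[symmetric]] elim(2) A1 conjunct2[OF AB]]
    have eq: "(?k * \<phi> z x + dx (\<phi> z) x) * e z / A z - 1 = ((?k * \<phi> z x + dx (\<phi> z) x) * e z - A z) / A z"
      using A by (simp add: field_simps)
    have "cmod ((?k * \<phi> z x + dx (\<phi> z) x) * e z / A z - 1) \<le> (1 + C) * Q * cmod (A z) / cmod ?k / cmod (A z)"
      unfolding eq norm_divide unfolding e_def by (simp only: divide_right_mono[OF V(1)] norm_ge_zero)
    also have "\<dots> = (1 + C) * Q * inverse (cmod ?k)" using A by (simp add: divide_inverse mult_ac)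
    also have "\<dots> \<le> bd (cmod ?k)"
      using \<epsilon> by (simp add: bd_def C_def)
    finally have 1: "cmod ((?k * \<phi> z x + dx (\<phi> z) x) * e z / A z - 1) \<le> bd (cmod ?k)" .
    have "cmod ((?k * \<phi> z x - dx (\<phi> z) x) * e z / A z)
        \<le> (C * cmod (A z) * exp (- 2 * Re ?k * (x - x0)) + (1 + C) * Q * cmod (A z) / cmod ?k) / cmod (A z)"
      unfolding norm_divide e_def by (simp only: divide_right_mono[OF V(2)] norm_ge_zero)
    also have "\<dots> = C * exp (- 2 * Re ?k * (x - x0)) + (1 + C) * Q * inverse (cmod ?k)"
      using A by (simp add: field_simps)
    also have "\<dots> \<le> bd (cmod ?k)"
    proof -
      have "\<epsilon> * cmod ?k \<le> Re ?k" using \<epsilon>(3)[OF z(1)] k0(1) by simp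
      then have "2 * (x - x0) * (\<epsilon> * cmod ?k) \<le> 2 * (x - x0) * Re ?k"
        using x(3) by (intro mult_left_mono) auto
      then have "exp (- 2 * Re ?k * (x - x0)) \<le> exp (- (2 * \<epsilon> * (x - x0)) * cmod ?k)"
        by (simp add: mult_ac)
      then show ?thesis using \<epsilon> by (auto simp: bd_def C_def intro!: mult_left_mono)
    qed
    finally show ?case using 1 by blast
  qed
  have "((\<lambda>z. (freq z * \<phi> z x + dx (\<phi> z) x) * e z / A z - 1) \<longlongrightarrow> 0) F"
    by (rule Lim_null_comparison[OF eventually_mono[OF ev] bd0]) blast
  then have l1: "((\<lambda>z. (freq z * \<phi> z x + dx (\<phi> z) x) * e z / A z) \<longlongrightarrow> 1) F"
    by (simp add: LIM_zero_iff)
  have l2: "((\<lambda>z. (freq z * \<phi> z x - dx (\<phi> z) x) * e z / A z) \<longlongrightarrow> 0) F"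
    by (rule Lim_null_comparison[OF eventually_mono[OF ev] bd0]) blast
  show "((\<lambda>z. 2 * freq z * \<phi> z x * e z / A z) \<longlongrightarrow> 1) F"
    using tendsto_add[OF l1 l2] by (simp add: add_divide_distrib[symmetric] algebra_simps)
  show "((\<lambda>z. 2 * dx (\<phi> z) x * e z / A z) \<longlongrightarrow> 1) F"
    using tendsto_diff[OF l1 l2] by (simp add: diff_divide_distrib[symmetric] algebra_simps)
qed

text \<open>Quotient of the two limits at \<open>x\<close>, in which amplitude and exponential
  cancel. The auxiliary \<open>x0\<close> lies strictly left of \<open>x\<close>, so that the
  decaying part has room to die out.\<close>

lemma log_derivative_asymptotics:
  assumes x: "x \<in> S"
  shows "((\<lambda>z. dx (\<phi> z) x / (freq z * \<phi> z x)) \<longlongrightarrow> 1) F"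
proof -
  have "a < ereal x" "ereal x < b" using x by (auto simp: einterval_def)
  then obtain x0 where "x0 \<in> einterval a (ereal x)" using einterval_nonempty by blast
  then have x0: "x0 \<in> S" "x0 < x" using einterval_subset(1)[OF x] by (auto simp: einterval_def)
  note as = asymptotics_aux[OF x0(1) x x0(2)]
  show ?thesis
  proof (rule Lim_transform_eventually)
    show "((\<lambda>z. (2 * dx (\<phi> z) x * exp (- (freq z * of_real (x - x0))) / (freq z * \<phi> z x0 + dx (\<phi> z) x0)) /
        (2 * freq z * \<phi> z x * exp (- (freq z * of_real (x - x0))) / (freq z * \<phi> z x0 + dx (\<phi> z) x0))) \<longlongrightarrow> 1) F"
      using tendsto_divide[OF as(3,2)] by simp
    show "eventually (\<lambda>z. (2 * dx (\<phi> z) x * exp (- (freq z * of_real (x - x0))) / (freq z * \<phi> z x0 + dx (\<phi> z) x0)) /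
        (2 * freq z * \<phi> z x * exp (- (freq z * of_real (x - x0))) / (freq z * \<phi> z x0 + dx (\<phi> z) x0))
        = dx (\<phi> z) x / (freq z * \<phi> z x)) F"
      using as(1) by eventually_elim simp
  qed
qed

text \<open>Both points are compared with the same auxiliary \<open>x0\<close> left of
  \<open>x\<close>; the amplitude cancels and \<open>exp (k (y - x))\<close> remains.\<close>

lemma ratio_asymptotics:
  assumes xy: "x \<in> S" "y \<in> S" "x < y"
  shows "((\<lambda>z. \<phi> z y / \<phi> z x * exp (- (freq z * of_real (y - x)))) \<longlongrightarrow> 1) F"
proof -
  have "a < ereal x" "ereal x < b" using xy by (auto simp: einterval_def)
  then obtain x0 where "x0 \<in> einterval a (ereal x)" using einterval_nonempty by blast
  then have x0: "x0 \<in> S" "x0 < x" using einterval_subset(1)[OF xy(1)] by (auto simp: einterval_def)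
  let ?A = "\<lambda>z. freq z * \<phi> z x0 + dx (\<phi> z) x0"
  let ?f = "\<lambda>x z. 2 * freq z * \<phi> z x * exp (- (freq z * of_real (x - x0))) / ?A z"
  note as = asymptotics_aux[OF x0(1) xy(1) x0(2)]
  have as2: "(?f y \<longlongrightarrow> 1) F" using x0 xy by (intro asymptotics_aux(2)) auto
  show ?thesis
  proof (rule Lim_transform_eventually)
    show "((\<lambda>z. ?f y z / ?f x z) \<longlongrightarrow> 1) F"
      using tendsto_divide[OF as2 as(2)] by simp
    show "eventually (\<lambda>z. ?f y z / ?f x z = \<phi> z y / \<phi> z x * exp (- (freq z * of_real (y - x)))) F"
      using as(1) eventually_sector[OF \<delta>]
    proof eventually_elim
      case (elim z)
      have "freq z \<noteq> 0" using freq_nonreal[of z] elim by auto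
      moreover have "exp (- (freq z * of_real (y - x0)))
          = exp (- (freq z * of_real (y - x))) * exp (- (freq z * of_real (x - x0)))"
        by (simp add: exp_add[symmetric] algebra_simps)
      ultimately show ?case using elim(1) by (simp only:) simp
    qed
  qed
qed

lemma ratio_tendsto_0:
  assumes xy: "x \<in> S" "y \<in> S" "x < y"
  shows "((\<lambda>z. \<phi> z x / \<phi> z y) \<longlongrightarrow> 0) F"
proof -
  obtain \<epsilon> where \<epsilon>: "0 < \<epsilon>"
    "\<And>z. z \<in> sector \<delta> \<Longrightarrow> \<epsilon> * cmod (freq z) \<le> \<bar>Re (freq z)\<bar> \<and> \<epsilon> * cmod (freq z) \<le> \<bar>Im (freq z)\<bar>"
    using freq_sector[OF \<delta>] by metis
  have "filterlim (\<lambda>r. (\<epsilon> * (y - x)) * r) at_top at_top"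
    using \<epsilon> xy(3) by (intro filterlim_tendsto_pos_mult_at_top[OF tendsto_const]) (auto intro: filterlim_ident)
  then have "filterlim (\<lambda>r. - (\<epsilon> * (y - x)) * r) at_bot at_top"
    by (simp add: filterlim_uminus_at_bot)
  then have "((\<lambda>r. exp (- (\<epsilon> * (y - x)) * r)) \<longlongrightarrow> 0) at_top"
    by (rule filterlim_compose[OF exp_at_bot])
  then have lim: "((\<lambda>z. exp (- (\<epsilon> * (y - x)) * cmod (freq z))) \<longlongrightarrow> 0) F"
    by (rule filterlim_compose[OF _ cmod_freq_at_top])
  have "eventually (\<lambda>z. cmod (exp (- (freq z * of_real (y - x)))) \<le> exp (- (\<epsilon> * (y - x)) * cmod (freq z))) F"
    using eventually_sector[OF \<delta>]
  proof eventually_elim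
    case (elim z)
    have "\<epsilon> * cmod (freq z) \<le> Re (freq z)"
      using \<epsilon>(2)[of z] freq_nonreal(1)[of z] elim by auto
    then have "\<epsilon> * cmod (freq z) * (y - x) \<le> Re (freq z) * (y - x)"
      using xy(3) by (intro mult_right_mono) auto
    then show ?case by (simp add: mult_ac)
  qed
  then have e0: "((\<lambda>z. exp (- (freq z * of_real (y - x)))) \<longlongrightarrow> 0) F"
    by (rule Lim_null_comparison[OF _ lim])
  have "((\<lambda>z. exp (- (freq z * of_real (y - x))) / (\<phi> z y / \<phi> z x * exp (- (freq z * of_real (y - x))))) \<longlongrightarrow> 0 / 1) F"
    by (intro tendsto_divide e0 ratio_asymptotics xy) simp
  then show ?thesis by (simp add: field_simps)
qed

text \<open>The imaginary parts of \<open>\<phi>'/\<phi>\<close> and \<open>m\<close> have opposite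
  signs, so the denominator of the diagonal is at least \<open>|Im (\<phi>'/\<phi>)|\<close>, which
  is comparable to \<open>|k|\<close>. The sign of \<open>Im m\<close> thus stands in for an
  asymptotic of the Weyl solution.\<close>

lemma green_diagonal_bigo:
  assumes x: "x \<in> S"
  shows "(\<lambda>z. \<phi> z x * (\<theta> z x + M z * \<phi> z x)) \<in> O[F](\<lambda>z. 1 / freq z)"
proof -
  obtain \<epsilon> where \<epsilon>: "0 < \<epsilon>"
    "\<And>z. z \<in> sector \<delta> \<Longrightarrow> \<epsilon> * cmod (freq z) \<le> \<bar>Re (freq z)\<bar> \<and> \<epsilon> * cmod (freq z) \<le> \<bar>Im (freq z)\<bar>"
    using freq_sector[OF \<delta>] by metis
  \<comment> \<open>The tolerance is half of the share \<open>\<epsilon>\<close> of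
    \<open>|k|\<close> that \<open>|Im k|\<close> is known to have, so the other half remains for
    \<open>|Im (\<phi>'/\<phi>)|\<close>.\<close>
  have "eventually (\<lambda>z. dist (dx (\<phi> z) x / (freq z * \<phi> z x)) 1 < \<epsilon> / 2) F"
    using \<epsilon> by (intro tendstoD[OF log_derivative_asymptotics[OF x]]) auto
  then have "eventually (\<lambda>z. cmod (\<phi> z x * (\<theta> z x + M z * \<phi> z x)) \<le> 2 / \<epsilon> * cmod (1 / freq z)) F"
    using eventually_sector[OF \<delta>]
  proof eventually_elim
    case (elim z)
    then have z: "z \<in> sector \<delta>" "Im z \<noteq> 0" by auto
    let ?k = "freq z" and ?m = "dx (\<phi> z) x / \<phi> z x"
    note k = freq_nonreal[OF z(2)] and p = phi_sign[OF x z(2)]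
    obtain m where m: "Im z * Im (m x) > 0" 
        "\<phi> z x * (\<theta> z x + M z * \<phi> z x) = 1 / (?m - m x)"
      using green_diagonal[OF z(2)] x by metis
    have "?m - ?k = ?k * (dx (\<phi> z) x / (?k * \<phi> z x) - 1)"
      using k(3) p(1) by (simp add: field_simps)
    then have "cmod (?m - ?k) = cmod ?k * cmod (dx (\<phi> z) x / (?k * \<phi> z x) - 1)" by (simp only: norm_mult)
    also have "\<dots> \<le> cmod ?k * (\<epsilon> / 2)"
      using elim(1) by (intro mult_left_mono) (auto simp: dist_norm)
    finally have "\<bar>Im ?m - Im ?k\<bar> \<le> cmod ?k * (\<epsilon> / 2)"
      using abs_Im_le_cmod[of "?m - ?k"] by (simp del: Im_divide)
    moreover have "\<epsilon> * cmod ?k \<le> \<bar>Im ?k\<bar>" using \<epsilon>(2)[OF z(1)] by simp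
    moreover have "cmod ?k * (\<epsilon> / 2) = \<epsilon> * cmod ?k / 2" "\<epsilon> / 2 * cmod ?k = \<epsilon> * cmod ?k / 2" by simp_all
    ultimately have "\<epsilon> / 2 * cmod ?k \<le> \<bar>Im ?m\<bar>" by linarith
    also have "\<bar>Im ?m\<bar> \<le> \<bar>Im (?m - m x)\<bar>"
      using p(2) m(1) by (auto simp: mult_less_0_iff zero_less_mult_iff simp del: Im_divide)
    also have "\<dots> \<le> cmod (?m - m x)" by (rule abs_Im_le_cmod)
    finally have le: "\<epsilon> / 2 * cmod ?k \<le> cmod (?m - m x)" .
    have pos: "0 < \<epsilon> / 2 * cmod ?k" using \<epsilon> k(3) by simp
    have "cmod (1 / (?m - m x)) = 1 / cmod (?m - m x)" by (simp add: norm_divide)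
    also have "\<dots> \<le> 1 / (\<epsilon> / 2 * cmod ?k)" by (rule divide_left_mono[OF le]) (use le pos in \<open>auto intro!: mult_pos_pos\<close>)
    finally show ?case unfolding m(2) by (simp add: norm_divide)
  qed
  then show ?thesis by (rule bigoI)
qed

end

end

section \<open>Entire functions of finite order\<close>

text \<open>The infimum defining the order may fail to be attained, so the bound is available for
  exponents strictly above \<open>s\<close>.\<close>

lemma growth_order_leD:
  assumes "growth_order f \<le> ereal s" "s < \<rho>"
  shows "(\<lambda>z. cmod (f z)) \<in> O[at_infinity](\<lambda>z. exp (cmod z powr \<rho>))"
proof -
  have "growth_order f < ereal \<rho>"
    using assms by (metis ereal_less(2) less_ereal.simps(1) le_less_trans)
  then obtain \<sigma> where \<sigma>: "0 \<le> \<sigma>" "\<sigma> < \<rho>"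
      "(\<lambda>z. cmod (f z)) \<in> O[at_infinity](\<lambda>z. exp (cmod z powr \<sigma>))"
    unfolding growth_order_def Inf_less_iff by auto
  have "(\<lambda>z. exp (cmod z powr \<sigma>)) \<in> O[at_infinity](\<lambda>z::complex. exp (cmod z powr \<rho>))"
    using \<sigma>(1,2) eventually_at_infinityI[of 1]
    by (intro landau_o.big_mono) (auto simp: powr_mono eventually_at_infinity intro!: exI[of _ 1])
  with \<sigma>(3) show ?thesis by (rule landau_o.big_trans)
qed

lemma growth_order_leI:
  assumes "0 \<le> s"
    and "\<And>\<rho>. s < \<rho> \<Longrightarrow> (\<lambda>z. cmod (f z)) \<in> O[at_infinity](\<lambda>z. exp (cmod z powr \<rho>))"
  shows "growth_order f \<le> ereal s"
proof (rule dense_ge)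
  fix y assume y: "ereal s < y"
  then obtain \<rho> where \<rho>: "ereal s < ereal \<rho>" "ereal \<rho> < y"
    using ereal_dense2 by blast
  then have "growth_order f \<le> ereal \<rho>"
    unfolding growth_order_def using assms by (intro Inf_lower) auto
  with \<rho> show "growth_order f \<le> y" by simp
qed

lemma growth_order_diff_le:
  assumes "0 \<le> s" "growth_order f \<le> ereal s" "growth_order g \<le> ereal s"
  shows "growth_order (\<lambda>z. f z - g z) \<le> ereal s"
proof (rule growth_order_leI)
  fix \<rho> assume "s < \<rho>"
  then have "(\<lambda>z. cmod (f z) + cmod (g z)) \<in> O[at_infinity](\<lambda>z. exp (cmod z powr \<rho>))"
    using growth_order_leD[OF assms(2)] growth_order_leD[OF assms(3)]
    by (intro sum_in_bigo) auto
  moreover have "(\<lambda>z. cmod (f z - g z)) \<in> O[at_infinity](\<lambda>z. cmod (f z) + cmod (g z))"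
    by (intro landau_o.big_mono always_eventually) (simp add: norm_triangle_ineq4)
  ultimately show "(\<lambda>z. cmod (f z - g z)) \<in> O[at_infinity](\<lambda>z. exp (cmod z powr \<rho>))"
    by (rule landau_o.big_trans[rotated])
qed (use assms in auto)

text \<open>An intermediate exponent \<open>\<sigma>\<close> leaves the room needed:
  \<open>2 r^\<sigma> \<le> r^\<rho>\<close> for large \<open>r\<close>.\<close>

lemma growth_order_mult_le:
  assumes "0 \<le> s" "growth_order f \<le> ereal s" "growth_order g \<le> ereal s"
  shows "growth_order (\<lambda>z. f z * g z) \<le> ereal s"
proof (rule growth_order_leI)
  fix \<rho> assume "s < \<rho>"
  then obtain \<sigma> where \<sigma>: "s < \<sigma>" "\<sigma> < \<rho>" using dense by blast
  have "(\<lambda>z. cmod (f z) * cmod (g z)) \<in> O[at_infinity](\<lambda>z. exp (cmod z powr \<sigma>) * exp (cmod z powr \<sigma>))"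
    using growth_order_leD[OF assms(2) \<sigma>(1)] growth_order_leD[OF assms(3) \<sigma>(1)]
    by (intro landau_o.big.mult) auto
  also have "eventually (\<lambda>r::real. exp (r powr \<sigma>) * exp (r powr \<sigma>) \<le> exp (r powr \<rho>)) at_top"
  proof -
    have "eventually (\<lambda>r::real. r powr (\<rho> - \<sigma>) \<ge> 2) at_top"
    proof -
      have "eventually (\<lambda>r::real. r powr p \<ge> 2) at_top" if "0 < p" for p
        using that by real_asymp
      then show ?thesis using \<sigma> by simp
    qed
    then show ?thesis using eventually_gt_at_top[of 0]
    proof eventually_elim
      case (elim r)
      have "r powr \<rho> = r powr \<sigma> * r powr (\<rho> - \<sigma>)"
        by (simp add: powr_add[symmetric])
      also have "\<dots> \<ge> r powr \<sigma> * 2"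
        using elim by (intro mult_left_mono) auto
      finally show ?case by (simp add: exp_add[symmetric])
    qed
  qed
  then have "eventually (\<lambda>z::complex. exp (cmod z powr \<sigma>) * exp (cmod z powr \<sigma>) \<le> exp (cmod z powr \<rho>))
      at_infinity"
    by (rule eventually_compose_filterlim[OF _ filterlim_norm_at_top])
  then have "(\<lambda>z. exp (cmod z powr \<sigma>) * exp (cmod z powr \<sigma>)) \<in>
      O[at_infinity](\<lambda>z::complex. exp (cmod z powr \<rho>))"
    by (intro landau_o.big_mono) auto
  finally show "(\<lambda>z. cmod (f z * g z)) \<in> O[at_infinity](\<lambda>z. exp (cmod z powr \<rho>))"
    by (simp add: norm_mult)
qed (use assms in auto)

text \<open>The sector is parametrized by a strip through \<open>exp\<close>, since for a single ray its opening angle is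
  \<open>2\<pi>\<close> and no branch of the power function is continuous on its closure.\<close>

lemma phragmen_lindelof_sector:
  fixes G :: "complex \<Rightarrow> complex"
  assumes holo: "G holomorphic_on UNIV" and order: "growth_order G \<le> ereal s" and "0 < s"
    and t: "t1 < t2" "t2 - t1 < pi / s" and B: "0 < B"
    and ray1: "\<And>z. z \<in> ray t1 \<Longrightarrow> cmod (G z) \<le> B"
    and ray2: "\<And>z. z \<in> ray t2 \<Longrightarrow> cmod (G z) \<le> B"
    and disc: "\<And>z. cmod z \<le> 1 \<Longrightarrow> cmod (G z) \<le> B"
    and y: "t1 \<le> y" "y \<le> t2"
  shows "cmod (G (exp (Complex x y))) \<le> B"
proof (cases "x \<le> 0")
  case True
  then show ?thesis by (intro disc) auto
next
  case False
  have "s < pi / (t2 - t1)"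
    using t \<open>0 < s\<close> by (simp add: field_simps)
  then obtain s' where s': "s < s'" "s' < pi / (t2 - t1)" using dense by blast
  obtain \<rho> where \<rho>: "s < \<rho>" "\<rho> < s'" using s' dense by blast
  define m where "m = (t1 + t2) / 2"
  define c0 where "c0 = cos (s' * (t2 - t1) / 2)"
  have s'pi: "s' * (t2 - t1) < pi" using s' t by (simp add: field_simps)
  have "0 \<le> s' * (t2 - t1) / 2" using s' t \<open>0 < s\<close> by auto
  then have c0: "0 < c0" unfolding c0_def using s'pi by (intro cos_gt_zero_pi) auto
  have cos_ge: "c0 \<le> cos (s' * (v - m))" if "t1 \<le> v" "v \<le> t2" for v
  proof -
    have "\<bar>v - m\<bar> \<le> (t2 - t1) / 2" using that by (auto simp: m_def abs_if field_simps)
    then have "s' * \<bar>v - m\<bar> \<le> s' * ((t2 - t1) / 2)"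
      using s' \<open>0 < s\<close> by (intro mult_left_mono) auto
    then have "\<bar>s' * (v - m)\<bar> \<le> s' * (t2 - t1) / 2"
      using s' \<open>0 < s\<close> by (simp add: abs_mult)
    then have "cos (s' * (t2 - t1) / 2) \<le> cos \<bar>s' * (v - m)\<bar>"
      using s'pi by (intro cos_monotone_0_pi_le) auto
    then show ?thesis by (simp add: c0_def)
  qed
  obtain K where K: "0 < K"
      "eventually (\<lambda>z. cmod (G z) \<le> K * exp (cmod z powr \<rho>)) at_infinity"
    using growth_order_leD[OF order \<rho>(1)] by (elim landau_o.bigE) auto
  then obtain r0 where r0: "\<And>z. r0 \<le> cmod z \<Longrightarrow> cmod (G z) \<le> K * exp (cmod z powr \<rho>)"
    by (auto simp: eventually_at_infinity)
  have *: "cmod (G (exp (Complex x y))) * exp (- \<epsilon> * exp (s' * x) * cos (s' * (y - m))) \<le> B"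
    if \<epsilon>: "0 < \<epsilon>" for \<epsilon>
  proof -
    \<comment> \<open>In terms of \<open>z = exp w\<close> the damping factor is
      \<open>exp (- \<epsilon> z^s')\<close>, with the power rotated so as to be real on the
      bisector \<open>m\<close> of the sector.\<close>
    define h where "h w = G (exp w) * exp (- of_real \<epsilon> * exp (of_real s' * (w - \<i> * of_real m)))" for w
    have normh: "cmod (h (Complex u v)) =
        cmod (G (exp (Complex u v))) * exp (- \<epsilon> * exp (s' * u) * cos (s' * (v - m)))" for u v
      by (simp add: h_def norm_mult Re_exp)
    have h_le: "cmod (h (Complex u v)) \<le> cmod (G (exp (Complex u v))) * exp (- \<epsilon> * c0 * exp (s' * u))"
      if "t1 \<le> v" "v \<le> t2" for u v
      unfolding normh using cos_ge[OF that] \<epsilon> by (intro mult_left_mono) (auto simp: mult_ac)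
    have h_le': "cmod (h (Complex u v)) \<le> cmod (G (exp (Complex u v)))"
      if "t1 \<le> v" "v \<le> t2" for u v
    proof -
      have "exp (- \<epsilon> * c0 * exp (s' * u)) \<le> 1" using \<epsilon> c0 by auto
      then show ?thesis using h_le[OF that, of u]
        by (smt (verit, best) mult_left_le norm_ge_zero)
    qed
    have "eventually (\<lambda>X. K * exp (exp (\<rho> * X)) * exp (- \<epsilon> * c0 * exp (s' * X)) \<le> B) at_top"
    proof -
      have "((\<lambda>X. exp (exp (r * X) * (1 - e * exp (b * X)))) \<longlongrightarrow> 0) at_top"
        if "0 < r" "0 < e" "0 < b" for r e b :: real
      proof -
        have "filterlim (\<lambda>X. e * exp (b * X) - 1) at_top at_top" "filterlim (\<lambda>X. exp (r * X)) at_top at_top"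
          using that by real_asymp+
        then have "filterlim (\<lambda>X. exp (r * X) * (e * exp (b * X) - 1)) at_top at_top"
          by (intro filterlim_at_top_mult_at_top)
        then have "filterlim (\<lambda>X. exp (r * X) * (1 - e * exp (b * X))) at_bot at_top"
          by (simp add: filterlim_uminus_at_bot algebra_simps)
        then show ?thesis by (rule filterlim_compose[OF exp_at_bot])
      qed
      from tendsto_mult_right_zero[OF this[of \<rho> "\<epsilon> * c0" "s' - \<rho>"], of K]
      have "((\<lambda>X. K * exp (exp (\<rho> * X) * (1 - (\<epsilon> * c0) * exp ((s' - \<rho>) * X)))) \<longlongrightarrow> 0) at_top"
        using \<rho> \<open>0 < s\<close> \<epsilon> c0 by simp
      then have "eventually (\<lambda>X. K * exp (exp (\<rho> * X) * (1 - (\<epsilon> * c0) * exp ((s' - \<rho>) * X))) < B) at_top"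
        using B by (simp add: order_tendsto_iff)
      then show ?thesis
      proof eventually_elim
        case (elim X)
        have "exp (\<rho> * X) * exp ((s' - \<rho>) * X) = exp (s' * X)"
          by (simp add: exp_add[symmetric] algebra_simps)
        then have "exp (\<rho> * X) * (1 - (\<epsilon> * c0) * exp ((s' - \<rho>) * X)) = exp (\<rho> * X) + - \<epsilon> * c0 * exp (s' * X)"
          by (simp add: right_diff_distrib mult.assoc mult.left_commute)
        then have "K * exp (exp (\<rho> * X) * (1 - (\<epsilon> * c0) * exp ((s' - \<rho>) * X))) =
            K * exp (exp (\<rho> * X)) * exp (- \<epsilon> * c0 * exp (s' * X))"
          by (simp only: exp_add mult.assoc)
        then show ?case using elim by linarith
      qed
    qed
    moreover have "eventually (\<lambda>X. r0 \<le> exp X) at_top"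
      using exp_at_top by (simp add: filterlim_at_top)
    ultimately have "eventually (\<lambda>X. x < X \<and> r0 \<le> exp X \<and>
        K * exp (exp (\<rho> * X)) * exp (- \<epsilon> * c0 * exp (s' * X)) \<le> B) at_top"
      using eventually_gt_at_top[of x] by eventually_elim auto
    then obtain X where X: "x < X" "r0 \<le> exp X"
        "K * exp (exp (\<rho> * X)) * exp (- \<epsilon> * c0 * exp (s' * X)) \<le> B"
      by (auto simp: eventually_at_top_linorder)
    \<comment> \<open>In this rectangle the left side maps into the unit circle and the horizontal
      sides into the two rays; on the right side \<open>X\<close> is large enough for the damping to
      beat the growth.\<close>
    define S where "S = cbox (Complex 0 t1) (Complex X t2)"
    have holh: "h holomorphic_on A" for A
      unfolding h_def
      by (intro holomorphic_intros holomorphic_on_compose_gen[OF _ holo, unfolded o_def]) auto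
    have "cmod (h (Complex x y)) \<le> B"
    proof (rule maximum_modulus_frontier[of h S])
      show "continuous_on (closure S) h"
        by (intro holomorphic_on_imp_continuous_on holh)
      show "bounded S" by (simp add: S_def)
      show "Complex x y \<in> S"
        using False X y by (simp add: S_def in_cbox_complex_iff)
      show "cmod (h w) \<le> B" if "w \<in> frontier S" for w
      proof -
        obtain u v where w: "w = Complex u v" by (cases w)
        have uv: "0 \<le> u" "u \<le> X" "t1 \<le> v" "v \<le> t2" "u = 0 \<or> u = X \<or> v = t1 \<or> v = t2"
          using that unfolding frontier_def S_def w
          by (auto simp: in_cbox_complex_iff in_box_complex_iff)
        consider "u = 0" | "u = X" | "v = t1" | "v = t2" using uv by blast
        then show ?thesis
        proof cases
          case 1
          then have "cmod (G (exp (Complex u v))) \<le> B" by (intro disc) auto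
          then show ?thesis using h_le'[OF uv(3,4), of u] w by simp
        next
          case 2
          have "cmod (G (exp (Complex u v))) \<le> K * exp (exp (\<rho> * X))"
            using r0[of "exp (Complex u v)"] X 2 by (simp add: powr_def)
          then have "cmod (G (exp (Complex u v))) * exp (- \<epsilon> * c0 * exp (s' * u)) \<le>
              K * exp (exp (\<rho> * X)) * exp (- \<epsilon> * c0 * exp (s' * X))"
            unfolding 2 by (intro mult_right_mono) auto
          then show ?thesis using h_le[OF uv(3,4), of u] w X by simp
        next
          case 3
          have "exp (Complex u v) \<in> ray t1"
            unfolding ray_def 3 by (auto simp: exp_eq_polar intro!: exI[of _ "exp u"])
          then show ?thesis using h_le'[OF uv(3,4), of u] w ray1 by fastforce
        next
          case 4
          have "exp (Complex u v) \<in> ray t2"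
            unfolding ray_def 4 by (auto simp: exp_eq_polar intro!: exI[of _ "exp u"])
          then show ?thesis using h_le'[OF uv(3,4), of u] w ray2 by fastforce
        qed
      qed
    qed (use holh in auto)
    then show ?thesis by (simp add: normh)
  qed
  \<comment> \<open>At the fixed point the damping is removed by letting \<open>\<epsilon>\<close>
    tend to 0.\<close>
  have "((\<lambda>\<epsilon>. cmod (G (exp (Complex x y))) * exp (- \<epsilon> * exp (s' * x) * cos (s' * (y - m)))) \<longlongrightarrow>
      cmod (G (exp (Complex x y))) * exp (- 0 * exp (s' * x) * cos (s' * (y - m)))) (at_right 0)"
    by (intro tendsto_intros)
  moreover have "eventually (\<lambda>\<epsilon>. cmod (G (exp (Complex x y))) *
      exp (- \<epsilon> * exp (s' * x) * cos (s' * (y - m))) \<le> B) (at_right 0)"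
    using * by (auto simp: eventually_at_right_field intro!: exI[of _ 1])
  ultimately have "cmod (G (exp (Complex x y))) * exp (- 0 * exp (s' * x) * cos (s' * (y - m))) \<le> B"
    by (intro tendsto_upperbound) auto
  then show ?thesis by simp
qed

section \<open>Dissections of the plane by rays\<close>

text \<open>The argument is shifted by a multiple of \<open>2 * pi\<close> into the window that
  starts at \<open>t 0\<close>; the least \<open>k\<close> with \<open>y \<le> t (Suc k)\<close>
  then picks the sector.\<close>

lemma dissecting_rays_cover:
  fixes t :: "nat \<Rightarrow> real" and z :: complex
  assumes "t n = t 0 + 2 * pi" and "\<And>k. k < n \<Longrightarrow> t k < t (Suc k)" and "z \<noteq> 0"
  obtains k y where "k < n" "t k \<le> y" "y \<le> t (Suc k)" "z = exp (Complex (ln (cmod z)) y)"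
proof -
  obtain j :: int where j: "t 0 \<le> Arg z + of_int j * (2 * pi)" "Arg z + of_int j * (2 * pi) < t 0 + 2 * pi"
  proof -
    define j where "j = \<lceil>(t 0 - Arg z) / (2 * pi)\<rceil>"
    have "(t 0 - Arg z) / (2 * pi) \<le> of_int j" "of_int j < (t 0 - Arg z) / (2 * pi) + 1"
      unfolding j_def by linarith+
    then have "t 0 \<le> Arg z + of_int j * (2 * pi)" "Arg z + of_int j * (2 * pi) < t 0 + 2 * pi"
      by (auto simp: field_simps)
    then show ?thesis using that by blast
  qed
  define y where "y = Arg z + of_int j * (2 * pi)"
  have "exp (Complex (ln (cmod z)) y) = of_real (cmod z) * cis (Arg z + 2 * pi * of_int j)"
    using assms(3) by (simp add: exp_eq_polar y_def mult_ac)
  also have "\<dots> = z"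
  proof -
    have "cis (2 * pi * of_int j) = 1" by (intro cis_multiple_2pi) auto
    moreover have "of_real (cmod z) * cis (Arg z) = z"
      using Arg_eq[OF assms(3)] by (simp add: cis_conv_exp)
    ultimately show ?thesis by (simp add: cis_mult[symmetric])
  qed
  finally have z: "z = exp (Complex (ln (cmod z)) y)" by simp
  define k where "k = (LEAST k. y \<le> t (Suc k))"
  have n: "n \<noteq> 0" using assms(1) by (metis add_cancel_right_right mult_eq_0_iff pi_neq_zero zero_neq_numeral)
  have ex: "y \<le> t (Suc (n - 1))" using j assms(1) n by (simp add: y_def)
  have k1: "y \<le> t (Suc k)" unfolding k_def by (rule LeastI[of _ "n - 1"]) (rule ex)
  have k2: "k < n" using Least_le[of "\<lambda>k. y \<le> t (Suc k)" "n - 1", OF ex] n by (simp add: k_def)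
  have k3: "t k \<le> y"
  proof (cases k)
    case 0
    then show ?thesis using j by (simp add: y_def)
  next
    case (Suc k')
    then have "\<not> y \<le> t (Suc k')" using not_less_Least[of k' "\<lambda>k. y \<le> t (Suc k)"] by (simp add: k_def)
    then show ?thesis using Suc by simp
  qed
  show thesis by (rule that[OF k2 k3 k1 z])
qed

lemma at_infinity_along_nontrivial:
  assumes "dissecting_rays \<omega> R"
  shows "at_infinity_along R \<noteq> bot"
proof
  obtain n :: nat and t :: "nat \<Rightarrow> real" where nt: "t n = t 0 + 2 * pi" "R = (\<Union>k<n. ray (t k))"
    using assms unfolding dissecting_rays_def by blast
  have "n \<noteq> 0" using nt(1) by (metis add_cancel_right_right mult_eq_0_iff pi_neq_zero zero_neq_numeral)
  then have "0 \<in> {..<n}" by simp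
  then have ray: "ray (t 0) \<subseteq> R" unfolding nt(2) by (rule UN_upper)
  assume "at_infinity_along R = bot"
  then have "eventually (\<lambda>z. z \<notin> R) at_infinity"
    by (simp add: at_infinity_along_def trivial_limit_def eventually_inf_principal)
  then obtain b where b: "\<And>z. b \<le> cmod z \<Longrightarrow> z \<notin> R" by (auto simp: eventually_at_infinity)
  have "of_real (\<bar>b\<bar> + 1) * cis (t 0) \<in> ray (t 0)"
    unfolding ray_def by (intro CollectI exI[of _ "\<bar>b\<bar> + 1"]) auto
  moreover have "b \<le> cmod (of_real (\<bar>b\<bar> + 1) * cis (t 0))" by (simp add: norm_mult)
  ultimately show False using b ray by blast
qed

text \<open>A bound on the rays and the unit disc spreads to each closed sector by
  Phragmen-Lindelof; the sectors cover the plane, and Liouville applies. Since the filter along the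
  rays is nontrivial, the limit identifies the constant.\<close>

lemma entire_tendsto_along_rays_imp_const:
  fixes G :: "complex \<Rightarrow> complex"
  assumes holo: "G holomorphic_on UNIV" and order: "growth_order G \<le> ereal s" and "0 < s"
    and R: "dissecting_rays (pi / s) R" and lim: "(G \<longlongrightarrow> l) (at_infinity_along R)"
  shows "G z = l"
proof -
  obtain n t where nt: "t n = t 0 + 2 * pi"
      "\<And>k. k < n \<Longrightarrow> t k < t (Suc k)" "\<And>k. k < n \<Longrightarrow> t (Suc k) - t k < pi / s" "R = (\<Union>k<n. ray (t k))"
    using R unfolding dissecting_rays_def by blast
  have "eventually (\<lambda>z. dist (G z) l < 1) (at_infinity_along R)"
    using lim by (rule tendstoD) simp
  then obtain b where b: "\<And>z. b \<le> cmod z \<Longrightarrow> z \<in> R \<Longrightarrow> dist (G z) l < 1"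
    by (auto simp: at_infinity_along_def eventually_inf_principal eventually_at_infinity)
  have "bounded (G ` cball 0 (max b 1))"
    by (intro compact_imp_bounded compact_continuous_image holomorphic_on_imp_continuous_on
        holomorphic_on_subset[OF holo]) auto
  then obtain C where "\<forall>x\<in>cball 0 (max b 1). cmod (G x) \<le> C"
    by (auto simp: bounded_iff)
  then have C: "\<And>z. cmod z \<le> max b 1 \<Longrightarrow> cmod (G z) \<le> C" by auto
  \<comment> \<open>\<open>C\<close> covers the unit disc and the initial parts of the rays,
    \<open>cmod l + 1\<close> the far parts, where \<open>G\<close> is within distance 1 of
    \<open>l\<close>.\<close>
  define B where "B = max C (cmod l + 1)"
  have B: "0 < B" unfolding B_def by (smt (verit) norm_ge_zero)
  have BR: "cmod (G z) \<le> B" if "z \<in> R" for z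
  proof (cases "b \<le> cmod z")
    case True
    then have "cmod (G z) \<le> cmod l + 1"
      using b[OF True that] norm_triangle_sub[of "G z" l] by (simp add: dist_norm)
    then show ?thesis by (simp add: B_def)
  next
    case False
    then have "cmod (G z) \<le> C" by (intro C) auto
    then show ?thesis by (simp add: B_def)
  qed
  have BD: "cmod (G z) \<le> B" if "cmod z \<le> 1" for z
  proof -
    have "cmod (G z) \<le> C" using that by (intro C) auto
    then show ?thesis by (simp add: B_def)
  qed
  \<comment> \<open>\<open>k = n\<close> is included: the last sector is closed by
    \<open>ray (t n) = ray (t 0)\<close>.\<close>
  have rays: "ray (t k) \<subseteq> R" if "k \<le> n" for k
  proof (cases "k = n")
    case True
    have "n \<noteq> 0" using nt(1) by (metis add_cancel_right_right mult_eq_0_iff pi_neq_zero zero_neq_numeral)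
    moreover have "ray (t n) = ray (t 0)" unfolding ray_def nt(1) by (simp add: cis_mult[symmetric])
    ultimately show ?thesis using True nt(4) by auto
  next
    case False
    then show ?thesis using that nt(4) by auto
  qed
  have bdd: "cmod (G z) \<le> B" for z
  proof (cases "z = 0")
    case True
    then show ?thesis using BD[of z] by simp
  next
    case False
    obtain k y where k: "k < n" "t k \<le> y" "y \<le> t (Suc k)" "z = exp (Complex (ln (cmod z)) y)"
      using dissecting_rays_cover[of t n z] nt False by metis
    have "cmod (G (exp (Complex (ln (cmod z)) y))) \<le> B"
      using k rays[of k] rays[of "Suc k"] BR BD
      by (intro phragmen_lindelof_sector[OF holo order \<open>0 < s\<close> nt(2,3) B]) auto
    then show ?thesis using k(4) by simp
  qed
  then have "bounded (range G)" by (auto simp: bounded_iff)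
  then have "G constant_on UNIV" using Liouville_theorem[OF holo] by blast
  then obtain c where c: "\<And>z. G z = c" by (auto simp: constant_on_def)
  then have "G = (\<lambda>z. c)" by auto
  then have "((\<lambda>z. c) \<longlongrightarrow> l) (at_infinity_along R)" using lim by simp
  then have "c = l" using at_infinity_along_nontrivial[OF R] by (simp add: tendsto_const_iff)
  then show ?thesis using c by simp
qed

section \<open>Comparison of two systems\<close>

lemma at_infinity_along_mono: "A \<subseteq> B \<Longrightarrow> at_infinity_along A \<le> at_infinity_along B"
  unfolding at_infinity_along_def by (intro inf_mono) auto

text \<open>A ray at angle \<open>t k\<close> lies in the sector once
  \<open>\<delta> \<le> |sin (t k)|\<close>, because \<open>|cos (t k)| \<le> 1\<close>; finitely
  many nonreal rays leave a positive minimum.\<close>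

lemma dissecting_rays_sector:
  assumes "dissecting_rays \<omega> R"
  obtains \<delta> where "0 < \<delta>" "R \<subseteq> sector \<delta>"
proof -
  obtain n :: nat and t :: "nat \<Rightarrow> real" where t: "t n = t 0 + 2 * pi"
      "\<And>k. k < n \<Longrightarrow> \<not> ray (t k) \<subseteq> \<real>" "R = (\<Union>k<n. ray (t k))"
    using assms unfolding dissecting_rays_def by blast
  have n0: "n \<noteq> 0" using t(1) by (metis add_cancel_right_right mult_eq_0_iff pi_neq_zero zero_neq_numeral)
  have sin0: "sin (t k) \<noteq> 0" if "k < n" for k
  proof
    assume "sin (t k) = 0"
    then have "ray (t k) \<subseteq> \<real>" by (auto simp: ray_def complex_is_Real_iff)
    then show False using t(2)[OF that] by blast
  qed
  define \<delta> where "\<delta> = Min ((\<lambda>k. \<bar>sin (t k)\<bar>) ` {..<n})"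
  show thesis
  proof (rule that[of \<delta>])
    show "0 < \<delta>" using n0 sin0 by (subst \<delta>_def, subst Min_gr_iff) auto
    show "R \<subseteq> sector \<delta>"
    proof
      fix z assume "z \<in> R"
      then obtain k r where k: "k < n" "0 < r" "z = of_real r * cis (t k)"
        using t(3) by (auto simp: ray_def)
      have "\<delta> \<le> \<bar>sin (t k)\<bar>" unfolding \<delta>_def using k by (intro Min_le) auto
      moreover have "\<bar>cos (t k)\<bar> \<le> 1" by simp
      moreover have "0 < \<delta>" by fact
      ultimately have "\<delta> * \<bar>cos (t k)\<bar> \<le> \<bar>sin (t k)\<bar>"
        using mult_left_mono[of "\<bar>cos (t k)\<bar>" 1 \<delta>] by linarith
      then have "r * (\<delta> * \<bar>cos (t k)\<bar>) \<le> r * \<bar>sin (t k)\<bar>"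
        using k(2) by (intro mult_left_mono) auto
      then show "z \<in> sector \<delta>" using k by (simp add: sector_def abs_mult mult_ac)
    qed
  qed
qed

lemma AE_lebesgue_on_subset:
  assumes "AE x in lebesgue_on T. P x" "S \<subseteq> T" "S \<in> sets lebesgue" "T \<in> sets lebesgue"
  shows "AE x in lebesgue_on S. P x"
  using assms by (auto simp: AE_lebesgue_on_negligible_iff)

text \<open>The sign lemmas concern nonreal \<open>z\<close>, whereas (i) speaks of every
  \<open>z\<close>. Real points are approached vertically and reached by continuity.\<close>

lemma holomorphic_eq_0_if_nonreal:
  fixes h :: "complex \<Rightarrow> complex"
  assumes "h holomorphic_on UNIV" "\<And>z. Im z \<noteq> 0 \<Longrightarrow> h z = 0"
  shows "h z = 0"
proof (cases "Im z = 0")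
  case True
  have "isCont h z"
    using holomorphic_on_imp_continuous_on[OF assms(1)] by (simp add: continuous_on_eq_continuous_at)
  moreover have "(\<lambda>n. z + \<i> * of_real (inverse (real (Suc n)))) \<longlonglongrightarrow> z + \<i> * of_real 0"
    by (intro tendsto_intros LIMSEQ_inverse_real_of_nat)
  ultimately have "(\<lambda>n. h (z + \<i> * of_real (inverse (real (Suc n))))) \<longlonglongrightarrow> h z"
    using isCont_tendsto_compose[of z h] by simp
  moreover have "h (z + \<i> * of_real (inverse (real (Suc n)))) = 0" for n
    using True by (intro assms(2)) simp
  ultimately have "(\<lambda>n. 0) \<longlonglongrightarrow> h z" by simp
  then show ?thesis by (simp add: LIMSEQ_const_iff)
qed (use assms in auto)

locale weyl_pair =
  W0: weyl_system a b0 q0 \<alpha>0 \<beta>0 \<theta>0 \<phi>0 M0 + W1: weyl_system a b1 q1 \<alpha>1 \<beta>1 \<theta>1 \<phi>1 M1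
  for a b0 b1 :: ereal and q0 q1 \<alpha>0 \<alpha>1 \<beta>0 \<beta>1 \<theta>0 \<theta>1 \<phi>0 \<phi>1 M0 M1 +
  fixes s :: real and R :: "complex set"
  assumes s: "0 < s"
    and \<theta>_order: "solution_order_le (einterval a b0) \<theta>0 s" "solution_order_le (einterval a b1) \<theta>1 s"
    and \<phi>_order: "solution_order_le (einterval a b0) \<phi>0 s" "solution_order_le (einterval a b1) \<phi>1 s"
    and R: "dissecting_rays (pi / s) R"
    and \<phi>_asymp: "\<exists>x \<in> einterval a b0 \<inter> einterval a b1.
      (\<lambda>z. \<phi>1 z x) \<sim>[at_infinity_along R] (\<lambda>z. \<phi>0 z x)"
begin

lemma order:
  assumes "x \<in> einterval a b0 \<inter> einterval a b1"
  shows "growth_order (\<lambda>z. \<theta>0 z x) \<le> ereal s" "growth_order (\<lambda>z. dx (\<theta>0 z) x) \<le> ereal s"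
    "growth_order (\<lambda>z. \<theta>1 z x) \<le> ereal s" "growth_order (\<lambda>z. dx (\<theta>1 z) x) \<le> ereal s"
    "growth_order (\<lambda>z. \<phi>0 z x) \<le> ereal s" "growth_order (\<lambda>z. dx (\<phi>0 z) x) \<le> ereal s"
    "growth_order (\<lambda>z. \<phi>1 z x) \<le> ereal s" "growth_order (\<lambda>z. dx (\<phi>1 z) x) \<le> ereal s"
  using \<theta>_order \<phi>_order assms by (auto simp: solution_order_le_def)

lemma rays_in_sector:
  obtains \<delta> where "0 < \<delta>" "at_infinity_along R \<le> at_infinity_along (sector \<delta>)"
  using dissecting_rays_sector[OF R] at_infinity_along_mono by metis

lemma eventually_nonreal: "eventually (\<lambda>z. Im z \<noteq> 0) (at_infinity_along R)"
proof -
  obtain \<delta> where \<delta>: "0 < \<delta>" "at_infinity_along R \<le> at_infinity_along (sector \<delta>)" by (rule rays_in_sector)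
  have "eventually (\<lambda>z. Im z \<noteq> 0) (at_infinity_along (sector \<delta>))"
    by (rule eventually_mono[OF eventually_sector[OF \<delta>(1)]]) simp
  then show ?thesis by (rule filter_leD[OF \<delta>(2)])
qed

text \<open>Between two points both \<open>\<phi>0\<close> and \<open>\<phi>1\<close> grow by the
  same exponential \<open>exp (k (y - x))\<close> to leading order, whatever the potentials. So the
  asymptotic hypothesis at one point carries over to every common point.\<close>

lemma phi_ratio_tendsto_1:
  assumes d: "d \<in> einterval a b0 \<inter> einterval a b1"
  shows "((\<lambda>z. \<phi>1 z d / \<phi>0 z d) \<longlongrightarrow> 1) (at_infinity_along R)"
proof -
  obtain x where x: "x \<in> einterval a b0 \<inter> einterval a b1"
      and as: "(\<lambda>z. \<phi>1 z x) \<sim>[at_infinity_along R] (\<lambda>z. \<phi>0 z x)"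
    using \<phi>_asymp by blast
  have limx: "((\<lambda>z. \<phi>1 z x / \<phi>0 z x) \<longlongrightarrow> 1) (at_infinity_along R)"
    using as unfolding asymp_equiv_def
  proof (rule Lim_transform_eventually)
    \<comment> \<open>The convention for a double zero in the definition of asymptotic equivalence
      is void for nonreal \<open>z\<close>, where \<open>\<phi>0\<close> has no zeros.\<close>
    show "eventually (\<lambda>z. (if \<phi>1 z x = 0 \<and> \<phi>0 z x = 0 then 1 else \<phi>1 z x / \<phi>0 z x) = \<phi>1 z x / \<phi>0 z x) (at_infinity_along R)"
      using eventually_nonreal by eventually_elim (use W0.phi_sign(1) x in auto)
  qed
  obtain \<delta> where \<delta>: "0 < \<delta>" "at_infinity_along R \<le> at_infinity_along (sector \<delta>)" by (rule rays_in_sector)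
  let ?e = "\<lambda>x y z. exp (- (freq z * of_real (y - x)))"
  have ratio: "((\<lambda>z. \<phi>0 z y / \<phi>0 z x * ?e x y z) \<longlongrightarrow> 1) (at_infinity_along R)"
    "((\<lambda>z. \<phi>1 z y / \<phi>1 z x * ?e x y z) \<longlongrightarrow> 1) (at_infinity_along R)"
    if "x < y" "x \<in> einterval a b0 \<inter> einterval a b1" "y \<in> einterval a b0 \<inter> einterval a b1" for x y
    using that W0.ratio_asymptotics[OF \<delta>(1)] W1.ratio_asymptotics[OF \<delta>(1)]
    by (auto intro: tendsto_mono[OF \<delta>(2)])
  show ?thesis
  proof (cases d x rule: linorder_cases)
    case equal
    then show ?thesis using limx by simp
  next
    case less
    note r = ratio[OF less d x]
    have "((\<lambda>z. \<phi>1 z x / \<phi>0 z x * ((\<phi>0 z x / \<phi>0 z d * ?e d x z) / (\<phi>1 z x / \<phi>1 z d * ?e d x z))) \<longlongrightarrow> 1 * (1 / 1))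
        (at_infinity_along R)"
      by (intro tendsto_mult tendsto_divide limx r) simp
    then have "((\<lambda>z. \<phi>1 z x / \<phi>0 z x * ((\<phi>0 z x / \<phi>0 z d * ?e d x z) / (\<phi>1 z x / \<phi>1 z d * ?e d x z))) \<longlongrightarrow> 1)
        (at_infinity_along R)" by simp
    then show ?thesis
    proof (rule Lim_transform_eventually)
      show "eventually (\<lambda>z. \<phi>1 z x / \<phi>0 z x * ((\<phi>0 z x / \<phi>0 z d * ?e d x z) / (\<phi>1 z x / \<phi>1 z d * ?e d x z)) = \<phi>1 z d / \<phi>0 z d)
          (at_infinity_along R)"
        using eventually_nonreal
      proof eventually_elim
        case (elim z)
        then have "\<phi>0 z x \<noteq> 0" "\<phi>0 z d \<noteq> 0" "\<phi>1 z x \<noteq> 0" "\<phi>1 z d \<noteq> 0"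
          using W0.phi_sign(1) W1.phi_sign(1) x d by auto
        then show ?case by simp
      qed
    qed
  next
    case greater
    note r = ratio[OF greater x d]
    have "((\<lambda>z. \<phi>1 z x / \<phi>0 z x * ((\<phi>1 z d / \<phi>1 z x * ?e x d z) / (\<phi>0 z d / \<phi>0 z x * ?e x d z))) \<longlongrightarrow> 1 * (1 / 1))
        (at_infinity_along R)"
      by (intro tendsto_mult tendsto_divide limx r) simp
    then have "((\<lambda>z. \<phi>1 z x / \<phi>0 z x * ((\<phi>1 z d / \<phi>1 z x * ?e x d z) / (\<phi>0 z d / \<phi>0 z x * ?e x d z))) \<longlongrightarrow> 1)
        (at_infinity_along R)" by simp
    then show ?thesis
    proof (rule Lim_transform_eventually)
      show "eventually (\<lambda>z. \<phi>1 z x / \<phi>0 z x * ((\<phi>1 z d / \<phi>1 z x * ?e x d z) / (\<phi>0 z d / \<phi>0 z x * ?e x d z)) = \<phi>1 z d / \<phi>0 z d)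
          (at_infinity_along R)"
        using eventually_nonreal
      proof eventually_elim
        case (elim z)
        then have "\<phi>0 z x \<noteq> 0" "\<phi>0 z d \<noteq> 0" "\<phi>1 z x \<noteq> 0" "\<phi>1 z d \<noteq> 0"
          using W0.phi_sign(1) W1.phi_sign(1) x d by auto
        then show ?case by simp
      qed
    qed
  qed
qed

section \<open>From equal potentials to the Weyl functions\<close>

text \<open>When \<open>\<phi>1\<close> is expanded in \<open>\<theta>0\<close> and
  \<open>\<phi>0\<close>, only the multiple \<open>E\<close> of \<open>\<phi>0\<close> is left, for
  the value and for the derivative alike. So \<open>E = 1\<close> yields equality of the full Cauchy
  data at \<open>c\<close>, which the comparison of \<open>\<theta>0\<close> with
  \<open>\<theta>1\<close> needs.\<close>

lemma phi_eq_if_wronskian_0: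
  assumes c: "c \<in> einterval a b0 \<inter> einterval a b1" and W: "\<And>z. wronskian (\<phi>0 z) (\<phi>1 z) c = 0"
  shows "\<phi>1 z c = \<phi>0 z c" "dx (\<phi>1 z) c = dx (\<phi>0 z) c"
proof -
  define E where "E = (\<lambda>z. \<theta>0 z c * dx (\<phi>1 z) c - dx (\<theta>0 z) c * \<phi>1 z c)"
  have c0: "c \<in> einterval a b0" and c1: "c \<in> einterval a b1" using c by auto
  have W': "\<phi>0 z c * dx (\<phi>1 z) c = dx (\<phi>0 z) c * \<phi>1 z c" for z
    using W[of z] by (simp add: wronskian_def)
  have E1: "E z * \<phi>0 z c = \<phi>1 z c" for z
  proof -
    have "E z * \<phi>0 z c = \<theta>0 z c * (\<phi>0 z c * dx (\<phi>1 z) c) - dx (\<theta>0 z) c * \<phi>0 z c * \<phi>1 z c"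
      by (simp add: E_def algebra_simps)
    also have "\<dots> = (\<theta>0 z c * dx (\<phi>0 z) c - dx (\<theta>0 z) c * \<phi>0 z c) * \<phi>1 z c"
      unfolding W' by (simp add: algebra_simps)
    finally show ?thesis using W0.wronskian_1[OF c0, of z] by simp
  qed
  have E2: "E z * dx (\<phi>0 z) c = dx (\<phi>1 z) c" for z
  proof -
    have "E z * dx (\<phi>0 z) c = \<theta>0 z c * dx (\<phi>0 z) c * dx (\<phi>1 z) c - dx (\<theta>0 z) c * (dx (\<phi>0 z) c * \<phi>1 z c)"
      by (simp add: E_def algebra_simps)
    also have "\<dots> = (\<theta>0 z c * dx (\<phi>0 z) c - dx (\<theta>0 z) c * \<phi>0 z c) * dx (\<phi>1 z) c"
      unfolding W'[symmetric] by (simp add: algebra_simps)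
    finally show ?thesis using W0.wronskian_1[OF c0, of z] by simp
  qed
  have "E holomorphic_on UNIV"
    unfolding E_def by (intro holomorphic_intros W0.holo[OF c0] W1.holo[OF c1])
  moreover have "growth_order E \<le> ereal s"
    unfolding E_def using s by (intro growth_order_diff_le growth_order_mult_le order[OF c]) auto
  moreover have "(E \<longlongrightarrow> 1) (at_infinity_along R)"
    using phi_ratio_tendsto_1[OF c]
  proof (rule Lim_transform_eventually)
    show "eventually (\<lambda>z. \<phi>1 z c / \<phi>0 z c = E z) (at_infinity_along R)"
      using eventually_nonreal
      by eventually_elim (use W0.phi_sign(1)[OF c0] E1 in \<open>simp add: divide_eq_eq\<close>)
  qed
  ultimately have "E z = 1"
    using s R by (intro entire_tendsto_along_rays_imp_const) auto
  then show "\<phi>1 z c = \<phi>0 z c" "dx (\<phi>1 z) c = dx (\<phi>0 z) c"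
    using E1[of z] E2[of z] by auto
qed

lemma potentials_eq_imp_weyl_asymp:
  assumes c: "c \<in> einterval a b0 \<inter> einterval a b1"
    and q: "AE x in lebesgue_on (einterval a (ereal c)). q0 x = q1 x"
    and W: "\<And>z. (wronskian (\<phi>0 z) (\<phi>1 z) \<longlongrightarrow> 0) (to_left_end a)"
    and \<delta>: "0 < \<delta>"
  shows "\<exists>f. f holomorphic_on UNIV \<and> growth_order f \<le> ereal s \<and>
    (\<lambda>z. M1 z - M0 z - f z) \<in> O[at_infinity_along (sector \<delta>)](\<lambda>z. 1 / (freq z * (\<phi>0 z c)\<^sup>2))"
proof -
  have c0: "c \<in> einterval a b0" and c1: "c \<in> einterval a b1" using c by auto
  have ac: "a < ereal c" using c0 by (simp add: einterval_def)
  \<comment> \<open>The Wronskian has the same value at \<open>c\<close> as at all points left of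
    it, so its limit at \<open>a\<close> is this value.\<close>
  have Wc: "wronskian (\<phi>0 z) (\<phi>1 z) c = 0" for z
  proof -
    have "wronskian (\<phi>0 z) (\<phi>1 z) x = wronskian (\<phi>0 z) (\<phi>1 z) c" if x: "x \<in> einterval a (ereal c)" for x
    proof (rule wronskian_eq[OF W0.sol(2) W1.sol(2) _ c _ q einterval_lebesgue])
      show "x \<in> einterval a b0 \<inter> einterval a b1"
        using x einterval_subset(1)[OF c0] einterval_subset(1)[OF c1] by blast
      show "x \<le> c" using x by (auto simp: einterval_def)
      show "{x<..<c} \<subseteq> einterval a (ereal c)"
        using x less_trans[of a "ereal x"] by (auto simp: einterval_def)
    qed
    then have "eventually (\<lambda>x. wronskian (\<phi>0 z) (\<phi>1 z) x = wronskian (\<phi>0 z) (\<phi>1 z) c) (to_left_end a)"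
      by (rule eventually_mono[OF eventually_to_left_end[OF ac]])
    then have "((\<lambda>x. wronskian (\<phi>0 z) (\<phi>1 z) c) \<longlongrightarrow> 0) (to_left_end a)"
      by (rule Lim_transform_eventually[OF W])
    then show ?thesis
      using to_left_end_nontrivial[OF ac] by (simp add: tendsto_const_iff)
  qed
  note eq = phi_eq_if_wronskian_0[OF c Wc]
  \<comment> \<open>\<open>\<theta>0 - \<theta>1\<close> has zero Wronskian with
    \<open>\<phi>0\<close> at \<open>c\<close>, hence is a multiple of \<open>\<phi>0\<close> there;
    \<open>\<kappa>\<close> is the factor.\<close>
  define \<kappa> where "\<kappa> = (\<lambda>z. dx (\<theta>0 z) c * \<theta>1 z c - \<theta>0 z c * dx (\<theta>1 z) c)"
  have \<kappa>: "\<kappa> z * \<phi>0 z c = \<theta>0 z c - \<theta>1 z c" for z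
  proof -
    have "\<kappa> z * \<phi>0 z c = \<theta>0 z c * (\<theta>1 z c * dx (\<phi>1 z) c - dx (\<theta>1 z) c * \<phi>1 z c)
        - \<theta>1 z c * (\<theta>0 z c * dx (\<phi>0 z) c - dx (\<theta>0 z) c * \<phi>0 z c)"
      by (simp add: \<kappa>_def eq algebra_simps)
    then show ?thesis unfolding W0.wronskian_1[OF c0] W1.wronskian_1[OF c1] by simp
  qed
  have "\<kappa> holomorphic_on UNIV"
    unfolding \<kappa>_def by (intro holomorphic_intros W0.holo[OF c0] W1.holo[OF c1])
  moreover have "growth_order \<kappa> \<le> ereal s"
    unfolding \<kappa>_def using s by (intro growth_order_diff_le growth_order_mult_le order[OF c]) auto
  moreover have "(\<lambda>z. M1 z - M0 z - \<kappa> z) \<in> O[at_infinity_along (sector \<delta>)](\<lambda>z. 1 / (freq z * (\<phi>0 z c)\<^sup>2))"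
  proof -
    let ?F = "at_infinity_along (sector \<delta>)"
    \<comment> \<open>The difference of the two Green diagonals equals
      \<open>\<phi>0^2 (M1 - M0 - \<kappa>)\<close>.\<close>
    have "(\<lambda>z. \<phi>1 z c * (\<theta>1 z c + M1 z * \<phi>1 z c) - \<phi>0 z c * (\<theta>0 z c + M0 z * \<phi>0 z c)) \<in> O[?F](\<lambda>z. 1 / freq z)"
      by (intro sum_in_bigo W0.green_diagonal_bigo[OF \<delta> c0] W1.green_diagonal_bigo[OF \<delta> c1])
    from landau_o.big.mult[OF this landau_o.big_refl[of "\<lambda>z. 1 / (\<phi>0 z c)\<^sup>2"]]
    have "(\<lambda>z. (\<phi>1 z c * (\<theta>1 z c + M1 z * \<phi>1 z c) - \<phi>0 z c * (\<theta>0 z c + M0 z * \<phi>0 z c)) * (1 / (\<phi>0 z c)\<^sup>2))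
        \<in> O[?F](\<lambda>z. 1 / (freq z * (\<phi>0 z c)\<^sup>2))" by simp
    moreover have "eventually (\<lambda>z. (\<phi>1 z c * (\<theta>1 z c + M1 z * \<phi>1 z c) - \<phi>0 z c * (\<theta>0 z c + M0 z * \<phi>0 z c)) * (1 / (\<phi>0 z c)\<^sup>2)
        = M1 z - M0 z - \<kappa> z) ?F"
      using eventually_sector[OF \<delta>]
    proof eventually_elim
      case (elim z)
      then have p: "\<phi>0 z c \<noteq> 0" using W0.phi_sign(1)[OF c0] by blast
      have "\<phi>1 z c * (\<theta>1 z c + M1 z * \<phi>1 z c) - \<phi>0 z c * (\<theta>0 z c + M0 z * \<phi>0 z c)
          = \<phi>0 z c * ((M1 z - M0 z) * \<phi>0 z c - (\<theta>0 z c - \<theta>1 z c))"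
        by (simp add: eq algebra_simps)
      also have "\<dots> = (M1 z - M0 z - \<kappa> z) * (\<phi>0 z c)\<^sup>2"
        unfolding \<kappa>[symmetric] by (simp add: algebra_simps power2_eq_square)
      finally show ?case using p by simp
    qed
    ultimately show ?thesis by (rule landau_o.big.in_cong[THEN iffD1, rotated])
  qed
  ultimately show ?thesis by blast
qed

text \<open>The quotient of the two majorants is \<open>(\<phi>0(d)/\<phi>0(c))^2 / k\<close>, and
  both of its factors tend to 0 since \<open>d < c\<close>.\<close>

lemma weyl_asymp_sector_imp_rays:
  assumes c: "c \<in> einterval a b0" and d: "d \<in> einterval a (ereal c)"
    and \<delta>: "0 < \<delta>" "at_infinity_along R \<le> at_infinity_along (sector \<delta>)"
    and bigo: "g \<in> O[at_infinity_along (sector \<delta>)](\<lambda>z. 1 / (freq z * (\<phi>0 z c)\<^sup>2))"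
  shows "g \<in> O[at_infinity_along R](\<lambda>z. 1 / (\<phi>0 z d)\<^sup>2)"
proof -
  let ?F = "at_infinity_along (sector \<delta>)"
  have d0: "d \<in> einterval a b0" "d < c"
    using d einterval_subset(1)[OF c] by (auto simp: einterval_def)
  have "((\<lambda>z. inverse (cmod (freq z))) \<longlongrightarrow> 0) ?F"
    by (intro tendsto_inverse_0_at_top cmod_freq_at_top)
  then have "((\<lambda>z. cmod (inverse (freq z))) \<longlongrightarrow> 0) ?F" by (simp add: norm_inverse)
  then have "((\<lambda>z. inverse (freq z)) \<longlongrightarrow> 0) ?F" by (rule tendsto_norm_zero_cancel)
  then have "((\<lambda>z. inverse (freq z) * (\<phi>0 z d / \<phi>0 z c)\<^sup>2) \<longlongrightarrow> 0 * 0\<^sup>2) ?F"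
    by (intro tendsto_mult tendsto_power W0.ratio_tendsto_0 \<delta> d0 c)
  then have "(\<lambda>z. inverse (freq z) * (\<phi>0 z d / \<phi>0 z c)\<^sup>2) \<in> O[?F](\<lambda>z. 1)"
    by (intro bigoI_tendsto[where c = 0]) auto
  from landau_o.big.mult[OF this landau_o.big_refl[of "\<lambda>z. 1 / (\<phi>0 z d)\<^sup>2"]]
  have "(\<lambda>z. inverse (freq z) * (\<phi>0 z d / \<phi>0 z c)\<^sup>2 * (1 / (\<phi>0 z d)\<^sup>2)) \<in> O[?F](\<lambda>z. 1 / (\<phi>0 z d)\<^sup>2)" by simp
  moreover have "eventually (\<lambda>z. inverse (freq z) * (\<phi>0 z d / \<phi>0 z c)\<^sup>2 * (1 / (\<phi>0 z d)\<^sup>2) = 1 / (freq z * (\<phi>0 z c)\<^sup>2)) ?F"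
    using eventually_sector[OF \<delta>(1)]
    by eventually_elim (use W0.phi_sign(1)[OF d0(1)] in \<open>simp add: power_divide inverse_eq_divide\<close>)
  ultimately have "(\<lambda>z. 1 / (freq z * (\<phi>0 z c)\<^sup>2)) \<in> O[?F](\<lambda>z. 1 / (\<phi>0 z d)\<^sup>2)"
    by (rule landau_o.big.in_cong[THEN iffD1, rotated])
  with bigo have "g \<in> O[?F](\<lambda>z. 1 / (\<phi>0 z d)\<^sup>2)" by (rule landau_o.big_trans)
  then show ?thesis by (rule landau_o.big.filter_mono[OF \<delta>(2)])
qed

section \<open>From the Weyl functions to the potentials\<close>

text \<open>With Green diagonals \<open>G0\<close> and \<open>G1\<close> the left side is
  \<open>(\<phi>1/\<phi>0) G0 - (\<phi>0/\<phi>1) G1 + (M1 - M0 - f) \<phi>0^2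
  (\<phi>1/\<phi>0)\<close> at \<open>d\<close>. The diagonals tend to 0 and the quotients to 1. In
  the last term \<open>d < d'\<close> makes \<open>(\<phi>0(d)/\<phi>0(d'))^2\<close> tend to
  0.\<close>

lemma weyl_asymp_imp_identity:
  assumes d: "d \<in> einterval a (ereal d')" and d': "d' \<in> einterval a b0 \<inter> einterval a b1"
    and f: "f holomorphic_on UNIV" "growth_order f \<le> ereal s"
    and bigo: "(\<lambda>z. M1 z - M0 z - f z) \<in> O[at_infinity_along R](\<lambda>z. 1 / (\<phi>0 z d')\<^sup>2)"
  shows "\<phi>1 z d * \<theta>0 z d - \<phi>0 z d * \<theta>1 z d - f z * (\<phi>0 z d * \<phi>1 z d) = 0"
proof -
  define H where "H = (\<lambda>z. \<phi>1 z d * \<theta>0 z d - \<phi>0 z d * \<theta>1 z d - f z * (\<phi>0 z d * \<phi>1 z d))"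
  have dd: "d \<in> einterval a b0 \<inter> einterval a b1" "d < d'"
    using d d' einterval_subset(1)[of d' a b0] einterval_subset(1)[of d' a b1] by (auto simp: einterval_def)
  then have d0: "d \<in> einterval a b0" and d1: "d \<in> einterval a b1" by auto
  let ?F = "at_infinity_along R"
  obtain \<delta> where \<delta>: "0 < \<delta>" "?F \<le> at_infinity_along (sector \<delta>)" by (rule rays_in_sector)
  have "((\<lambda>z. inverse (cmod (freq z))) \<longlongrightarrow> 0) ?F"
    by (intro tendsto_inverse_0_at_top cmod_freq_at_top)
  then have "((\<lambda>z. cmod (1 / freq z)) \<longlongrightarrow> 0) ?F" by (simp add: norm_divide inverse_eq_divide)
  then have k0: "((\<lambda>z. 1 / freq z) \<longlongrightarrow> 0) ?F" by (rule tendsto_norm_zero_cancel)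
  have bigo_0: "(g \<longlongrightarrow> 0) ?F" if gh: "g \<in> O[?F](h)" "(h \<longlongrightarrow> 0) ?F" for g h :: "complex \<Rightarrow> complex"
  proof -
    obtain C where "eventually (\<lambda>z. cmod (g z) \<le> C * cmod (h z)) ?F" using gh(1) by (elim landau_o.bigE)
    moreover have "((\<lambda>z. C * cmod (h z)) \<longlongrightarrow> 0) ?F"
      using tendsto_mult[OF tendsto_const tendsto_norm[OF gh(2)], of C] by simp
    ultimately show ?thesis by (rule Lim_null_comparison)
  qed
  have G: "((\<lambda>z. \<phi>0 z d * (\<theta>0 z d + M0 z * \<phi>0 z d)) \<longlongrightarrow> 0) ?F" "((\<lambda>z. \<phi>1 z d * (\<theta>1 z d + M1 z * \<phi>1 z d)) \<longlongrightarrow> 0) ?F"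
    using landau_o.big.filter_mono[OF \<delta>(2) W0.green_diagonal_bigo[OF \<delta>(1) d0]]
      landau_o.big.filter_mono[OF \<delta>(2) W1.green_diagonal_bigo[OF \<delta>(1) d1]]
    by (auto intro: bigo_0[OF _ k0])
  note r = phi_ratio_tendsto_1[OF dd(1)]
  have r': "((\<lambda>z. \<phi>0 z d / \<phi>1 z d) \<longlongrightarrow> 1) ?F"
    using tendsto_divide[OF tendsto_const r, of 1] by simp
  have ratio: "((\<lambda>z. \<phi>0 z d / \<phi>0 z d') \<longlongrightarrow> 0) ?F"
    by (rule tendsto_mono[OF \<delta>(2) W0.ratio_tendsto_0[OF \<delta>(1) d0 _ dd(2)]]) (use d' in auto)
  have "(\<lambda>z. (M1 z - M0 z - f z) * (\<phi>0 z d)\<^sup>2) \<in> O[?F](\<lambda>z. 1 / (\<phi>0 z d')\<^sup>2 * (\<phi>0 z d)\<^sup>2)"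
    by (intro landau_o.big.mult bigo landau_o.big_refl)
  moreover have "((\<lambda>z. 1 / (\<phi>0 z d')\<^sup>2 * (\<phi>0 z d)\<^sup>2) \<longlongrightarrow> 0) ?F"
    using tendsto_power[OF ratio, of 2] by (simp add: power_divide)
  ultimately have D: "((\<lambda>z. (M1 z - M0 z - f z) * (\<phi>0 z d)\<^sup>2) \<longlongrightarrow> 0) ?F" by (rule bigo_0)
  have "((\<lambda>z. \<phi>1 z d / \<phi>0 z d * (\<phi>0 z d * (\<theta>0 z d + M0 z * \<phi>0 z d)) - \<phi>0 z d / \<phi>1 z d * (\<phi>1 z d * (\<theta>1 z d + M1 z * \<phi>1 z d))
      + (M1 z - M0 z - f z) * (\<phi>0 z d)\<^sup>2 * (\<phi>1 z d / \<phi>0 z d)) \<longlongrightarrow> 1 * 0 - 1 * 0 + 0 * 1) ?F"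
    by (intro tendsto_intros r r' G D)
  then have "((\<lambda>z. \<phi>1 z d / \<phi>0 z d * (\<phi>0 z d * (\<theta>0 z d + M0 z * \<phi>0 z d)) - \<phi>0 z d / \<phi>1 z d * (\<phi>1 z d * (\<theta>1 z d + M1 z * \<phi>1 z d))
      + (M1 z - M0 z - f z) * (\<phi>0 z d)\<^sup>2 * (\<phi>1 z d / \<phi>0 z d)) \<longlongrightarrow> 0) ?F" by simp
  then have "(H \<longlongrightarrow> 0) ?F"
  proof (rule Lim_transform_eventually)
    show "eventually (\<lambda>z. \<phi>1 z d / \<phi>0 z d * (\<phi>0 z d * (\<theta>0 z d + M0 z * \<phi>0 z d)) - \<phi>0 z d / \<phi>1 z d * (\<phi>1 z d * (\<theta>1 z d + M1 z * \<phi>1 z d))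
      + (M1 z - M0 z - f z) * (\<phi>0 z d)\<^sup>2 * (\<phi>1 z d / \<phi>0 z d) = H z) ?F"
      using eventually_nonreal
    proof eventually_elim
      case (elim z)
      then have "\<phi>0 z d \<noteq> 0" "\<phi>1 z d \<noteq> 0" using W0.phi_sign(1)[OF d0] W1.phi_sign(1)[OF d1] by auto
      then show ?case by (simp add: H_def power2_eq_square algebra_simps)
    qed
  qed
  moreover have "H holomorphic_on UNIV"
    unfolding H_def by (intro holomorphic_intros f W0.holo[OF d0] W1.holo[OF d1])
  moreover have "growth_order H \<le> ereal s"
    unfolding H_def using s by (intro growth_order_diff_le growth_order_mult_le order[OF dd(1)] f) auto
  ultimately have "H z = 0" using s R by (intro entire_tendsto_along_rays_imp_const) auto
  then show ?thesis by (simp add: H_def)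
qed

lemma vector_derivative_eq_0:
  fixes g :: "real \<Rightarrow> complex"
  assumes "(g has_vector_derivative g') (at x)" "open S" "x \<in> S" "\<And>y. y \<in> S \<Longrightarrow> g y = 0"
  shows "g' = 0"
proof -
  have "((\<lambda>_. 0) has_vector_derivative g') (at x)"
    by (rule has_vector_derivative_transform_within_open[OF assms(1-3)]) (use assms(4) in auto)
  then show ?thesis
    using vector_derivative_unique_at[OF _ has_vector_derivative_const] by blast
qed

text \<open>\<open>f\<close> belongs to \<open>d'\<close> and is thus the same for all points left
  of \<open>d'\<close>, which permits differentiation in \<open>x\<close>. Denominators are cleared:
  \<open>D\<close> and \<open>B\<close> are the derivatives of
  \<open>\<phi>1 \<theta>0 - \<phi>0 \<theta>1\<close> and of
  \<open>\<phi>0 \<phi>1\<close>.\<close>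

lemma weyl_asymp_imp_phi_square_eq:
  assumes x: "x \<in> einterval a (ereal d')" and d': "d' \<in> einterval a b0 \<inter> einterval a b1"
    and f: "f holomorphic_on UNIV" "growth_order f \<le> ereal s"
    and bigo: "(\<lambda>z. M1 z - M0 z - f z) \<in> O[at_infinity_along R](\<lambda>z. 1 / (\<phi>0 z d')\<^sup>2)"
    and z: "Im z \<noteq> 0"
  shows "(\<phi>0 z x)\<^sup>2 = (\<phi>1 z x)\<^sup>2"
proof -
  have x0: "x \<in> einterval a b0" and x1: "x \<in> einterval a b1"
    using x d' einterval_subset(1)[of d' a b0] einterval_subset(1)[of d' a b1] by auto
  note id = weyl_asymp_imp_identity[OF _ d' f bigo, of _ z]
  have "((\<lambda>t. \<phi>1 z t * \<theta>0 z t - \<phi>0 z t * \<theta>1 z t - f z * (\<phi>0 z t * \<phi>1 z t)) has_vector_derivative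
      ((\<phi>1 z x * dx (\<theta>0 z) x + dx (\<phi>1 z) x * \<theta>0 z x) - (\<phi>0 z x * dx (\<theta>1 z) x + dx (\<phi>0 z) x * \<theta>1 z x)
        - f z * (\<phi>0 z x * dx (\<phi>1 z) x + dx (\<phi>0 z) x * \<phi>1 z x))) (at x)"
    by (rule has_vector_derivative_diff[OF
          has_vector_derivative_diff[OF has_vector_derivative_mult[OF W1.reg(2)[OF x1] W0.reg(1)[OF x0]]
            has_vector_derivative_mult[OF W0.reg(2)[OF x0] W1.reg(1)[OF x1]]]
          has_vector_derivative_mult_right[OF has_vector_derivative_mult[OF W0.reg(2)[OF x0] W1.reg(2)[OF x1]]]])
  then have 0: "(\<phi>1 z x * dx (\<theta>0 z) x + dx (\<phi>1 z) x * \<theta>0 z x) - (\<phi>0 z x * dx (\<theta>1 z) x + dx (\<phi>0 z) x * \<theta>1 z x)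
        - f z * (\<phi>0 z x * dx (\<phi>1 z) x + dx (\<phi>0 z) x * \<phi>1 z x) = 0"
    by (rule vector_derivative_eq_0[OF _ open_einterval x id])
  have fz: "f z * (\<phi>0 z x * \<phi>1 z x) = \<phi>1 z x * \<theta>0 z x - \<phi>0 z x * \<theta>1 z x" using id[OF x] by simp
  define D where "D = (\<phi>1 z x * dx (\<theta>0 z) x + dx (\<phi>1 z) x * \<theta>0 z x) - (\<phi>0 z x * dx (\<theta>1 z) x + dx (\<phi>0 z) x * \<theta>1 z x)"
  define B where "B = \<phi>0 z x * dx (\<phi>1 z) x + dx (\<phi>0 z) x * \<phi>1 z x"
  have "D = f z * B" using 0 by (simp add: D_def B_def)
  \<comment> \<open>The factor \<open>\<phi>0 \<phi>1\<close> lets the undifferentiated identity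
    eliminate \<open>f\<close>; what remains are the two Wronskians.\<close>
  then have "0 = \<phi>0 z x * \<phi>1 z x * D - f z * (\<phi>0 z x * \<phi>1 z x) * B" by simp
  also have "\<dots> = \<phi>0 z x * \<phi>1 z x * D - (\<phi>1 z x * \<theta>0 z x - \<phi>0 z x * \<theta>1 z x) * B"
    unfolding fz ..
  also have "\<dots> = (\<phi>0 z x)\<^sup>2 * (\<theta>1 z x * dx (\<phi>1 z) x - dx (\<theta>1 z) x * \<phi>1 z x)
      - (\<phi>1 z x)\<^sup>2 * (\<theta>0 z x * dx (\<phi>0 z) x - dx (\<theta>0 z) x * \<phi>0 z x)"
    by (simp add: D_def B_def algebra_simps power2_eq_square)
  also have "\<dots> = (\<phi>0 z x)\<^sup>2 - (\<phi>1 z x)\<^sup>2"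
    unfolding W0.wronskian_1[OF x0] W1.wronskian_1[OF x1] by simp
  finally show ?thesis by simp
qed

text \<open>Each \<open>x\<close> gets its own \<open>d\<close> between \<open>x\<close> and
  \<open>c\<close> and so its own \<open>f\<close>, but the equality of squares no longer contains
  \<open>f\<close>. Its derivative makes the Wronskian vanish, and the derivative of the Wronskian
  is \<open>(q1 - q0) \<phi>0 \<phi>1\<close>.\<close>

lemma weyl_asymp_imp_potentials_eq:
  assumes c: "c \<in> einterval a b0 \<inter> einterval a b1"
    and asymp: "\<And>d. d \<in> einterval a (ereal c) \<Longrightarrow> \<exists>f. f holomorphic_on UNIV \<and> growth_order f \<le> ereal s \<and>
        (\<lambda>z. M1 z - M0 z - f z) \<in> O[at_infinity_along R](\<lambda>z. 1 / (\<phi>0 z d)\<^sup>2)"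
  shows "AE x in lebesgue_on (einterval a (ereal c)). q0 x = q1 x"
    and "(wronskian (\<phi>0 z) (\<phi>1 z) \<longlongrightarrow> 0) (to_left_end a)"
proof -
  let ?S = "einterval a (ereal c)"
  have sub: "?S \<subseteq> einterval a b0" "?S \<subseteq> einterval a b1"
    using c einterval_subset(1)[of c a b0] einterval_subset(1)[of c a b1] by auto
  have ac: "a < ereal c" using c by (simp add: einterval_def)
  have sq: "(\<phi>0 z x)\<^sup>2 - (\<phi>1 z x)\<^sup>2 = 0" if x: "x \<in> ?S" and z: "Im z \<noteq> 0" for x z
  proof -
    have xc: "a < ereal x" "ereal x < ereal c" using x by (auto simp: einterval_def)
    obtain d where "d \<in> einterval (ereal x) (ereal c)" using einterval_nonempty[OF xc(2)] by blast
    then have d: "x \<in> einterval a (ereal d)" "d \<in> ?S"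
      using xc less_trans[OF xc(1), of "ereal d"] by (auto simp: einterval_def)
    obtain f where f: "f holomorphic_on UNIV" "growth_order f \<le> ereal s"
      "(\<lambda>z. M1 z - M0 z - f z) \<in> O[at_infinity_along R](\<lambda>z. 1 / (\<phi>0 z d)\<^sup>2)" using asymp[OF d(2)] by blast
    have "d \<in> einterval a b0 \<inter> einterval a b1" using d(2) sub by blast
    from weyl_asymp_imp_phi_square_eq[OF d(1) this f z] show ?thesis by simp
  qed
  have W0: "wronskian (\<phi>0 z) (\<phi>1 z) x = 0" if x: "x \<in> ?S" and z: "Im z \<noteq> 0" for x z
  proof -
    have xx: "x \<in> einterval a b0" "x \<in> einterval a b1" using x sub by auto
    have "((\<lambda>t. (\<phi>0 z t)\<^sup>2 - (\<phi>1 z t)\<^sup>2) has_vector_derivative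
        ((\<phi>0 z x * dx (\<phi>0 z) x + dx (\<phi>0 z) x * \<phi>0 z x) - (\<phi>1 z x * dx (\<phi>1 z) x + dx (\<phi>1 z) x * \<phi>1 z x))) (at x)"
      unfolding power2_eq_square
      by (rule has_vector_derivative_diff[OF has_vector_derivative_mult[OF W0.reg(2)[OF xx(1)] W0.reg(2)[OF xx(1)]]
            has_vector_derivative_mult[OF W1.reg(2)[OF xx(2)] W1.reg(2)[OF xx(2)]]])
    from vector_derivative_eq_0[OF this open_einterval x sq[OF _ z]]
    have eq: "\<phi>0 z x * dx (\<phi>0 z) x = \<phi>1 z x * dx (\<phi>1 z) x" by (simp add: mult.commute)
    \<comment> \<open>Multiplying by the nonzero \<open>\<phi>0 \<phi>1\<close> avoids
      distinguishing \<open>\<phi>1 = \<phi>0\<close> from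
      \<open>\<phi>1 = - \<phi>0\<close>.\<close>
    have "\<phi>0 z x * \<phi>1 z x * wronskian (\<phi>0 z) (\<phi>1 z) x
        = (\<phi>0 z x)\<^sup>2 * (\<phi>1 z x * dx (\<phi>1 z) x) - (\<phi>1 z x)\<^sup>2 * (\<phi>0 z x * dx (\<phi>0 z) x)"
      by (simp add: wronskian_def algebra_simps power2_eq_square)
    also have "\<dots> = ((\<phi>0 z x)\<^sup>2 - (\<phi>1 z x)\<^sup>2) * (\<phi>1 z x * dx (\<phi>1 z) x)"
      unfolding eq by (simp add: algebra_simps)
    finally show ?thesis
      using sq[OF x z] W0.phi_sign(1)[OF xx(1) z] W1.phi_sign(1)[OF xx(2) z] by simp
  qed
  have "wronskian (\<phi>0 z) (\<phi>1 z) x = 0" if x: "x \<in> ?S" for x z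
  proof (rule holomorphic_eq_0_if_nonreal[where h = "\<lambda>z. wronskian (\<phi>0 z) (\<phi>1 z) x"])
    have "x \<in> einterval a b0" "x \<in> einterval a b1" using x sub by auto
    then show "(\<lambda>z. wronskian (\<phi>0 z) (\<phi>1 z) x) holomorphic_on UNIV"
      unfolding wronskian_def by (intro holomorphic_intros W0.holo W1.holo)
  qed (rule W0[OF x])
  then have "eventually (\<lambda>x. wronskian (\<phi>0 z) (\<phi>1 z) x = 0) (to_left_end a)"
    by (rule eventually_mono[OF eventually_to_left_end[OF ac]])
  then show "(wronskian (\<phi>0 z) (\<phi>1 z) \<longlongrightarrow> 0) (to_left_end a)"
    by (rule tendsto_eventually)
  \<comment> \<open>One nonreal parameter is enough for the potentials: at \<open>\<i>\<close>
    neither solution has zeros. The second derivatives exist almost everywhere.\<close>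
  have AC: "AC_loc (einterval a b0) (dx (\<phi>0 \<i>))" "AC_loc (einterval a b1) (dx (\<phi>1 \<i>))"
    using sl_solutionD(1)[OF W0.sol(2)] sl_solutionD(1)[OF W1.sol(2)] by (auto simp: sl_regular_def)
  have "AE x in lebesgue_on ?S. x \<in> ?S" by (rule AE_I2) simp
  moreover note AE_lebesgue_on_subset[OF AC_loc_ae_derivative(1)[OF AC(1)] sub(1) einterval_lebesgue einterval_lebesgue]
    AE_lebesgue_on_subset[OF AC_loc_ae_derivative(1)[OF AC(2)] sub(2) einterval_lebesgue einterval_lebesgue]
    AE_lebesgue_on_subset[OF sl_solutionD(2)[OF W0.sol(2)[of \<i>]] sub(1) einterval_lebesgue einterval_lebesgue]
    AE_lebesgue_on_subset[OF sl_solutionD(2)[OF W1.sol(2)[of \<i>]] sub(2) einterval_lebesgue einterval_lebesgue]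
  ultimately show "AE x in lebesgue_on ?S. q0 x = q1 x"
  proof eventually_elim
    case (elim x)
    have xx: "x \<in> einterval a b0" "x \<in> einterval a b1" using elim(1) sub by auto
    have "(wronskian (\<phi>0 \<i>) (\<phi>1 \<i>) has_vector_derivative
      ((\<phi>0 \<i> x * dx (dx (\<phi>1 \<i>)) x + dx (\<phi>0 \<i>) x * dx (\<phi>1 \<i>) x) - (dx (\<phi>0 \<i>) x * dx (\<phi>1 \<i>) x + dx (dx (\<phi>0 \<i>)) x * \<phi>1 \<i> x))) (at x)"
      unfolding wronskian_def[abs_def]
      by (rule has_vector_derivative_diff[OF has_vector_derivative_mult[OF W0.reg(2)[OF xx(1)] elim(3)]
            has_vector_derivative_mult[OF elim(2) W1.reg(2)[OF xx(2)]]])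
    from vector_derivative_eq_0[OF this open_einterval elim(1) W0]
    have "\<phi>0 \<i> x * dx (dx (\<phi>1 \<i>)) x = dx (dx (\<phi>0 \<i>)) x * \<phi>1 \<i> x" by simp
    then have "\<phi>0 \<i> x * \<phi>1 \<i> x * of_real (q1 x) = \<phi>0 \<i> x * \<phi>1 \<i> x * of_real (q0 x)"
      unfolding elim by (simp add: algebra_simps)
    then show ?case using W0.phi_sign(1)[OF xx(1), of \<i>] W1.phi_sign(1)[OF xx(2), of \<i>] by simp
  qed
qed

end

theorem theorem4p2:
  fixes a b0 b1 :: ereal and q0 q1 :: "real \<Rightarrow> real"
    and \<alpha>0 \<beta>0 \<alpha>1 \<beta>1 :: boundary_condition
    and \<theta>0 \<phi>0 \<theta>1 \<phi>1 :: "complex \<Rightarrow> real \<Rightarrow> complex"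
    and M0 M1 :: "complex \<Rightarrow> complex"
    and s c :: real and R :: "complex set"
  assumes "a < b0" and "a < b1"
    and "loc_integrable (einterval a b0) q0" and "loc_integrable (einterval a b1) q1"
    and "separated_self_adjoint a b0 q0 \<alpha>0 \<beta>0" and "separated_self_adjoint a b1 q1 \<alpha>1 \<beta>1"
    and "real_entire_system (einterval a b0) q0 \<theta>0 \<phi>0"
    and "real_entire_system (einterval a b1) q1 \<theta>1 \<phi>1"
    and "\<And>z. in_domain_near_left a b0 \<alpha>0 (\<phi>0 z)"
    and "\<And>z. in_domain_near_left a b1 \<alpha>1 (\<phi>1 z)"
    and "singular_weyl_function a b0 q0 \<beta>0 \<theta>0 \<phi>0 M0"
    and "singular_weyl_function a b1 q1 \<beta>1 \<theta>1 \<phi>1 M1"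
    and "s > 0"
    and "solution_order_le (einterval a b0) \<theta>0 s" and "solution_order_le (einterval a b1) \<theta>1 s"
    and "solution_order_le (einterval a b0) \<phi>0 s" and "solution_order_le (einterval a b1) \<phi>1 s"
    and "dissecting_rays (pi / s) R"
    and "\<exists>x \<in> einterval a b0 \<inter> einterval a b1.
           (\<lambda>z. \<phi>1 z x) \<sim>[at_infinity_along R] (\<lambda>z. \<phi>0 z x)"
    and "c \<in> einterval a b0 \<inter> einterval a b1"
  defines "i \<equiv> (AE x in lebesgue_on (einterval a (ereal c)). q0 x = q1 x) \<and>
        (\<forall>z. (wronskian (\<phi>0 z) (\<phi>1 z) \<longlongrightarrow> 0) (to_left_end a))"
    and "ii \<equiv> \<forall>\<delta>>0. \<exists>f. f holomorphic_on UNIV \<and> growth_order f \<le> ereal s \<and>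
        (\<lambda>z. M1 z - M0 z - f z)
          \<in> O[at_infinity_along {z. \<bar>Im z\<bar> \<ge> \<delta> * \<bar>Re z\<bar>}](\<lambda>z. 1 / (csqrt (- z) * (\<phi>0 z c)\<^sup>2))"
    and "iii \<equiv> \<forall>d \<in> einterval a (ereal c). \<exists>f. f holomorphic_on UNIV \<and> growth_order f \<le> ereal s \<and>
        (\<lambda>z. M1 z - M0 z - f z) \<in> O[at_infinity_along R](\<lambda>z. 1 / (\<phi>0 z d)\<^sup>2)"
  shows "(i \<longleftrightarrow> ii) \<and> (ii \<longleftrightarrow> iii)"
proof -
  interpret weyl_pair a b0 b1 q0 q1 \<alpha>0 \<alpha>1 \<beta>0 \<beta>1 \<theta>0 \<theta>1 \<phi>0 \<phi>1 M0 M1 s R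
    by (intro weyl_pair.intro weyl_system.intro weyl_pair_axioms.intro assms(3-19))
  note c = assms(20)
  have ii_sector: "ii \<longleftrightarrow> (\<forall>\<delta>>0. \<exists>f. f holomorphic_on UNIV \<and> growth_order f \<le> ereal s \<and>
      (\<lambda>z. M1 z - M0 z - f z) \<in> O[at_infinity_along (sector \<delta>)](\<lambda>z. 1 / (freq z * (\<phi>0 z c)\<^sup>2)))"
    unfolding ii_def sector_def freq_def ..
  have "i \<Longrightarrow> ii"
    unfolding i_def ii_sector using potentials_eq_imp_weyl_asymp[OF c] by blast
  moreover have "iii" if ii: ii
    unfolding iii_def
  proof
    fix d assume d: "d \<in> einterval a (ereal c)"
    \<comment> \<open>(ii) is used for a \<open>\<delta>\<close> so small that the sector contains
      all the rays.\<close>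
    obtain \<delta> where \<delta>: "0 < \<delta>" "at_infinity_along R \<le> at_infinity_along (sector \<delta>)" by (rule rays_in_sector)
    then obtain f where f: "f holomorphic_on UNIV" "growth_order f \<le> ereal s"
      "(\<lambda>z. M1 z - M0 z - f z) \<in> O[at_infinity_along (sector \<delta>)](\<lambda>z. 1 / (freq z * (\<phi>0 z c)\<^sup>2))"
      using ii unfolding ii_sector by blast
    then show "\<exists>f. f holomorphic_on UNIV \<and> growth_order f \<le> ereal s \<and>
        (\<lambda>z. M1 z - M0 z - f z) \<in> O[at_infinity_along R](\<lambda>z. 1 / (\<phi>0 z d)\<^sup>2)"
      using weyl_asymp_sector_imp_rays[OF _ d \<delta>] c by blast
  qed
  moreover have "iii \<Longrightarrow> i"
    unfolding i_def iii_def using weyl_asymp_imp_potentials_eq[OF c] by blast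
  ultimately show ?thesis by blast
qed

end
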